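(* The Higson corona functor $\nu\colon\mathbf{CC}\to\mathbf{K}$ is an equivalence of categories, where $\mathbf{CC}$ is the category whose objects are the locally compact spaces with the continuously controlled coarse structures induced by metrizable compactifications and whose morphisms are the coarse maps modulo closeness, and $\mathbf{K}$ is the category of compact metrizable spaces and continuous maps. In particular, two metrizable compactifications $\tilde X_1$ and $\tilde X_2$ of a locally compact space $X$ determine coarsely equivalent continuously controlled coarse structures if and only if their remainders $\tilde X_1\setminus X$ and $\tilde X_2\setminus X$ are homeomorphic.
   Context: A coarse structure on a set $X$ is a collection $\mathcal{E}$ of subsets of $X\times X$, called controlled sets, that contains the diagonal and is closed under taking subsets, inverses $E^{-1}=\{(x,y):(y,x)\in E\}$, compositions $E\circ F=\{(x,z): \exists y,\ (x,y)\in E,\ (y,z)\in F\}$, and finite unions. A subset $B\subset X$ is bounded if $B\times B$ is controlled. A (not necessarily continuous) map $f\colon X\to Y$ of coarse spaces is coarse if $f^{-1}(B)$ is bounded for every bounded $B\subset Y$ and $(f\times f)(E)$ is controlled for every controlled $E\subset X\times X$. Maps $f,g\colon S\to Y$ from a set to a coarse space are close if $\{(f(s),g(s)): s\in S\}$ is controlled. Coarse spaces $X,Y$ are coarsely equivalent if there are coarse maps $f\colon X\to Y$, $g\colon Y\to X$ with $g\circ f$ close to $\mathrm{id}_X$ and $f\circ g$ close to $\mathrm{id}_Y$. Let $X$ be a locally compact Hausdorff space with a Hausdorff compactification $\tilde X$, and $\partial X=\tilde X\setminus X$. The continuously controlled coarse structure on $X$ induced by $\tilde X$: $E\subset X\times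 X$ is controlled iff the closure of $E$ in $\tilde X\times\tilde X$ meets the complement of $X\times X$ only in the diagonal $\Delta_{\partial X}=\{(\omega,\omega):\omega\in\partial X\}$. In it, a set is bounded iff it has compact closure in $X$. A bounded (not necessarily continuous) function $\varphi\colon X\to\mathbb{R}$ is a Higson function if for every controlled $E$ and $\varepsilon>0$ there is a bounded $B\subset X$ with $|\varphi(x)-\varphi(y)|<\varepsilon$ for all $(x,y)\in E\setminus (B\times B)$. $B_h(X)$ denotes the algebra of Higson functions and $C_h(X)$ the subalgebra of continuous ones. The Higson compactification $hX$ is the closure of the image of $X$ under the embedding $e\colon X\to\mathbb{R}^{C_h(X)}$, $e(x)=(\varphi(x))_{\varphi\in C_h(X)}$; the Higson corona is $\nu X=hX\setminus X$. Let $B_0(X)$ be the algebra of bounded real functions on $X$ that vanish at infinity (for each $\varepsilon>0$ there is a compact $K$ with $|\varphi|<\varepsilon$ off $K$) and $C_0(X)$ its subalgebra of continuous functions. For objects $X$ of $\mathbf{CC}$ there are natural isomorphisms $C(\nu X)\cong C_h(X)/C_0(X)\cong B_h(X)/B_0(X)$. A coarse map $f\colon X\to Y$ induces $f^*\colon B_h(Y)\to B_h(X)$, $\varphi\mapsto\varphi\circ f$, with $f^*(B_0(Y))\subset B_0(X)$, hence a homomorphism $C(\nu Y)\to C(\nu X)$, and $\nu f\colon\nu X\to\nu Y$ is the continuous map corresponding to it by Gel'fand–Naimark duality; it depends only on the closeness class of $f$. For an object $X$ of $\mathbf{CC}$ with metrizable compactification $\tilde X$, $\tilde X$ is (equivalent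 to) the Higson compactification, so $\nu X=\tilde X\setminus X$.
   Formalization: The empty space is excluded from CC (it and a point both have empty corona, but no map goes from the point to it, so ν would not be full); the spaces of CC have their points in one arbitrary infinite type, which, from continuum size on, contains all objects up to isomorphism. *)

theory Defs
  imports "HOL-Analysis.Analysis"
begin

section \<open>Categories\<close>

text \<open>Hom-sets need not be disjoint: composition and identities are indexed by objects, and
  \<open>Comp C A B D g f\<close> is the composite of \<open>f : A \<rightarrow> B\<close> and \<open>g : B \<rightarrow> D\<close>.\<close>

record ('o, 'm) precategory =
  Obj :: "'o set"
  Hom :: "'o \<Rightarrow> 'o \<Rightarrow> 'm set"
  Ident :: "'o \<Rightarrow> 'm"
  Comp :: "'o \<Rightarrow> 'o \<Rightarrow> 'o \<Rightarrow> 'm \<Rightarrow> 'm \<Rightarrow> 'm"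

definition is_category :: "('o, 'm) precategory \<Rightarrow> bool" where
  "is_category C \<longleftrightarrow>
     (\<forall>A\<in>Obj C. Ident C A \<in> Hom C A A) \<and>
     (\<forall>A\<in>Obj C. \<forall>B\<in>Obj C. \<forall>D\<in>Obj C. \<forall>f\<in>Hom C A B. \<forall>g\<in>Hom C B D.
        Comp C A B D g f \<in> Hom C A D) \<and>
     (\<forall>A\<in>Obj C. \<forall>B\<in>Obj C. \<forall>f\<in>Hom C A B.
        Comp C A A B f (Ident C A) = f \<and> Comp C A B B (Ident C B) f = f) \<and>
     (\<forall>A\<in>Obj C. \<forall>B\<in>Obj C. \<forall>D\<in>Obj C. \<forall>E\<in>Obj C.
        \<forall>f\<in>Hom C A B. \<forall>g\<in>Hom C B D. \<forall>h\<in>Hom C D E.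
          Comp C A B E (Comp C B D E h g) f = Comp C A D E h (Comp C A B D g f))"

definition is_functor ::
  "('o, 'm) precategory \<Rightarrow> ('p, 'n) precategory \<Rightarrow> ('o \<Rightarrow> 'p) \<Rightarrow> ('o \<Rightarrow> 'o \<Rightarrow> 'm \<Rightarrow> 'n) \<Rightarrow> bool" where
  "is_functor C D Fo Fm \<longleftrightarrow> is_category C \<and> is_category D \<and>
     (\<forall>A\<in>Obj C. Fo A \<in> Obj D) \<and>
     (\<forall>A\<in>Obj C. \<forall>B\<in>Obj C. \<forall>f\<in>Hom C A B. Fm A B f \<in> Hom D (Fo A) (Fo B)) \<and>
     (\<forall>A\<in>Obj C. Fm A A (Ident C A) = Ident D (Fo A)) \<and>
     (\<forall>A\<in>Obj C. \<forall>B\<in>Obj C. \<forall>E\<in>Obj C. \<forall>f\<in>Hom C A B. \<forall>g\<in>Hom C B E.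
        Fm A E (Comp C A B E g f) = Comp D (Fo A) (Fo B) (Fo E) (Fm B E g) (Fm A B f))"

definition is_iso :: "('o, 'm) precategory \<Rightarrow> 'o \<Rightarrow> 'o \<Rightarrow> 'm \<Rightarrow> bool" where
  "is_iso C A B f \<longleftrightarrow> f \<in> Hom C A B \<and>
     (\<exists>g\<in>Hom C B A. Comp C A B A g f = Ident C A \<and> Comp C B A B f g = Ident C B)"

definition naturally_isomorphic ::
  "('o, 'm) precategory \<Rightarrow> ('p, 'n) precategory \<Rightarrow> ('o \<Rightarrow> 'p) \<Rightarrow> ('o \<Rightarrow> 'o \<Rightarrow> 'm \<Rightarrow> 'n)
     \<Rightarrow> ('o \<Rightarrow> 'p) \<Rightarrow> ('o \<Rightarrow> 'o \<Rightarrow> 'm \<Rightarrow> 'n) \<Rightarrow> bool" where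
  "naturally_isomorphic C D Fo Fm Go Gm \<longleftrightarrow>
     (\<exists>\<eta>. (\<forall>A\<in>Obj C. is_iso D (Fo A) (Go A) (\<eta> A)) \<and>
          (\<forall>A\<in>Obj C. \<forall>B\<in>Obj C. \<forall>f\<in>Hom C A B.
             Comp D (Fo A) (Fo B) (Go B) (\<eta> B) (Fm A B f) =
             Comp D (Fo A) (Go A) (Go B) (Gm A B f) (\<eta> A)))"

definition is_equivalence_of_categories ::
  "('o, 'm) precategory \<Rightarrow> ('p, 'n) precategory \<Rightarrow> ('o \<Rightarrow> 'p) \<Rightarrow> ('o \<Rightarrow> 'o \<Rightarrow> 'm \<Rightarrow> 'n) \<Rightarrow> bool" where
  "is_equivalence_of_categories C D Fo Fm \<longleftrightarrow> is_functor C D Fo Fm \<and>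
     (\<exists>Go Gm. is_functor D C Go Gm \<and>
        naturally_isomorphic C C (\<lambda>A. Go (Fo A)) (\<lambda>A B f. Gm (Fo A) (Fo B) (Fm A B f))
          (\<lambda>A. A) (\<lambda>A B f. f) \<and>
        naturally_isomorphic D D (\<lambda>A. Fo (Go A)) (\<lambda>A B f. Fm (Go A) (Go B) (Gm A B f))
          (\<lambda>A. A) (\<lambda>A B f. f))"


section \<open>Coarse spaces\<close>

definition coarse_structure :: "'a set \<Rightarrow> ('a \<times> 'a) set set \<Rightarrow> bool" where
  "coarse_structure S \<E> \<longleftrightarrow> \<E> \<subseteq> Pow (S \<times> S) \<and> Id_on S \<in> \<E> \<and>
     (\<forall>E\<in>\<E>. \<forall>F. F \<subseteq> E \<longrightarrow> F \<in> \<E>) \<and> (\<forall>E\<in>\<E>. E\<inverse> \<in> \<E>) \<and>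
     (\<forall>E\<in>\<E>. \<forall>F\<in>\<E>. E O F \<in> \<E>) \<and> (\<forall>E\<in>\<E>. \<forall>F\<in>\<E>. E \<union> F \<in> \<E>)"

definition coarsely_bounded :: "('a \<times> 'a) set set \<Rightarrow> 'a set \<Rightarrow> bool" where
  "coarsely_bounded \<E> B \<longleftrightarrow> B \<times> B \<in> \<E>"

definition coarse_map ::
  "'a set \<Rightarrow> ('a \<times> 'a) set set \<Rightarrow> 'b set \<Rightarrow> ('b \<times> 'b) set set \<Rightarrow> ('a \<Rightarrow> 'b) \<Rightarrow> bool" where
  "coarse_map S \<E> T \<F> f \<longleftrightarrow> f \<in> S \<rightarrow> T \<and>
     (\<forall>B\<subseteq>T. coarsely_bounded \<F> B \<longrightarrow> coarsely_bounded \<E> {x \<in> S. f x \<in> B}) \<and>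
     (\<forall>E\<in>\<E>. map_prod f f ` E \<in> \<F>)"

definition close_maps :: "'s set \<Rightarrow> ('b \<times> 'b) set set \<Rightarrow> ('s \<Rightarrow> 'b) \<Rightarrow> ('s \<Rightarrow> 'b) \<Rightarrow> bool" where
  "close_maps S \<F> f g \<longleftrightarrow> (\<lambda>s. (f s, g s)) ` S \<in> \<F>"

definition coarsely_equivalent ::
  "'a set \<Rightarrow> ('a \<times> 'a) set set \<Rightarrow> 'b set \<Rightarrow> ('b \<times> 'b) set set \<Rightarrow> bool" where
  "coarsely_equivalent S \<E> T \<F> \<longleftrightarrow>
     (\<exists>f g. coarse_map S \<E> T \<F> f \<and> coarse_map T \<F> S \<E> g \<and>
            close_maps S \<E> (g \<circ> f) id \<and> close_maps T \<F> (f \<circ> g) id)"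


section \<open>The continuously controlled coarse structure\<close>

definition compactification :: "'a topology \<Rightarrow> 'c topology \<Rightarrow> ('a \<Rightarrow> 'c) \<Rightarrow> bool" where
  "compactification X K i \<longleftrightarrow> compact_space K \<and> Hausdorff_space K \<and> embedding_map X K i \<and>
     K closure_of (i ` topspace X) = topspace K"

definition remainder :: "'a topology \<Rightarrow> 'c topology \<Rightarrow> ('a \<Rightarrow> 'c) \<Rightarrow> 'c set" where
  "remainder X K i = topspace K - i ` topspace X"

definition cc_structure :: "'a topology \<Rightarrow> 'c topology \<Rightarrow> ('a \<Rightarrow> 'c) \<Rightarrow> ('a \<times> 'a) set set" where
  "cc_structure X K i = {E. E \<subseteq> topspace X \<times> topspace X \<and>
     (prod_topology K K closure_of (map_prod i i ` E)) - (i ` topspace X \<times> i ` topspace X)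
       \<subseteq> Id_on (remainder X K i)}"


section \<open>Higson functions and the Higson corona\<close>

text \<open>A space with a coarse structure is a pair \<open>(X, \<E>)\<close>. Functions on \<open>X\<close> are represented by
  functions that are extensional on \<open>topspace X\<close>.\<close>

type_synonym 'a coarse_top = "'a topology \<times> ('a \<times> 'a) set set"

fun B_h :: "'a coarse_top \<Rightarrow> ('a \<Rightarrow> real) set" where
  "B_h (X, \<E>) = {\<phi> \<in> extensional (topspace X). bounded (\<phi> ` topspace X) \<and>
     (\<forall>E\<in>\<E>. \<forall>\<epsilon>>0. \<exists>B\<subseteq>topspace X. coarsely_bounded \<E> B \<and>
        (\<forall>(x, y) \<in> E - B \<times> B. \<bar>\<phi> x - \<phi> y\<bar> < \<epsilon>))}"

fun C_h :: "'a coarse_top \<Rightarrow> ('a \<Rightarrow> real) set" where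
  "C_h (X, \<E>) = {\<phi> \<in> B_h (X, \<E>). continuous_map X euclideanreal \<phi>}"

definition B_0 :: "'a topology \<Rightarrow> ('a \<Rightarrow> real) set" where
  "B_0 X = {\<phi> \<in> extensional (topspace X). bounded (\<phi> ` topspace X) \<and>
     (\<forall>\<epsilon>>0. \<exists>C. compactin X C \<and> (\<forall>x\<in>topspace X - C. \<bar>\<phi> x\<bar> < \<epsilon>))}"

fun higson_embedding :: "'a coarse_top \<Rightarrow> 'a \<Rightarrow> (('a \<Rightarrow> real) \<Rightarrow> real)" where
  "higson_embedding (X, \<E>) x = (\<lambda>\<phi>\<in>C_h (X, \<E>). \<phi> x)"

fun higson_compactification :: "'a coarse_top \<Rightarrow> (('a \<Rightarrow> real) \<Rightarrow> real) topology" where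
  "higson_compactification (X, \<E>) =
     subtopology (powertop_real (C_h (X, \<E>)))
       (powertop_real (C_h (X, \<E>)) closure_of (higson_embedding (X, \<E>) ` topspace X))"

fun higson_corona :: "'a coarse_top \<Rightarrow> (('a \<Rightarrow> real) \<Rightarrow> real) topology" where
  "higson_corona (X, \<E>) = subtopology (higson_compactification (X, \<E>))
     (topspace (higson_compactification (X, \<E>)) - higson_embedding (X, \<E>) ` topspace X)"

text \<open>\<open>corona_class (X, \<E>) \<phi> \<psi>\<close>: the class of \<open>\<phi> \<in> B_h(X)\<close> in \<open>B_h(X)/B_0(X)\<close> and the function
  \<open>\<psi> \<in> C(\<nu>X)\<close> correspond under \<open>B_h(X)/B_0(X) \<cong> C_h(X)/C_0(X) \<cong> C(\<nu>X)\<close>. Here the second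
  isomorphism extends \<open>\<phi>' \<in> C_h(X)\<close> continuously to the Higson compactification, the extension
  being the coordinate function \<open>p \<mapsto> p \<phi>'\<close>, and restricts to \<open>\<nu>X\<close>.\<close>

fun corona_class :: "'a coarse_top \<Rightarrow> ('a \<Rightarrow> real) \<Rightarrow> ((('a \<Rightarrow> real) \<Rightarrow> real) \<Rightarrow> real) \<Rightarrow> bool" where
  "corona_class (X, \<E>) \<phi> \<psi> \<longleftrightarrow> \<phi> \<in> B_h (X, \<E>) \<and>
     continuous_map (higson_corona (X, \<E>)) euclideanreal \<psi> \<and>
     (\<exists>\<phi>'\<in>C_h (X, \<E>). (\<lambda>x\<in>topspace X. \<phi> x - \<phi>' x) \<in> B_0 X \<and>
        (\<forall>p\<in>topspace (higson_corona (X, \<E>)). \<psi> p = p \<phi>'))"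

text \<open>The Gelfand dual of the homomorphism \<open>C(\<nu>Y) \<rightarrow> C(\<nu>X)\<close> induced by \<open>\<phi> \<mapsto> \<phi> \<circ> f\<close>: the
  continuous map \<open>h : \<nu>X \<rightarrow> \<nu>Y\<close> such that this homomorphism is \<open>\<psi> \<mapsto> \<psi> \<circ> h\<close>.\<close>

definition higson_corona_map ::
  "'a coarse_top \<Rightarrow> 'b coarse_top \<Rightarrow> ('a \<Rightarrow> 'b)
     \<Rightarrow> (('a \<Rightarrow> real) \<Rightarrow> real) \<Rightarrow> (('b \<Rightarrow> real) \<Rightarrow> real)" where
  "higson_corona_map A B f = (THE h.
     continuous_map (higson_corona A) (higson_corona B) h \<and>
     h \<in> extensional (topspace (higson_corona A)) \<and>
     (\<forall>\<phi> \<psi>. corona_class B \<phi> \<psi> \<longrightarrow>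
        corona_class A (restrict (\<phi> \<circ> f) (topspace (fst A))) (\<psi> \<circ> h)))"


section \<open>The categories and the functor\<close>

fun coarse_maps :: "'a coarse_top \<Rightarrow> 'b coarse_top \<Rightarrow> ('a \<Rightarrow> 'b) set" where
  "coarse_maps (X, \<E>) (Y, \<F>) =
     {f \<in> extensional (topspace X). coarse_map (topspace X) \<E> (topspace Y) \<F> f}"

fun closeness :: "'a coarse_top \<Rightarrow> 'b coarse_top \<Rightarrow> (('a \<Rightarrow> 'b) \<times> ('a \<Rightarrow> 'b)) set" where
  "closeness (X, \<E>) (Y, \<F>) =
     {(f, g). f \<in> coarse_maps (X, \<E>) (Y, \<F>) \<and> g \<in> coarse_maps (X, \<E>) (Y, \<F>) \<and>
              close_maps (topspace X) \<F> f g}"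

text \<open>All spaces underlying the objects have their points in \<open>'a\<close>. The metrizable compactification
  is taken on the type \<open>nat \<Rightarrow> real\<close>; this loses nothing, see \<open>CC_objI\<close> below. The empty space is
  excluded: it and a one-point space both have empty corona, but a nonempty space has no map to
  the empty one, so with the empty space as an object the corona functor would not be full.\<close>

definition CC :: "('a coarse_top, ('a \<Rightarrow> 'a) set) precategory" where
  "CC = \<lparr>
     Obj = {(X, \<E>). topspace X \<noteq> {} \<and> locally_compact_space X \<and> Hausdorff_space X \<and>
       (\<exists>(K :: (nat \<Rightarrow> real) topology) i.
          compactification X K i \<and> metrizable_space K \<and> \<E> = cc_structure X K i)},
     Hom = (\<lambda>A B. coarse_maps A B // closeness A B),
     Ident = (\<lambda>A. closeness A A `` {restrict id (topspace (fst A))}),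
     Comp = (\<lambda>A B D \<Gamma> \<Phi>. \<Union>f\<in>\<Phi>. \<Union>g\<in>\<Gamma>. closeness A D `` {compose (topspace (fst A)) g f}) \<rparr>"

definition KM :: "('b topology, 'b \<Rightarrow> 'b) precategory" where
  "KM = \<lparr>
     Obj = {Z. compact_space Z \<and> metrizable_space Z},
     Hom = (\<lambda>Y Z. {f \<in> extensional (topspace Y). continuous_map Y Z f}),
     Ident = (\<lambda>Z. restrict id (topspace Z)),
     Comp = (\<lambda>W Y Z g f. compose (topspace W) g f) \<rparr>"

text \<open>On a morphism, i.e. a closeness class, the functor is given by the common value on the
  representatives.\<close>

definition corona_functor_map ::
  "'a coarse_top \<Rightarrow> 'a coarse_top \<Rightarrow> ('a \<Rightarrow> 'a) set
     \<Rightarrow> (('a \<Rightarrow> real) \<Rightarrow> real) \<Rightarrow> (('a \<Rightarrow> real) \<Rightarrow> real)" where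
  "corona_functor_map A B \<Phi> = the_elem (higson_corona_map A B ` \<Phi>)"


section \<open>Sanity checks\<close>

lemma closedin_relcomp:
  assumes "compact_space K" "Hausdorff_space K"
    and "closedin (prod_topology K K) A" "closedin (prod_topology K K) B"
  shows "closedin (prod_topology K K) (A O B)"
proof -
  let ?P = "prod_topology (prod_topology K K) (prod_topology K K)"
  let ?D = "{t \<in> topspace ?P. (snd \<circ> fst) t = (fst \<circ> snd) t}"
  have cont: "continuous_map ?P K (snd \<circ> fst)" "continuous_map ?P K (fst \<circ> snd)"
    "continuous_map ?P K (fst \<circ> fst)" "continuous_map ?P K (snd \<circ> snd)"
    by (auto intro!: continuous_map_compose continuous_map_fst continuous_map_snd)
  have "closedin ?P ?D"
    using closedin_continuous_maps_eq[OF assms(2) cont(1,2)] .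
  moreover have "closedin ?P (A \<times> B)"
    using assms(3,4) by (simp add: closedin_prod_Times_iff)
  ultimately have "closedin ?P (A \<times> B \<inter> ?D)"
    by (rule closedin_Int[rotated])
  moreover have "compact_space ?P"
    using assms(1) by (simp add: compact_space_prod_topology)
  ultimately have "compactin ?P (A \<times> B \<inter> ?D)"
    by (simp add: closedin_compact_space)
  moreover have "continuous_map ?P (prod_topology K K) (\<lambda>t. ((fst \<circ> fst) t, (snd \<circ> snd) t))"
    using cont(3,4) by (intro continuous_map_pairedI) (simp_all add: o_def)
  ultimately have "compactin (prod_topology K K)
      ((\<lambda>t. ((fst \<circ> fst) t, (snd \<circ> snd) t)) ` (A \<times> B \<inter> ?D))"
    by (rule image_compactin)
  moreover have "(\<lambda>t. ((fst \<circ> fst) t, (snd \<circ> snd) t)) ` (A \<times> B \<inter> ?D) = A O B"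
  proof (intro set_eqI iffI)
    fix r assume "r \<in> A O B"
    then obtain x y z where r: "r = (x, z)" "(x, y) \<in> A" "(y, z) \<in> B" by blast
    then have "((x, y), (y, z)) \<in> A \<times> B \<inter> ?D"
      using closedin_subset[OF assms(3)] closedin_subset[OF assms(4)] by auto
    then show "r \<in> (\<lambda>t. ((fst \<circ> fst) t, (snd \<circ> snd) t)) ` (A \<times> B \<inter> ?D)"
      by (rule rev_image_eqI) (simp add: r)
  next
    fix r assume "r \<in> (\<lambda>t. ((fst \<circ> fst) t, (snd \<circ> snd) t)) ` (A \<times> B \<inter> ?D)"
    then show "r \<in> A O B" by auto
  qed
  moreover have "Hausdorff_space (prod_topology K K)"
    using assms(2) by (simp add: Hausdorff_space_prod_topology)
  ultimately show ?thesis
    by (metis compactin_imp_closedin)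
qed

lemma coarse_structure_cc_structure:
  assumes "compactification X K i"
  shows "coarse_structure (topspace X) (cc_structure X K i)"
proof -
  let ?S = "topspace X" and ?P = "prod_topology K K" and ?I = "i ` topspace X"
  let ?m = "map_prod i i"
  have K: "compact_space K" "Hausdorff_space K" and emb: "embedding_map X K i"
    using assms by (auto simp: compactification_def)
  have iK: "i x \<in> topspace K" if "x \<in> ?S" for x
    using emb that by (meson continuous_map_image_subset_topspace embedding_map_imp_homeomorphic_space
        homeomorphic_imp_continuous_map embedding_map_def continuous_map_in_subtopology image_subset_iff)
  have inP: "?m ` E \<subseteq> topspace ?P" if "E \<subseteq> ?S \<times> ?S" for E
    using that iK by auto
  have diag: "Id_on ?S \<in> cc_structure X K i"
  proof -
    have "closedin ?P {t \<in> topspace ?P. fst t = snd t}"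
      using closedin_continuous_maps_eq[OF K(2) continuous_map_fst continuous_map_snd] .
    moreover have "?m ` Id_on ?S \<subseteq> {t \<in> topspace ?P. fst t = snd t}"
      using iK by auto
    ultimately have "?P closure_of (?m ` Id_on ?S) \<subseteq> {t \<in> topspace ?P. fst t = snd t}"
      by (simp add: closure_of_minimal)
    then show ?thesis
      unfolding cc_structure_def remainder_def by (fastforce simp: Id_on_iff)
  qed
  have sub: "F \<in> cc_structure X K i" if "E \<in> cc_structure X K i" "F \<subseteq> E" for E F
  proof -
    have "?P closure_of (?m ` F) \<subseteq> ?P closure_of (?m ` E)"
      using that(2) by (intro closure_of_mono image_mono)
    moreover have "?P closure_of (?m ` E) - ?I \<times> ?I \<subseteq> Id_on (remainder X K i)"
      and "E \<subseteq> ?S \<times> ?S"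
      using that(1) by (simp_all add: cc_structure_def)
    ultimately have "?P closure_of (?m ` F) - ?I \<times> ?I \<subseteq> Id_on (remainder X K i)" "F \<subseteq> ?S \<times> ?S"
      using that(2) by (meson Diff_mono order.trans order_refl)+
    then show ?thesis by (simp add: cc_structure_def)
  qed
  have un: "E \<union> F \<in> cc_structure X K i"
    if "E \<in> cc_structure X K i" "F \<in> cc_structure X K i" for E F
    using that unfolding cc_structure_def by (simp add: image_Un Un_Diff)
  have inv: "E\<inverse> \<in> cc_structure X K i" if "E \<in> cc_structure X K i" for E
  proof -
    let ?s = "\<lambda>(x, y). (y, x)"
    have E: "E \<subseteq> ?S \<times> ?S"
      and cl: "?P closure_of (?m ` E) - ?I \<times> ?I \<subseteq> Id_on (remainder X K i)"
      using that by (auto simp: cc_structure_def)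
    have "?P closure_of (?s ` (?m ` E)) = ?s ` (?P closure_of (?m ` E))"
      using homeomorphic_map_closure_of[OF homeomorphic_map_swap inP[OF E]] .
    moreover have "?s ` (?m ` E) = ?m ` (E\<inverse>)"
      by force
    ultimately have "?P closure_of (?m ` (E\<inverse>)) = ?s ` (?P closure_of (?m ` E))" by simp
    with E cl show ?thesis
      unfolding cc_structure_def by (auto simp: Id_on_iff)
  qed
  have comp: "E O F \<in> cc_structure X K i"
    if "E \<in> cc_structure X K i" "F \<in> cc_structure X K i" for E F
  proof -
    let ?A = "?P closure_of (?m ` E)" and ?B = "?P closure_of (?m ` F)"
    have EF: "E \<subseteq> ?S \<times> ?S" "F \<subseteq> ?S \<times> ?S"
      and cl: "?A - ?I \<times> ?I \<subseteq> Id_on (remainder X K i)" "?B - ?I \<times> ?I \<subseteq> Id_on (remainder X K i)"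
      using that by (auto simp: cc_structure_def)
    have "?m ` E \<subseteq> ?A" "?m ` F \<subseteq> ?B"
      using inP EF by (simp_all add: closure_of_subset)
    then have "?m ` (E O F) \<subseteq> ?A O ?B"
      by fastforce
    then have c: "?P closure_of (?m ` (E O F)) \<subseteq> ?A O ?B"
      by (intro closure_of_minimal closedin_relcomp K closedin_closure_of)
    have "(a, c) \<in> Id_on (remainder X K i)"
      if ab: "(a, b) \<in> ?A" and bc: "(b, c) \<in> ?B" and ac: "(a, c) \<notin> ?I \<times> ?I" for a b c
    proof (cases "b \<in> ?I")
      case True
      then have "a \<in> ?I" "c \<in> ?I"
        using ab bc cl by (fastforce simp: Id_on_iff remainder_def)+
      with ac show ?thesis by blast
    next
      case False
      then have "(a, b) \<in> Id_on (remainder X K i)" "(b, c) \<in> Id_on (remainder X K i)"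
        using ab bc cl by blast+
      then show ?thesis by (auto simp: Id_on_iff)
    qed
    then have "?A O ?B - ?I \<times> ?I \<subseteq> Id_on (remainder X K i)" by auto
    then have "?P closure_of (?m ` (E O F)) - ?I \<times> ?I \<subseteq> Id_on (remainder X K i)"
      using c by (meson Diff_mono order.trans order_refl)
    moreover have "E O F \<subseteq> ?S \<times> ?S" using EF by auto
    ultimately show ?thesis by (simp add: cc_structure_def)
  qed
  have pow: "cc_structure X K i \<subseteq> Pow (?S \<times> ?S)"
    unfolding cc_structure_def by blast
  show ?thesis
    unfolding coarse_structure_def
    by (intro conjI ballI allI impI pow diag inv comp un) (rule sub)
qed

lemma compact_metrizable_embeds:
  assumes "compact_space K" "metrizable_space K"
  shows "\<exists>j. embedding_map K (powertop_real (UNIV :: nat set)) j"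
proof (cases "topspace K = {}")
  case True
  then have "embedding_map K (powertop_real (UNIV :: nat set)) (\<lambda>x n. 0)"
    using assms by (intro continuous_imp_embedding_map)
      (auto simp: continuous_map_on_empty Hausdorff_space_product_topology)
  then show ?thesis by blast
next
  case False
  obtain M d where "Metric_space M d" and Kd: "K = Metric_space.mtopology M d"
    using assms(2) by (auto simp: metrizable_space_def)
  then interpret Metric_space M d by simp
  have M: "topspace K = M" by (simp add: Kd)
  have "mtotally_bounded M"
    using assms(1) Kd by (metis M compact_space_def compactin_imp_mtotally_bounded)
  then have "\<forall>n. \<exists>F. finite F \<and> F \<subseteq> M \<and> M \<subseteq> (\<Union>x\<in>F. mball x (inverse (real (Suc n))))"
    unfolding mtotally_bounded_def by simp
  then obtain F where F: "\<And>n. finite (F n)" "\<And>n. F n \<subseteq> M"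
    "\<And>n. M \<subseteq> (\<Union>x\<in>F n. mball x (inverse (real (Suc n))))" by metis
  define Q where "Q = (\<Union>n. F n)"
  have cQ: "countable Q" unfolding Q_def using F(1) by (intro countable_UN) (auto intro: countable_finite)
  have Qne: "Q \<noteq> {}" using F(3)[of 0] False M by (auto simp: Q_def)
  have QM: "Q \<subseteq> M" using F(2) by (auto simp: Q_def)
  have rg: "range (from_nat_into Q) = Q" by (rule range_from_nat_into[OF Qne cQ])
  have in_M: "from_nat_into Q n \<in> M" for n using rg QM by blast
  let ?j = "\<lambda>x n. d (from_nat_into Q n) x"
  have "continuous_map K (powertop_real (UNIV :: nat set)) ?j"
    unfolding continuous_map_componentwise_UNIV
  proof
    fix n
    have "continuous_map mtopology euclideanreal
        (\<lambda>x. mdist (metric (M, d)) (from_nat_into Q n) x)"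
      by (intro continuous_map_mdist) (simp_all add: in_M mtopology_of_def id_def[symmetric])
    then have "continuous_map mtopology euclideanreal (\<lambda>x. d (from_nat_into Q n) x)"
      by simp
    then show "continuous_map K euclideanreal (\<lambda>x. d (from_nat_into Q n) x)" by (simp add: Kd)
  qed
  moreover have "inj_on ?j (topspace K)"
  proof (rule inj_onI)
    fix x y assume xy: "x \<in> topspace K" "y \<in> topspace K" and eq: "?j x = ?j y"
    have eqQ: "d q x = d q y" if "q \<in> Q" for q
      using eq that rg by (metis (mono_tags, lifting) imageE)
    show "x = y"
    proof (rule ccontr)
      assume "x \<noteq> y"
      then have "d x y > 0" using xy M by simp
      then obtain n where n: "inverse (real (Suc n)) < d x y / 2"
        using reals_Archimedean[of "d x y / 2"] by auto
      obtain q where q: "q \<in> F n" "d q x < inverse (real (Suc n))" 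
        using F(3)[of n] xy M by (auto simp: mball_def)
      then have "q \<in> Q" "q \<in> M" using QM by (auto simp: Q_def)
      then have "d x y \<le> d q x + d q y"
        using triangle[of x q y] xy M by (simp add: commute)
      then show False using q n eqQ[OF \<open>q \<in> Q\<close>] by linarith
    qed
  qed
  ultimately have "embedding_map K (powertop_real (UNIV :: nat set)) ?j"
    using assms(1) by (intro continuous_imp_embedding_map)
      (auto simp: Hausdorff_space_product_topology)
  then show ?thesis by blast
qed

lemma compactification_transport:
  assumes "compactification X K i" "homeomorphic_map K L j"
  shows "compactification X L (j \<circ> i)" "cc_structure X L (j \<circ> i) = cc_structure X K i"
proof -
  have K: "compact_space K" "Hausdorff_space K" and emb: "embedding_map X K i"
    and dense: "K closure_of (i ` topspace X) = topspace K"
    using assms by (auto simp: compactification_def)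
  have hs: "K homeomorphic_space L" using assms(2) homeomorphic_map_imp_homeomorphic_space by blast
  have jK: "j ` topspace K = topspace L" and inj: "inj_on j (topspace K)"
    using assms(2) by (auto simp: homeomorphic_imp_surjective_map homeomorphic_imp_injective_map)
  have iK: "i ` topspace X \<subseteq> topspace K"
    using emb by (meson embedding_map_def continuous_map_image_subset_topspace
        homeomorphic_imp_continuous_map continuous_map_in_subtopology)
  have "embedding_map X L (j \<circ> i)"
    using emb assms(2) jK by (intro embedding_map_compose[OF emb]) (simp add: embedding_map_def)
  moreover have "L closure_of ((j \<circ> i) ` topspace X) = topspace L"
    using homeomorphic_map_closure_of[OF assms(2) iK] dense jK by (simp add: image_comp)
  ultimately show "compactification X L (j \<circ> i)"
    using K hs by (simp add: compactification_def homeomorphic_compact_space homeomorphic_Hausdorff_space)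
  let ?KK = "prod_topology K K" and ?LL = "prod_topology L L"
  have hp: "homeomorphic_map ?KK ?LL (map_prod j j)"
  proof -
    obtain j' where "homeomorphic_maps K L j j'"
      using assms(2) homeomorphic_map_maps by blast
    then have "homeomorphic_maps ?KK ?LL (\<lambda>(x, y). (j x, j y)) (\<lambda>(x, y). (j' x, j' y))"
      by (simp add: homeomorphic_maps_prod)
    moreover have "(\<lambda>(x, y). (j x, j y)) = map_prod j j" by auto
    ultimately show ?thesis using homeomorphic_map_maps by metis
  qed
  have "(?LL closure_of (map_prod (j \<circ> i) (j \<circ> i) ` E)
           - ((j \<circ> i) ` topspace X \<times> (j \<circ> i) ` topspace X) \<subseteq> Id_on (remainder X L (j \<circ> i))) \<longleftrightarrow>
        (?KK closure_of (map_prod i i ` E)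
           - (i ` topspace X \<times> i ` topspace X) \<subseteq> Id_on (remainder X K i))"
    if E: "E \<subseteq> topspace X \<times> topspace X" for E
  proof -
    let ?A = "?KK closure_of (map_prod i i ` E)"
    have "map_prod i i ` E \<subseteq> topspace ?KK" using E iK by auto
    then have "?LL closure_of (map_prod j j ` (map_prod i i ` E)) = map_prod j j ` ?A"
      by (rule homeomorphic_map_closure_of[OF hp])
    then have cl: "?LL closure_of (map_prod (j \<circ> i) (j \<circ> i) ` E) = map_prod j j ` ?A"
      by (simp add: image_comp map_prod.comp)
    have AK: "?A \<subseteq> topspace K \<times> topspace K"
      using closure_of_subset_topspace[of ?KK] by simp
    have m: "j a \<in> (j \<circ> i) ` topspace X \<longleftrightarrow> a \<in> i ` topspace X" if "a \<in> topspace K" for a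
      using that iK inj by (auto simp: inj_on_def image_iff)
    have r: "(j a, j b) \<in> Id_on (remainder X L (j \<circ> i)) \<longleftrightarrow> (a, b) \<in> Id_on (remainder X K i)"
      if "a \<in> topspace K" "b \<in> topspace K" for a b
      using that m[OF that(1)] jK inj by (auto simp: Id_on_iff remainder_def inj_on_eq_iff)
    show ?thesis
      unfolding cl
    proof (intro iffI subrelI)
      fix a b
      assume *: "map_prod j j ` ?A - (j \<circ> i) ` topspace X \<times> (j \<circ> i) ` topspace X
          \<subseteq> Id_on (remainder X L (j \<circ> i))"
        and ab: "(a, b) \<in> ?A - i ` topspace X \<times> i ` topspace X"
      have abK: "a \<in> topspace K" "b \<in> topspace K" using AK ab by auto
      then have "(j a, j b) \<notin> (j \<circ> i) ` topspace X \<times> (j \<circ> i) ` topspace X"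
        using ab m[OF abK(1)] m[OF abK(2)] by blast
      moreover have "(j a, j b) \<in> map_prod j j ` ?A" using ab by force
      ultimately have "(j a, j b) \<in> Id_on (remainder X L (j \<circ> i))"
        using * by (meson DiffI subsetD)
      then show "(a, b) \<in> Id_on (remainder X K i)" by (simp only: r[OF abK])
    next
      fix c d
      assume *: "?A - i ` topspace X \<times> i ` topspace X \<subseteq> Id_on (remainder X K i)"
        and cd: "(c, d) \<in> map_prod j j ` ?A - (j \<circ> i) ` topspace X \<times> (j \<circ> i) ` topspace X"
      then obtain a b where ab: "(a, b) \<in> ?A" "c = j a" "d = j b" by auto
      have abK: "a \<in> topspace K" "b \<in> topspace K" using AK ab by auto
      have "(a, b) \<notin> i ` topspace X \<times> i ` topspace X"
        using cd unfolding ab(2,3) Diff_iff mem_Times_iff fst_conv snd_conv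
          m[OF abK(1)] m[OF abK(2)] by (rule conjunct2)
      then have "(a, b) \<in> Id_on (remainder X K i)" using * ab by blast
      then show "(c, d) \<in> Id_on (remainder X L (j \<circ> i))" by (simp only: ab(2,3) r[OF abK])
    qed
  qed
  then show "cc_structure X L (j \<circ> i) = cc_structure X K i"
    unfolding cc_structure_def by (intro Collect_cong conj_cong refl)
qed

lemma CC_objI:
  fixes K :: "'c topology"
  assumes "compactification X K i" "metrizable_space K"
    and "topspace X \<noteq> {}" "locally_compact_space X" "Hausdorff_space X"
  shows "(X, cc_structure X K i) \<in> Obj CC"
proof -
  have "compact_space K" using assms(1) by (simp add: compactification_def)
  then obtain j where j: "embedding_map K (powertop_real (UNIV :: nat set)) j"
    using compact_metrizable_embeds assms(2) by blast
  let ?L = "subtopology (powertop_real (UNIV :: nat set)) (j ` topspace K)"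
  have h: "homeomorphic_map K ?L j" using j by (simp add: embedding_map_def)
  then have "metrizable_space ?L"
    using assms(2) homeomorphic_map_imp_homeomorphic_space homeomorphic_metrizable_space by blast
  with compactification_transport[OF assms(1) h] assms(3-5) show ?thesis
    by (auto simp: CC_def intro!: exI[of _ ?L] exI[of _ "j \<circ> i"])
qed

text \<open>Up to homeomorphism, \<open>KM\<close> on the type in which the coronas live contains all compact
  metrizable spaces.\<close>

lemma KM_universe:
  fixes Z :: "'c topology"
  assumes "infinite (UNIV :: 'a set)" "compact_space Z" "metrizable_space Z"
  shows "\<exists>Z' \<in> Obj (KM :: ((('a \<Rightarrow> real) \<Rightarrow> real) topology, _) precategory). Z homeomorphic_space Z'"
proof -
  obtain j where j: "embedding_map Z (powertop_real (UNIV :: nat set)) j"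
    using compact_metrizable_embeds assms(2,3) by blast
  have injj: "inj_on j (topspace Z)"
    using j homeomorphic_imp_injective_map by (fastforce simp: embedding_map_def)
  obtain u :: "nat \<Rightarrow> 'a" where u: "inj u"
    using assms(1) infinite_countable_subset by blast
  define v :: "(nat \<Rightarrow> real) \<Rightarrow> (('a \<Rightarrow> real) \<Rightarrow> real)"
    where "v = (\<lambda>s \<phi>. if \<exists>n. \<phi> = indicator {u n} then s (THE n. \<phi> = indicator {u n}) else 0)"
  have vn: "v s (indicator {u n}) = s n" for s n
  proof -
    have "(indicator {u n} :: 'a \<Rightarrow> real) = indicator {u m} \<longleftrightarrow> n = m" for m
      using u by (metis indicator_simps(1) indicator_simps(2) injD insertI1 singletonD zero_neq_one)
    then show ?thesis unfolding v_def by auto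
  qed
  have "inj v" by (rule injI) (metis vn ext)
  define w where "w = v \<circ> j"
  have injw: "inj_on w (topspace Z)"
    unfolding w_def using injj \<open>inj v\<close> by (simp add: comp_inj_on inj_on_subset)
  define g where "g = inv_into (topspace Z) w"
  have gw: "g (w x) = x" if "x \<in> topspace Z" for x
    using injw that by (simp add: g_def)
  let ?Z = "pullback_topology (w ` topspace Z) g Z"
  have ts: "topspace ?Z = w ` topspace Z"
    using gw by (auto simp: topspace_pullback_topology)
  have "homeomorphic_maps Z ?Z w g"
    unfolding homeomorphic_maps_def
  proof (intro conjI ballI)
    show "continuous_map Z ?Z w"
    proof (rule continuous_map_pullback')
      show "continuous_map Z Z (g \<circ> w)"
        by (rule continuous_map_eq[OF continuous_map_id]) (simp add: gw)
    qed auto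
    show "continuous_map ?Z Z g"
      using continuous_map_pullback[OF continuous_map_id, of "w ` topspace Z" g Z] by simp
  qed (use gw ts in auto)
  then have "Z homeomorphic_space ?Z" unfolding homeomorphic_space_def by blast
  moreover from this have "compact_space ?Z" "metrizable_space ?Z"
    using assms(2,3) homeomorphic_compact_space homeomorphic_metrizable_space by blast+
  ultimately show ?thesis by (auto simp: KM_def)
qed

end

theory Submission
  imports Defs
begin

text \<open>Embed each metrizable compactification of \<open>X\<close> in the metric space \<open>nat \<Rightarrow> real\<close>. By sequential
  compactness, a map \<open>f : X \<rightarrow> Y\<close> that preserves bounded sets is coarse iff it extends over the
  remainders by a map \<open>h : \<partial>X \<rightarrow> \<partial>Y\<close> with \<open>f x \<longlonglongrightarrow> h p\<close> as \<open>x \<longlonglongrightarrow> p \<in> \<partial>X\<close>; such an \<open>h\<close> is automatically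
  continuous, and two coarse maps are close iff their boundary maps agree. Every continuous \<open>h\<close>
  arises in this way. In the same manner the Higson functions are the bounded functions with boundary
  values on \<open>\<partial>X\<close>, so \<open>\<partial>X\<close> is the Higson corona and the corona map of \<open>f\<close> is \<open>h\<close>. Hence the functor is
  full and faithful; it is essentially surjective because every nonempty compact metrizable space is
  the remainder of a countable discrete space.\<close>

section \<open>Points tending to the remainder\<close>

text \<open>Metrizability acts through sequences. Any two sequences in \<open>X\<close> with a
  common limit \<open>p\<close> form a controlled set, because their pairs accumulate only at
  \<open>(p, p)\<close>; testing a coarse map or a Higson function on such sets forces its limits at
  \<open>p\<close> to agree. The converses split a convergent sequence into two cases. If a limit
  lies in the boundary, the boundary values decide. If the limits lie in \<open>X\<close>, the
  sequence is bounded and boundary values say nothing, which is why a map must be required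
  separately to send bounded sets to bounded sets.

  A second obstacle is that an object of \<open>CC\<close> carries only a coarse structure, with the
  mere existence of a compactification behind it, while the corona is built from Higson functions
  alone. One embedding is chosen per object, and \<open>corona_point\<close>, which takes limits of
  Higson functions, translates between the chosen boundary and the corona. The functor itself is
  defined without reference to that choice.\<close>

definition boundary :: "'a topology \<Rightarrow> ('a \<Rightarrow> 'k::topological_space) \<Rightarrow> 'k set" where
  "boundary X i = closure (i ` topspace X) - i ` topspace X"

text \<open>For \<open>p = i x\<close> with \<open>i\<close> an embedding this is the neighbourhood
  filter of \<open>x\<close>, so limits at points of \<open>X\<close> and at boundary points are
  treated alike.\<close>

definition ends :: "'a topology \<Rightarrow> ('a \<Rightarrow> 'k::topological_space) \<Rightarrow> 'k \<Rightarrow> 'a filter" where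
  "ends X i p = inf (filtercomap i (nhds p)) (principal (topspace X))"

abbreviation controlled :: "'a topology \<Rightarrow> ('a \<Rightarrow> 'k::topological_space) \<Rightarrow> ('a \<times> 'a) set set" where
  "controlled X i \<equiv> cc_structure X (top_of_set (closure (i ` topspace X))) i"

section \<open>Limits at a point of the closure\<close>

lemma eventually_ends:
  fixes i :: "'a \<Rightarrow> 'k::metric_space"
  shows "eventually P (ends X i p) \<longleftrightarrow> (\<exists>e>0. \<forall>x\<in>topspace X. dist (i x) p < e \<longrightarrow> P x)"
proof
  assume "eventually P (ends X i p)"
  then show "\<exists>e>0. \<forall>x\<in>topspace X. dist (i x) p < e \<longrightarrow> P x"
    unfolding ends_def eventually_inf_principal eventually_filtercomap eventually_nhds_metric by blast
next
  assume "\<exists>e>0. \<forall>x\<in>topspace X. dist (i x) p < e \<longrightarrow> P x"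
  then obtain e where "e > 0" "\<forall>x\<in>topspace X. dist (i x) p < e \<longrightarrow> P x" by blast
  then show "eventually P (ends X i p)"
    unfolding ends_def eventually_inf_principal eventually_filtercomap eventually_nhds_metric
    by (intro exI[of _ "\<lambda>q. dist q p < e"]) auto
qed

lemma eventually_ends_topspace: "eventually (\<lambda>x. x \<in> topspace X) (ends X i p)"
  by (simp add: ends_def eventually_inf_principal)

lemma tendsto_ends: "(i \<longlongrightarrow> p) (ends X i p)"
  unfolding ends_def by (rule tendsto_mono[OF inf_le1 filterlim_filtercomap])

lemma filterlim_ends:
  "filterlim x (ends X i p) F \<longleftrightarrow>
     filterlim (\<lambda>n. i (x n)) (nhds p) F \<and> eventually (\<lambda>n. x n \<in> topspace X) F"
  unfolding ends_def filterlim_inf filterlim_principal filterlim_filtercomap_iff o_def ..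

lemma ends_nontrivial:
  fixes i :: "'a \<Rightarrow> 'k::metric_space"
  assumes "p \<in> closure (i ` topspace X)"
  shows "ends X i p \<noteq> bot"
proof
  assume "ends X i p = bot"
  then have "eventually (\<lambda>x. False) (ends X i p)" by simp
  then show False
    using assms unfolding eventually_ends closure_approachable by blast
qed

lemma obtain_ends_sequence:
  fixes i :: "'a \<Rightarrow> 'k::metric_space"
  assumes "p \<in> closure (i ` topspace X)"
  obtains x where "filterlim x (ends X i p) sequentially" "\<And>n::nat. x n \<in> topspace X"
proof -
  obtain y where y: "\<And>n. y n \<in> i ` topspace X" "y \<longlonglongrightarrow> p"
    using closure_sequential[THEN iffD1, OF assms] by auto
  then have "\<forall>n. \<exists>x. x \<in> topspace X \<and> y n = i x" by blast
  then obtain x where "\<And>n. x n \<in> topspace X" "\<And>n. y n = i (x n)" by metis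
  moreover from this have "y = (\<lambda>n. i (x n))" by auto
  ultimately show ?thesis using y that[of x] by (auto simp: filterlim_ends)
qed

text \<open>The balls of radius \<open>1/(n+1)\<close> about \<open>p\<close> give the filter a
  countable base, so failure of convergence is witnessed by a single sequence staying away from
  \<open>l\<close>. Asking only for a convergent subsequence fits what compactness of the target
  delivers.\<close>

lemma tendsto_ends_sequentially:
  fixes i :: "'a \<Rightarrow> 'k::metric_space" and g :: "'a \<Rightarrow> 'z::metric_space"
  assumes "\<And>x. (\<And>n. x n \<in> topspace X) \<Longrightarrow> filterlim x (ends X i p) sequentially
             \<Longrightarrow> \<exists>r. strict_mono r \<and> (\<lambda>n. g (x (r n))) \<longlonglongrightarrow> l"
  shows "(g \<longlongrightarrow> l) (ends X i p)"
proof (rule ccontr)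
  assume "\<not> ?thesis"
  then obtain \<epsilon> where \<epsilon>: "\<epsilon> > 0"
    and "\<And>e. e > 0 \<Longrightarrow> \<exists>x\<in>topspace X. dist (i x) p < e \<and> \<not> dist (g x) l < \<epsilon>"
    unfolding tendsto_iff eventually_ends by blast
  then have "\<exists>x\<in>topspace X. dist (i x) p < inverse (real (Suc n)) \<and> \<not> dist (g x) l < \<epsilon>" for n
    by simp
  then obtain x where x: "\<And>n. x n \<in> topspace X"
    "\<And>n. dist (i (x n)) p < inverse (real (Suc n))" "\<And>n. \<not> dist (g (x n)) l < \<epsilon>"
    by metis
  have "(\<lambda>n. dist (i (x n)) p) \<longlonglongrightarrow> 0"
    by (rule real_tendsto_sandwich[OF _ _ tendsto_const LIMSEQ_inverse_real_of_nat])
      (use x(2) in \<open>auto intro!: always_eventually less_imp_le simp del: of_nat_Suc\<close>)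
  then have "filterlim x (ends X i p) sequentially"
    using x(1) by (simp add: filterlim_ends tendsto_dist_iff[symmetric])
  then obtain r where "(\<lambda>n. g (x (r n))) \<longlonglongrightarrow> l"
    using assms x(1) by blast
  then have "eventually (\<lambda>n. dist (g (x (r n))) l < \<epsilon>) sequentially"
    using \<epsilon> by (simp add: tendsto_iff)
  then show False using x(3) by (auto simp: eventually_sequentially)
qed

text \<open>Nothing is assumed about continuity of \<open>g\<close>. An estimate for
  \<open>g\<close> near \<open>h p\<close> holds on a ball about \<open>p\<close>; this ball
  contains a smaller one about every nearby \<open>q\<close>, so the estimate passes to the limit
  \<open>h q\<close>.\<close>

lemma boundary_values_continuous:
  fixes i :: "'a \<Rightarrow> 'k::metric_space" and g :: "'a \<Rightarrow> 'z::metric_space"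
  assumes "A \<subseteq> closure (i ` topspace X)"
    and lim: "\<And>p. p \<in> A \<Longrightarrow> (g \<longlongrightarrow> h p) (ends X i p)"
  shows "continuous_on A h"
  unfolding continuous_on_iff
proof (intro ballI allI impI)
  fix p and \<epsilon> :: real assume p: "p \<in> A" and "\<epsilon> > 0"
  then have "eventually (\<lambda>x. dist (g x) (h p) < \<epsilon>/2) (ends X i p)"
    using lim[OF p] half_gt_zero by (blast dest: tendstoD)
  then obtain e where e: "e > 0" "\<And>x. x \<in> topspace X \<Longrightarrow> dist (i x) p < e \<Longrightarrow> dist (g x) (h p) < \<epsilon>/2"
    unfolding eventually_ends by blast
  show "\<exists>\<delta>>0. \<forall>q\<in>A. dist q p < \<delta> \<longrightarrow> dist (h q) (h p) < \<epsilon>"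
  proof (intro exI conjI ballI impI)
    fix q assume q: "q \<in> A" "dist q p < e"
    have "eventually (\<lambda>x. dist (g x) (h p) \<le> \<epsilon>/2) (ends X i q)"
      unfolding eventually_ends
    proof (intro exI conjI ballI impI)
      show "e - dist q p > 0" using q by simp
      fix x assume "x \<in> topspace X" "dist (i x) q < e - dist q p"
      then show "dist (g x) (h p) \<le> \<epsilon>/2"
        using e(2)[of x] dist_triangle[of "i x" p q] by force
    qed
    moreover have "((\<lambda>x. dist (g x) (h p)) \<longlongrightarrow> dist (h q) (h p)) (ends X i q)"
      by (intro tendsto_dist lim q tendsto_const)
    moreover have "ends X i q \<noteq> bot"
      using q(1) assms(1) by (intro ends_nontrivial) auto
    ultimately have "dist (h q) (h p) \<le> \<epsilon>/2"
      using tendsto_upperbound by blast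
    then show "dist (h q) (h p) < \<epsilon>" using \<open>\<epsilon> > 0\<close> by linarith
  qed (use e in auto)
qed

text \<open>The metrizable compactifications are realised inside a metric space type, as the closure of
  the image of an embedding \<open>i\<close>.\<close>

locale compactified_space =
  fixes X :: "'a topology" and i :: "'a \<Rightarrow> 'k::{metric_space,second_countable_topology}"
  assumes embedding: "embedding_map X euclidean i"
    and compact_closure: "compact (closure (i ` topspace X))"
    and locally_compact: "locally_compact_space X"
begin

lemma homeomorphic: "homeomorphic_map X (top_of_set (i ` topspace X)) i"
  using embedding by (simp add: embedding_map_def)

lemma inj_i: "inj_on i (topspace X)"
  using homeomorphic homeomorphic_imp_injective_map by blast

lemma closure_eq: "closure (i ` topspace X) = i ` topspace X \<union> boundary X i"
  using closure_subset[of "i ` topspace X"] by (auto simp: boundary_def)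

lemma boundary_subset: "boundary X i \<subseteq> closure (i ` topspace X)"
  by (auto simp: boundary_def)

lemma boundary_disjoint: "boundary X i \<inter> i ` topspace X = {}"
  by (auto simp: boundary_def)

lemma image_in_closure: "x \<in> topspace X \<Longrightarrow> i x \<in> closure (i ` topspace X)"
  by (simp add: closure_eq)

text \<open>Local compactness enters here: a locally compact subspace of a Hausdorff space is open
  in its closure. This makes the boundary closed, hence compact.\<close>

lemma openin_image: "openin (top_of_set (closure (i ` topspace X))) (i ` topspace X)"
proof -
  have "locally_compact_space (top_of_set (i ` topspace X))"
    using locally_compact homeomorphic homeomorphic_locally_compact_space
      homeomorphic_map_imp_homeomorphic_space by blast
  then show ?thesis
    using locally_compact_subspace_openin_closure_of[of euclidean "i ` topspace X"] by simp
qed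

lemma compact_boundary: "compact (boundary X i)"
proof -
  have "closedin (top_of_set (closure (i ` topspace X))) (boundary X i)"
    using closedin_diff[OF closedin_topspace openin_image] by (simp add: boundary_def)
  then show ?thesis using compact_closure closedin_compact by blast
qed

lemma ends_neq_bot: "p \<in> boundary X i \<Longrightarrow> ends X i p \<noteq> bot"
  using boundary_subset ends_nontrivial by blast

section \<open>Controlled and bounded sets through sequences\<close>

lemma convergent_subsequence:
  assumes "\<And>n::nat. x n \<in> topspace X"
  obtains r p where "strict_mono r" "p \<in> closure (i ` topspace X)"
    "filterlim (x \<circ> r) (ends X i p) sequentially"
proof -
  obtain p r where "p \<in> closure (i ` topspace X)" "strict_mono r" "((i \<circ> x) \<circ> r) \<longlonglongrightarrow> p"
    using compact_closure[unfolded compact_def, rule_format, of "i \<circ> x"] assms image_in_closure by force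
  with that show ?thesis using assms by (auto simp: filterlim_ends o_def)
qed

text \<open>The closure may be taken in the ambient type because it stays inside the compact square.
  There, a diagonal point outside the square of the image automatically lies over the remainder, so
  \<open>Id_on\<close> of the remainder reduces to \<open>Id\<close>.\<close>

lemma controlled_iff:
  "E \<in> controlled X i \<longleftrightarrow> E \<subseteq> topspace X \<times> topspace X \<and>
     closure (map_prod i i ` E) - i ` topspace X \<times> i ` topspace X \<subseteq> Id"
proof -
  let ?K = "closure (i ` topspace X)"
  have "prod_topology (top_of_set ?K) (top_of_set ?K) closure_of (map_prod i i ` E)
      = closure (map_prod i i ` E)" and "closure (map_prod i i ` E) \<subseteq> ?K \<times> ?K"
    if "E \<subseteq> topspace X \<times> topspace X"
  proof -
    have sub: "map_prod i i ` E \<subseteq> ?K \<times> ?K" using that image_in_closure by auto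
    show *: "closure (map_prod i i ` E) \<subseteq> ?K \<times> ?K"
      using sub by (intro closure_minimal closed_Times) auto
    show "prod_topology (top_of_set ?K) (top_of_set ?K) closure_of (map_prod i i ` E)
      = closure (map_prod i i ` E)"
      using sub * by (simp add: closure_of_subtopology Int_absorb1)
  qed
  moreover have "C - I \<times> I \<subseteq> Id_on (K - I) \<longleftrightarrow> C - I \<times> I \<subseteq> Id" if "C \<subseteq> K \<times> K"
    for C :: "('k \<times> 'k) set" and I K
    using that by (auto simp: Id_on_iff)
  ultimately show ?thesis
    unfolding cc_structure_def remainder_def topspace_euclidean_subtopology mem_Collect_eq
    by (intro conj_cong refl) simp
qed

text \<open>The pair \<open>(p, q)\<close> is a limit of pairs from \<open>E\<close> and lies
  outside the square of the image, so control puts it on the diagonal.\<close>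

lemma controlledD:
  assumes "E \<in> controlled X i" "\<And>n. (x n, y n) \<in> E"
    and "filterlim x (ends X i p) sequentially" "filterlim y (ends X i q) sequentially"
    and "p \<in> boundary X i \<or> q \<in> boundary X i"
  shows "p = q"
proof -
  have "(\<lambda>n. (i (x n), i (y n))) \<longlonglongrightarrow> (p, q)"
    using assms(3,4) by (intro tendsto_Pair) (auto simp: filterlim_ends)
  moreover have "\<And>n. (i (x n), i (y n)) \<in> map_prod i i ` E" using assms(2) by force
  ultimately have "(p, q) \<in> closure (map_prod i i ` E)"
    unfolding closure_sequential by (intro exI[of _ "\<lambda>n. (i (x n), i (y n))"]) simp
  then show ?thesis
    using assms(1,5) unfolding controlled_iff by (auto simp: boundary_def)
qed

text \<open>In a metric product each point of the closure is the limit of a sequence from the set,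
  so sequences suffice to test control.\<close>

lemma controlledI:
  assumes "E \<subseteq> topspace X \<times> topspace X"
    and "\<And>x y p q. (\<And>n. (x n, y n) \<in> E) \<Longrightarrow> filterlim x (ends X i p) sequentially \<Longrightarrow>
           filterlim y (ends X i q) sequentially \<Longrightarrow> p \<in> boundary X i \<or> q \<in> boundary X i \<Longrightarrow> p = q"
  shows "E \<in> controlled X i"
  unfolding controlled_iff
proof (intro conjI assms(1) subsetI)
  fix z assume z: "z \<in> closure (map_prod i i ` E) - i ` topspace X \<times> i ` topspace X"
  obtain p q where pq: "z = (p, q)" by force
  obtain w where w: "\<And>n. w n \<in> map_prod i i ` E" "w \<longlonglongrightarrow> z"
    using closure_sequential[THEN iffD1, OF DiffD1[OF z]] by auto
  then have "\<forall>n. \<exists>x y. (x, y) \<in> E \<and> w n = (i x, i y)" by fastforce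
  then obtain x y where xy: "\<And>n. (x n, y n) \<in> E" "\<And>n. w n = (i (x n), i (y n))" by metis
  have xyS: "x n \<in> topspace X" "y n \<in> topspace X" for n using xy(1)[of n] assms(1) by auto
  have lim: "(\<lambda>n. i (x n)) \<longlonglongrightarrow> p" "(\<lambda>n. i (y n)) \<longlonglongrightarrow> q"
    using w(2) tendsto_fst[of w z sequentially] tendsto_snd[of w z sequentially] by (simp_all add: pq xy(2))
  have "p \<in> closure (i ` topspace X)"
    unfolding closure_sequential using lim xyS
    by (intro exI[of _ "\<lambda>n. i (x n)"] conjI allI imageI; simp)
  moreover have "q \<in> closure (i ` topspace X)"
    unfolding closure_sequential using lim xyS
    by (intro exI[of _ "\<lambda>n. i (y n)"] conjI allI imageI; simp)
  ultimately
  have "p \<in> boundary X i \<or> q \<in> boundary X i"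
    using z pq by (auto simp: boundary_def)
  then show "z \<in> Id"
    using assms(2)[of x y p q] xy(1) lim xyS by (auto simp: pq filterlim_ends)
qed

text \<open>The sequence of image pairs converges to \<open>(p, p)\<close>, so its closure adds at
  most this diagonal point. These are the test sets on which coarse maps and Higson functions are
  evaluated.\<close>

lemma controlled_sequencesI:
  fixes x y :: "nat \<Rightarrow> 'a"
  assumes xS: "\<And>n. x n \<in> topspace X" and yS: "\<And>n. y n \<in> topspace X"
    and x: "filterlim x (ends X i p) sequentially" and y: "filterlim y (ends X i p) sequentially"
  shows "range (\<lambda>n. (x n, y n)) \<in> controlled X i"
  unfolding controlled_iff
proof (intro conjI subsetI)
  fix z assume z: "z \<in> closure (map_prod i i ` range (\<lambda>n. (x n, y n))) - i ` topspace X \<times> i ` topspace X"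
  have "(\<lambda>n. (i (x n), i (y n))) \<longlonglongrightarrow> (p, p)"
    using x y by (intro tendsto_Pair) (auto simp: filterlim_ends)
  moreover have "map_prod i i ` range (\<lambda>n. (x n, y n)) = range (\<lambda>n. (i (x n), i (y n)))" by auto
  moreover from this have "z \<notin> map_prod i i ` range (\<lambda>n. (x n, y n))" using z xS yS by auto
  ultimately have "z = (p, p)"
    using z sequence_unique_limpt[of "\<lambda>n. (i (x n), i (y n))" "(p, p)" z] by (simp add: closure_def)
  then show "z \<in> Id" by simp
qed (use xS yS in auto)

text \<open>The closure of \<open>B \<times> B\<close> is the product of the closures. If it
  contained a boundary point \<open>p\<close>, then \<open>(p, b)\<close> for any \<open>b\<close>
  in the image of \<open>B\<close> would be an off-diagonal point outside the square of the
  image.\<close>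

lemma bounded_iff:
  "coarsely_bounded (controlled X i) B \<longleftrightarrow>
     B \<subseteq> topspace X \<and> closure (i ` B) \<inter> boundary X i = {}"
proof -
  have cl: "closure (map_prod i i ` (B \<times> B)) = closure (i ` B) \<times> closure (i ` B)"
  proof -
    have "map_prod i i ` (B \<times> B) = i ` B \<times> i ` B" by auto
    then show ?thesis by (simp add: closure_Times)
  qed
  show ?thesis
  proof (cases "B \<subseteq> topspace X")
    case True
    then have 1: "closure (i ` B) \<subseteq> i ` topspace X \<union> boundary X i"
      using closure_eq closure_mono[of "i ` B" "i ` topspace X"] by blast
    have 2: "i ` B \<subseteq> i ` topspace X" "i ` B \<subseteq> closure (i ` B)"
      using True by (auto intro!: closure_subset)
    have 3: "i ` B \<noteq> {} \<or> closure (i ` B) = {}" by auto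
    show ?thesis
    proof
      assume "coarsely_bounded (controlled X i) B"
      then have *: "closure (i ` B) \<times> closure (i ` B) - i ` topspace X \<times> i ` topspace X \<subseteq> Id"
        unfolding coarsely_bounded_def controlled_iff cl by blast
      have False if p: "p \<in> closure (i ` B)" "p \<in> boundary X i" for p
      proof -
        obtain b where b: "b \<in> i ` B" using 3 p(1) by (cases "B = {}") auto
        have "p \<notin> i ` topspace X" "b \<in> i ` topspace X" "b \<in> closure (i ` B)"
          using subsetD[OF 2(1) b] subsetD[OF 2(2) b] p(2) by (simp_all add: boundary_def)
        then have "(p, b) \<in> Id" using * p(1) by (intro subsetD[OF *]) simp
        then show False using \<open>p \<notin> _\<close> \<open>b \<in> i ` topspace X\<close> by simp
      qed
      then show "B \<subseteq> topspace X \<and> closure (i ` B) \<inter> boundary X i = {}" using True by blast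
    next
      assume "B \<subseteq> topspace X \<and> closure (i ` B) \<inter> boundary X i = {}"
      then have "closure (i ` B) \<subseteq> i ` topspace X" using 1 by blast
      then show "coarsely_bounded (controlled X i) B"
        unfolding coarsely_bounded_def controlled_iff cl using True Sigma_mono by fastforce
    qed
  next
    case False
    then show ?thesis unfolding coarsely_bounded_def controlled_iff by auto
  qed
qed

text \<open>In this form, preimages of bounded sets are bounded as soon as a map carries the filters
  \<open>ends\<close> at boundary points to filters \<open>ends\<close> at boundary points.\<close>

lemma bounded_iff_ends:
  "coarsely_bounded (controlled X i) B \<longleftrightarrow>
     B \<subseteq> topspace X \<and> (\<forall>p\<in>boundary X i. eventually (\<lambda>x. x \<notin> B) (ends X i p))"
proof -
  have "p \<notin> closure (i ` B) \<longleftrightarrow> eventually (\<lambda>x. x \<notin> B) (ends X i p)" if "B \<subseteq> topspace X" for p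
    unfolding eventually_ends closure_approachable using that
    by (auto simp: subset_iff)
  then show ?thesis unfolding bounded_iff by blast
qed

lemma bounded_not_eventually:
  assumes "coarsely_bounded (controlled X i) B" "p \<in> boundary X i"
    and "filterlim x (ends X i p) sequentially"
  shows "eventually (\<lambda>n::nat. x n \<notin> B) sequentially"
  using assms bounded_iff_ends filterlim_iff by blast

text \<open>A convergent sequence accumulates only at its limit, so its closure stays inside the
  image of \<open>X\<close>.\<close>

lemma bounded_sequence:
  assumes "\<And>n. x n \<in> topspace X" "filterlim x (ends X i p) sequentially" "p \<in> i ` topspace X"
  shows "coarsely_bounded (controlled X i) (range (x :: nat \<Rightarrow> 'a))"
  unfolding bounded_iff
proof
  have "i ` range x = range (\<lambda>n. i (x n))" by auto
  then have "closure (i ` range x) \<subseteq> insert p (i ` range x)"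
    using assms(2) sequence_unique_limpt[of "\<lambda>n. i (x n)" p]
    by (auto simp: closure_def filterlim_ends)
  then show "closure (i ` range x) \<inter> boundary X i = {}"
    using assms(1,3) boundary_disjoint by blast
qed (use assms in auto)

end


section \<open>Coarse maps and their boundary maps\<close>

context compactified_space
begin

lemma finite_bounded:
  assumes "finite B" "B \<subseteq> topspace X"
  shows "coarsely_bounded (controlled X i) B"
proof -
  have "closure (i ` B) = i ` B"
    using assms(1) by (intro closure_closed finite_imp_closed finite_imageI)
  then show ?thesis
    unfolding bounded_iff using assms(2) by (auto simp: boundary_def)
qed

lemma convergent_pair_subsequence:
  assumes "\<And>n::nat. x n \<in> topspace X" "\<And>n. y n \<in> topspace X"
  obtains r p q where "strict_mono r" "p \<in> closure (i ` topspace X)" "q \<in> closure (i ` topspace X)"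
    "filterlim (x \<circ> r) (ends X i p) sequentially" "filterlim (y \<circ> r) (ends X i q) sequentially"
proof -
  obtain r p where r: "strict_mono r" "p \<in> closure (i ` topspace X)"
    "filterlim (x \<circ> r) (ends X i p) sequentially"
    using convergent_subsequence assms(1) by blast
  obtain s q where s: "strict_mono s" "q \<in> closure (i ` topspace X)"
    "filterlim ((y \<circ> r) \<circ> s) (ends X i q) sequentially"
    using convergent_subsequence[of "y \<circ> r"] assms(2) by auto
  have "filterlim (x \<circ> (r \<circ> s)) (ends X i p) sequentially"
    using filterlim_compose[OF r(3) filterlim_subseq[OF s(1)]] by (simp add: o_def)
  with that[OF strict_mono_o[OF r(1) s(1)] r(2) s(2)] s(3) show ?thesis by (simp add: o_assoc)
qed

text \<open>Compactness of \<open>C\<close> gives subsequential limits along every sequence tending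
  to \<open>p\<close>, and \<open>unique\<close> makes them all equal to one \<open>l\<close>. The
  lemma serves coarse maps, with \<open>C\<close> the compactified target, and Higson functions,
  with \<open>C\<close> the closure of the range.\<close>

lemma boundary_value_exists:
  fixes g :: "'a \<Rightarrow> 'z::metric_space"
  assumes C: "compact C" "g ` topspace X \<subseteq> C" and p: "p \<in> boundary X i"
    and unique: "\<And>x y a b. (\<And>n. x n \<in> topspace X) \<Longrightarrow> (\<And>n. y n \<in> topspace X) \<Longrightarrow>
      filterlim x (ends X i p) sequentially \<Longrightarrow> filterlim y (ends X i p) sequentially \<Longrightarrow>
      (\<lambda>n. g (x n)) \<longlonglongrightarrow> a \<Longrightarrow> (\<lambda>n. g (y n)) \<longlonglongrightarrow> b \<Longrightarrow> a = b"
  obtains l where "l \<in> C" "(g \<longlongrightarrow> l) (ends X i p)"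
proof -
  have sub: "\<exists>l\<in>C. \<exists>r. strict_mono r \<and> (\<lambda>n. g (x (r n))) \<longlonglongrightarrow> l"
    if "\<And>n::nat. x n \<in> topspace X" for x
    using C(1)[unfolded compact_def, rule_format, of "g \<circ> x"] C(2) that by (force simp: o_def)
  obtain x where x: "filterlim x (ends X i p) sequentially" "\<And>n::nat. x n \<in> topspace X"
    using obtain_ends_sequence p boundary_subset by blast
  obtain l r where l: "l \<in> C" "strict_mono r" "(\<lambda>n. g (x (r n))) \<longlonglongrightarrow> l"
    using sub x(2) by blast
  have xr: "filterlim (\<lambda>n. x (r n)) (ends X i p) sequentially"
    using filterlim_compose[OF x(1) filterlim_subseq[OF l(2)]] .
  have "(g \<longlongrightarrow> l) (ends X i p)"
  proof (rule tendsto_ends_sequentially)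
    fix y assume y: "\<And>n. y n \<in> topspace X" "filterlim y (ends X i p) sequentially"
    obtain b s where b: "strict_mono s" "(\<lambda>n. g (y (s n))) \<longlonglongrightarrow> b"
      using sub y(1) by blast
    have "filterlim (\<lambda>n. y (s n)) (ends X i p) sequentially"
      using filterlim_compose[OF y(2) filterlim_subseq[OF b(1)]] .
    then have "b = l"
      using unique[of "\<lambda>n. y (s n)" "\<lambda>n. x (r n)" b l] x(2) y(1) xr b(2) l(3) by blast
    with b show "\<exists>r. strict_mono r \<and> (\<lambda>n. g (y (r n))) \<longlonglongrightarrow> l" by blast
  qed
  with that l(1) show ?thesis by blast
qed

end

locale compactified_pair = X: compactified_space X i + Y: compactified_space Y j
  for X :: "'a topology" and i :: "'a \<Rightarrow> 'k::{metric_space,second_countable_topology}"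
    and Y :: "'b topology" and j :: "'b \<Rightarrow> 'l::{metric_space,second_countable_topology}"
begin

abbreviation coarse :: "('a \<Rightarrow> 'b) \<Rightarrow> bool" where
  "coarse \<equiv> coarse_map (topspace X) (controlled X i) (topspace Y) (controlled Y j)"

lemma filterlim_ends_Y:
  assumes "f \<in> topspace X \<rightarrow> topspace Y" "((\<lambda>x. j (f x)) \<longlongrightarrow> q) (ends X i p)"
  shows "filterlim f (ends Y j q) (ends X i p)"
  unfolding filterlim_ends using assms eventually_ends_topspace[of X i p]
  by (auto elim: eventually_mono)

lemma coarse_bounded_image:
  assumes "coarse f" "coarsely_bounded (controlled X i) B"
  shows "coarsely_bounded (controlled Y j) (f ` B)"
proof -
  have "map_prod f f ` (B \<times> B) = f ` B \<times> f ` B" by auto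
  then show ?thesis
    using assms unfolding coarse_map_def coarsely_bounded_def by metis
qed

text \<open>Control makes the limit independent of the sequence: two sequences tending to
  \<open>p\<close> form a controlled set, and so do their images.\<close>

lemma coarse_boundary_value:
  assumes f: "coarse f" and p: "p \<in> boundary X i"
  obtains q where "q \<in> boundary Y j" "((\<lambda>x. j (f x)) \<longlongrightarrow> q) (ends X i p)"
proof -
  have fS: "f x \<in> topspace Y" if "x \<in> topspace X" for x
    using f that by (auto simp: coarse_map_def)
  \<comment> \<open>Properness keeps limits in the boundary. Were \<open>a\<close> a point of
    \<open>Y\<close>, the image sequence would be bounded, hence so would its preimage, which
    contains every \<open>x n\<close>; but a sequence tending to \<open>p\<close> leaves every
    bounded set.\<close>
  have inD: "a \<in> boundary Y j"
    if x: "\<And>n::nat. x n \<in> topspace X" "filterlim x (ends X i p) sequentially"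
      and a: "(\<lambda>n. j (f (x n))) \<longlonglongrightarrow> a" for x a
  proof (rule ccontr)
    assume "a \<notin> boundary Y j"
    moreover have "a \<in> closure (j ` topspace Y)"
      unfolding closure_sequential using a fS x(1)
      by (intro exI[of _ "\<lambda>n. j (f (x n))"]) simp
    ultimately have "a \<in> j ` topspace Y" by (simp add: boundary_def)
    then have "coarsely_bounded (controlled Y j) (range (\<lambda>n. f (x n)))"
      using fS x(1) a by (intro Y.bounded_sequence[of _ a]) (auto simp: filterlim_ends)
    then have "coarsely_bounded (controlled X i) {z \<in> topspace X. f z \<in> range (\<lambda>n. f (x n))}"
      using f fS x(1) unfolding coarse_map_def by (elim conjE allE[of _ "range (\<lambda>n. f (x n))"]) auto
    then have "eventually (\<lambda>n. x n \<notin> {z \<in> topspace X. f z \<in> range (\<lambda>n. f (x n))}) sequentially"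
      using X.bounded_not_eventually p x(2) by blast
    then show False using x(1) by (auto simp: eventually_sequentially)
  qed
  obtain q where q: "((\<lambda>x. j (f x)) \<longlongrightarrow> q) (ends X i p)"
  proof (rule X.boundary_value_exists[OF Y.compact_closure _ p])
    show "(\<lambda>x. j (f x)) ` topspace X \<subseteq> closure (j ` topspace Y)"
      using fS Y.image_in_closure by auto
    fix x y a b
    assume x: "\<And>n. x n \<in> topspace X" and y: "\<And>n. y n \<in> topspace X"
      and lx: "filterlim x (ends X i p) sequentially" and ly: "filterlim y (ends X i p) sequentially"
      and a: "(\<lambda>n. j (f (x n))) \<longlonglongrightarrow> a" and b: "(\<lambda>n. j (f (y n))) \<longlonglongrightarrow> b"
    have "map_prod f f ` range (\<lambda>n. (x n, y n)) \<in> controlled Y j"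
      using f X.controlled_sequencesI[OF x y lx ly] by (simp add: coarse_map_def)
    then show "a = b"
      by (rule Y.controlledD[where x = "\<lambda>n. f (x n)" and y = "\<lambda>n. f (y n)"])
        (use x y a b fS inD[OF x lx a] in \<open>auto simp: filterlim_ends image_image\<close>)
  qed
  moreover obtain x where "filterlim x (ends X i p) sequentially" "\<And>n::nat. x n \<in> topspace X"
    using obtain_ends_sequence p X.boundary_subset by blast
  moreover from this have "q \<in> boundary Y j"
    using inD[of x q] filterlim_compose[OF q] by blast
  ultimately show ?thesis using that by blast
qed

text \<open>Continuity of \<open>h\<close> is not demanded. Properness follows from the limits by
  \<open>bounded_iff_ends\<close>; control is tested on convergent pairs in the image, pulled back
  to \<open>X\<close> and thinned out to converge there.\<close>

lemma coarseI:
  assumes f: "f \<in> topspace X \<rightarrow> topspace Y"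
    and bdd: "\<And>B. coarsely_bounded (controlled X i) B \<Longrightarrow> coarsely_bounded (controlled Y j) (f ` B)"
    and hD: "\<And>p. p \<in> boundary X i \<Longrightarrow> h p \<in> boundary Y j"
    and lim: "\<And>p. p \<in> boundary X i \<Longrightarrow> ((\<lambda>x. j (f x)) \<longlongrightarrow> h p) (ends X i p)"
  shows "coarse f"
  unfolding coarse_map_def
proof (intro conjI allI impI ballI f)
  have flim: "filterlim f (ends Y j (h p)) (ends X i p)" if "p \<in> boundary X i" for p
    using filterlim_ends_Y f lim that by blast
  {
    fix B assume B: "coarsely_bounded (controlled Y j) B"
    have "eventually (\<lambda>x. f x \<notin> B) (ends X i p)" if p: "p \<in> boundary X i" for p
      using flim[OF p] B hD[OF p] unfolding filterlim_iff Y.bounded_iff_ends by blast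
    then show "coarsely_bounded (controlled X i) {x \<in> topspace X. f x \<in> B}"
      unfolding X.bounded_iff_ends by (auto intro: eventually_mono)
  next
    fix E assume E: "E \<in> controlled X i"
    then have ES: "E \<subseteq> topspace X \<times> topspace X" by (simp add: X.controlled_iff)
    show "map_prod f f ` E \<in> controlled Y j"
    proof (rule Y.controlledI)
      show "map_prod f f ` E \<subseteq> topspace Y \<times> topspace Y" using ES f by auto
      fix u v a b
      assume uv: "\<And>n. (u n, v n) \<in> map_prod f f ` E"
        and u: "filterlim u (ends Y j a) sequentially" and v: "filterlim v (ends Y j b) sequentially"
        and ab: "a \<in> boundary Y j \<or> b \<in> boundary Y j"
      have "\<forall>n. \<exists>x y. (x, y) \<in> E \<and> u n = f x \<and> v n = f y" using uv by fastforce
      then obtain x y where xy: "\<And>n. (x n, y n) \<in> E" "\<And>n. u n = f (x n)" "\<And>n. v n = f (y n)"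
        by metis
      have xyS: "x n \<in> topspace X" "y n \<in> topspace X" for n using xy(1)[of n] ES by auto
      obtain r p q where r: "strict_mono r" "p \<in> closure (i ` topspace X)" "q \<in> closure (i ` topspace X)"
        "filterlim (x \<circ> r) (ends X i p) sequentially" "filterlim (y \<circ> r) (ends X i q) sequentially"
        by (rule X.convergent_pair_subsequence[OF xyS])
      have ur: "filterlim (u \<circ> r) (ends Y j a) sequentially" "filterlim (v \<circ> r) (ends Y j b) sequentially"
        using filterlim_compose[OF u filterlim_subseq[OF r(1)]]
          filterlim_compose[OF v filterlim_subseq[OF r(1)]] by (simp_all add: o_def)
      show "a = b"
      proof (cases "p \<in> boundary X i \<or> q \<in> boundary X i")
        case True
        then have pq: "p = q" "p \<in> boundary X i"
          using X.controlledD[OF E, of "x \<circ> r" "y \<circ> r" p q] xy(1) r by auto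
        have "(\<lambda>n. j (u (r n))) \<longlonglongrightarrow> h p" "(\<lambda>n. j (v (r n))) \<longlonglongrightarrow> h p"
          using filterlim_compose[OF lim[OF pq(2)] r(4)]
            filterlim_compose[OF lim[OF pq(2)] r(5)[folded pq(1)]] by (simp_all add: xy o_def)
        moreover have "(\<lambda>n. j (u (r n))) \<longlonglongrightarrow> a" "(\<lambda>n. j (v (r n))) \<longlonglongrightarrow> b"
          using ur by (simp_all add: filterlim_ends)
        ultimately show ?thesis by (metis LIMSEQ_unique)
      \<comment> \<open>Both pulled-back limits lie in \<open>X\<close>, so these sequences are
        bounded; by \<open>bdd\<close> so are their images, and neither image limit can be a
        boundary point.\<close>
      next
        case False
        then have "p \<in> i ` topspace X" "q \<in> i ` topspace X"
          using r(2,3) by (auto simp: X.closure_eq)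
        then have "coarsely_bounded (controlled X i) (range (x \<circ> r))"
          "coarsely_bounded (controlled X i) (range (y \<circ> r))"
          using xyS X.bounded_sequence[OF _ r(4)] X.bounded_sequence[OF _ r(5)] by auto
        then have B: "coarsely_bounded (controlled Y j) (f ` range (x \<circ> r))"
          "coarsely_bounded (controlled Y j) (f ` range (y \<circ> r))"
          using bdd by blast+
        have "\<not> a \<in> boundary Y j"
          using Y.bounded_not_eventually[OF B(1) _ ur(1)] by (auto simp: xy eventually_sequentially)
        moreover have "\<not> b \<in> boundary Y j"
          using Y.bounded_not_eventually[OF B(2) _ ur(2)] by (auto simp: xy eventually_sequentially)
        ultimately show ?thesis using ab by blast
      qed
    qed
  }
qed

text \<open>A sequence tending to \<open>p\<close> turns closeness into equality of limits.
  Conversely, pairs \<open>(f x, g x)\<close> reaching the boundary of \<open>Y\<close> must come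
  from points \<open>x\<close> tending to the boundary of \<open>X\<close>, since coarse maps send
  bounded sets to bounded sets; there the common limit decides.\<close>

lemma close_iff:
  assumes f: "coarse f" and g: "coarse g"
    and hf: "\<And>p. p \<in> boundary X i \<Longrightarrow> ((\<lambda>x. j (f x)) \<longlongrightarrow> h p) (ends X i p)"
    and hg: "\<And>p. p \<in> boundary X i \<Longrightarrow> ((\<lambda>x. j (g x)) \<longlongrightarrow> k p) (ends X i p)"
  shows "close_maps (topspace X) (controlled Y j) f g \<longleftrightarrow> (\<forall>p\<in>boundary X i. h p = k p)"
proof
  have fS: "f x \<in> topspace Y" "g x \<in> topspace Y" if "x \<in> topspace X" for x
    using f g that by (auto simp: coarse_map_def)
  show "\<forall>p\<in>boundary X i. h p = k p" if c: "close_maps (topspace X) (controlled Y j) f g"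
  proof
    fix p assume p: "p \<in> boundary X i"
    obtain x where x: "filterlim x (ends X i p) sequentially" "\<And>n::nat. x n \<in> topspace X"
      using obtain_ends_sequence p X.boundary_subset by blast
    obtain q where "q \<in> boundary Y j" "((\<lambda>x. j (f x)) \<longlongrightarrow> q) (ends X i p)"
      using coarse_boundary_value[OF f p] by blast
    \<comment> \<open>\<open>controlledD\<close> sees only limits of which at least one is in the
      boundary; uniqueness of limits identifies \<open>h p\<close> with a boundary point.\<close>
    then have "h p \<in> boundary Y j"
      using tendsto_unique[OF X.ends_neq_bot[OF p] hf[OF p]] by blast
    then show "h p = k p"
      using c x fS filterlim_compose[OF hf[OF p] x(1)] filterlim_compose[OF hg[OF p] x(1)]
      unfolding close_maps_def
      by (intro Y.controlledD[where x = "\<lambda>n. f (x n)" and y = "\<lambda>n. g (x n)"])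
        (auto simp: filterlim_ends)
  qed
  assume eq: "\<forall>p\<in>boundary X i. h p = k p"
  show "close_maps (topspace X) (controlled Y j) f g"
    unfolding close_maps_def
  proof (rule Y.controlledI)
    show "(\<lambda>s. (f s, g s)) ` topspace X \<subseteq> topspace Y \<times> topspace Y" using fS by auto
    fix u v a b
    assume uv: "\<And>n. (u n, v n) \<in> (\<lambda>s. (f s, g s)) ` topspace X"
      and u: "filterlim u (ends Y j a) sequentially" and v: "filterlim v (ends Y j b) sequentially"
      and ab: "a \<in> boundary Y j \<or> b \<in> boundary Y j"
    have "\<forall>n. \<exists>x\<in>topspace X. u n = f x \<and> v n = g x" using uv by fastforce
    then obtain x where xy: "\<And>n. u n = f (x n)" "\<And>n. v n = g (x n)" and xS: "\<And>n. x n \<in> topspace X"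
      by metis
    obtain r p where r: "strict_mono r" "p \<in> closure (i ` topspace X)"
      "filterlim (x \<circ> r) (ends X i p) sequentially"
      by (rule X.convergent_subsequence[OF xS])
    have ur: "filterlim (u \<circ> r) (ends Y j a) sequentially" "filterlim (v \<circ> r) (ends Y j b) sequentially"
      using filterlim_compose[OF u filterlim_subseq[OF r(1)]]
        filterlim_compose[OF v filterlim_subseq[OF r(1)]] by (simp_all add: o_def)
    show "a = b"
    proof (cases "p \<in> boundary X i")
      case True
      have "(\<lambda>n. j (u (r n))) \<longlonglongrightarrow> h p" "(\<lambda>n. j (v (r n))) \<longlonglongrightarrow> k p"
        using filterlim_compose[OF hf[OF True] r(3)]
          filterlim_compose[OF hg[OF True] r(3)] by (simp_all add: xy o_def)
      moreover have "(\<lambda>n. j (u (r n))) \<longlonglongrightarrow> a" "(\<lambda>n. j (v (r n))) \<longlonglongrightarrow> b"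
        using ur by (simp_all add: filterlim_ends)
      ultimately show ?thesis using eq True by (metis LIMSEQ_unique)
    next
      case False
      then have "p \<in> i ` topspace X"
        using r(2) by (auto simp: X.closure_eq)
      then have "coarsely_bounded (controlled X i) (range (x \<circ> r))"
        using xS X.bounded_sequence[OF _ r(3)] by auto
      then have B: "coarsely_bounded (controlled Y j) (f ` range (x \<circ> r))"
        "coarsely_bounded (controlled Y j) (g ` range (x \<circ> r))"
        using coarse_bounded_image f g by blast+
      have "\<not> a \<in> boundary Y j"
        using Y.bounded_not_eventually[OF B(1) _ ur(1)] by (auto simp: xy eventually_sequentially)
      moreover have "\<not> b \<in> boundary Y j"
        using Y.bounded_not_eventually[OF B(2) _ ur(2)] by (auto simp: xy eventually_sequentially)
      ultimately show ?thesis using ab by blast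
    qed
  qed
qed

text \<open>The values of the realising map at points at distance about \<open>1/n\<close> from the boundary are
  taken in a finite \<open>1/n\<close>-net of \<open>Y\<close>, so that bounded sets have bounded images.\<close>

lemma boundary_map_realized:
  assumes cont: "continuous_on (boundary X i) h" and hD: "h ` boundary X i \<subseteq> boundary Y j"
    and ne: "topspace X = {} \<or> topspace Y \<noteq> {}"
  obtains f where "f \<in> extensional (topspace X)" "coarse f"
    "\<And>p. p \<in> boundary X i \<Longrightarrow> ((\<lambda>x. j (f x)) \<longlongrightarrow> h p) (ends X i p)"
\<comment> \<open>The distance to an empty set is 0 by convention, so the construction by distances
  breaks down; a constant map works because all limit conditions are vacuous.\<close>
proof (cases "boundary X i = {}")
  case True
  let ?f = "restrict (\<lambda>_. SOME y. y \<in> topspace Y) (topspace X)"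
  have fY: "?f \<in> topspace X \<rightarrow> topspace Y" using ne some_in_eq[of "topspace Y"] by auto
  have "coarse ?f"
  proof (rule coarseI[where h = h])
    fix B assume "coarsely_bounded (controlled X i) B"
    then have B: "B \<subseteq> topspace X" by (simp add: X.bounded_iff)
    then have "?f ` B \<subseteq> {SOME y. y \<in> topspace Y}" by auto
    then have "finite (?f ` B)" using finite_subset by blast
    moreover have "?f ` B \<subseteq> topspace Y" using B fY by blast
    ultimately show "coarsely_bounded (controlled Y j) (?f ` B)"
      by (rule Y.finite_bounded)
  qed (use fY True in auto)
  then show ?thesis using that[of ?f] True by simp
next
  case ne: False
  define \<delta> where "\<delta> x = infdist (i x) (boundary X i)" for x
  \<comment> \<open>The index serves two opposite needs: \<open>1/(N x + 1) < \<delta> x\<close>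
    makes the net error vanish towards the boundary, while a lower bound on \<open>\<delta>\<close>
    bounds \<open>N\<close> and so leaves finitely many nets.\<close>
  define N where "N x = nat \<lfloor>1 / \<delta> x\<rfloor>" for x
  have closed: "closed (boundary X i)" using X.compact_boundary compact_imp_closed by blast
  have \<delta>pos: "\<delta> x > 0" if "x \<in> topspace X" for x
  proof -
    have "i x \<notin> boundary X i" using that by (simp add: boundary_def)
    then show ?thesis
      unfolding \<delta>_def by (rule infdist_pos_not_in_closed[OF closed ne])
  qed
  have N\<delta>: "inverse (real (Suc (N x))) < \<delta> x" if "x \<in> topspace X" for x
  proof -
    have "1 / \<delta> x < real (Suc (N x))" using \<delta>pos[OF that] unfolding N_def by (simp add: floor_le_iff) linarith
    then show ?thesis using \<delta>pos[OF that] by (simp add: field_simps)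
  qed
  have "\<exists>F. finite F \<and> F \<subseteq> topspace Y \<and>
      (\<forall>q\<in>closure (j ` topspace Y). \<exists>y\<in>F. dist (j y) q < inverse (real (Suc n)))" for n
  proof -
    have "closure (j ` topspace Y) \<subseteq> (\<Union>y\<in>topspace Y. ball (j y) (inverse (real (Suc n))))"
    proof
      fix q assume "q \<in> closure (j ` topspace Y)"
      then obtain y where "y \<in> topspace Y" "dist (j y) q < inverse (real (Suc n))"
        unfolding closure_approachable using inverse_positive_iff_positive of_nat_0_less_iff zero_less_Suc
        by (metis imageE)
      then show "q \<in> (\<Union>y\<in>topspace Y. ball (j y) (inverse (real (Suc n))))" by auto
    qed
    then obtain F where "F \<subseteq> topspace Y" "finite F"
      "closure (j ` topspace Y) \<subseteq> (\<Union>y\<in>F. ball (j y) (inverse (real (Suc n))))"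
      using compactE_image[OF Y.compact_closure, of "topspace Y" "\<lambda>y. ball (j y) (inverse (real (Suc n)))"]
      by (metis open_ball)
    then show ?thesis by (intro exI[of _ F]) fastforce
  qed
  then obtain F where F: "\<And>n. finite (F n)" "\<And>n. F n \<subseteq> topspace Y"
    "\<And>n q. q \<in> closure (j ` topspace Y) \<Longrightarrow> \<exists>y\<in>F n. dist (j y) q < inverse (real (Suc n))"
    by metis
  have "\<exists>p\<in>boundary X i. \<delta> x = dist (i x) p" for x
  proof -
    obtain p where p: "p \<in> boundary X i" "\<And>q. q \<in> boundary X i \<Longrightarrow> dist (i x) p \<le> dist (i x) q"
      using continuous_attains_inf[OF X.compact_boundary ne, of "dist (i x)"]
        continuous_on_dist[OF continuous_on_const continuous_on_id] by blast
    then have "\<delta> x = dist (i x) p"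
      unfolding \<delta>_def using ne infdist_le[OF p(1)] by (auto simp: infdist_def intro!: antisym cINF_greatest)
    with p show ?thesis by blast
  qed
  \<comment> \<open>\<open>\<pi> x\<close> is a nearest boundary point, chosen without any
    continuity in \<open>x\<close>.\<close>
  then obtain \<pi> where \<pi>: "\<And>x. \<pi> x \<in> boundary X i" "\<And>x. \<delta> x = dist (i x) (\<pi> x)" by metis
  have "\<exists>y\<in>F (N x). dist (j y) (h (\<pi> x)) < inverse (real (Suc (N x)))" for x
    using F(3) \<pi>(1) hD Y.boundary_subset by blast
  then obtain f' where f': "\<And>x. f' x \<in> F (N x)"
    "\<And>x. dist (j (f' x)) (h (\<pi> x)) < inverse (real (Suc (N x)))" by metis
  define f where "f = restrict f' (topspace X)"
  have lim: "((\<lambda>x. j (f x)) \<longlongrightarrow> h p) (ends X i p)" if p: "p \<in> boundary X i" for p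
  proof (rule tendstoI)
    fix \<epsilon> :: real assume "\<epsilon> > 0"
    then obtain e where e: "e > 0"
      "\<And>q. q \<in> boundary X i \<Longrightarrow> dist q p < e \<Longrightarrow> dist (h q) (h p) < \<epsilon> / 2"
      using cont[unfolded continuous_on_iff, rule_format, OF p, of "\<epsilon>/2"] by auto
    show "eventually (\<lambda>x. dist (j (f x)) (h p) < \<epsilon>) (ends X i p)"
      unfolding eventually_ends
    proof (intro exI conjI ballI impI)
      \<comment> \<open>The bound \<open>e/2\<close> suffices because \<open>\<pi> x\<close> is
        within \<open>\<delta> x + dist (i x) p\<close>, at most twice \<open>dist (i x) p\<close>,
        of \<open>p\<close>; the bound \<open>\<epsilon>/2\<close> controls the net error, which is
        below \<open>\<delta> x\<close>.\<close>
      show "min (e/2) (\<epsilon>/2) > 0" using e \<open>\<epsilon> > 0\<close> by simp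
      fix x assume x: "x \<in> topspace X" "dist (i x) p < min (e/2) (\<epsilon>/2)"
      have le: "\<delta> x \<le> dist (i x) p" unfolding \<delta>_def using p by (rule infdist_le)
      have "dist (\<pi> x) p \<le> \<delta> x + dist (i x) p"
        unfolding \<pi>(2) using dist_triangle3 by blast
      then have "dist (\<pi> x) p < e" using le x(2) by simp
      then have "dist (h (\<pi> x)) (h p) < \<epsilon> / 2" using e(2) \<pi>(1) by blast
      moreover have "dist (j (f x)) (h (\<pi> x)) < \<epsilon> / 2"
        using f'(2)[of x] N\<delta>[OF x(1)] le x by (simp add: f_def)
      ultimately show "dist (j (f x)) (h p) < \<epsilon>"
        using dist_triangle_half_r[of "h (\<pi> x)" "j (f x)" \<epsilon> "h p"] by (simp add: dist_commute)
    qed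
  qed
  have fY: "f \<in> topspace X \<rightarrow> topspace Y" using f'(1) F(2) by (auto simp: f_def)
  have "coarse f"
  proof (rule coarseI[OF fY])
    fix B assume B: "coarsely_bounded (controlled X i) B"
    then have BS: "B \<subseteq> topspace X" by (simp add: X.bounded_iff)
    have "compact (closure (i ` B))"
      using compact_Int_closed[OF X.compact_closure closed_closure, of "i ` B"] BS
      by (simp add: Int_absorb1 closure_mono image_mono)
    \<comment> \<open>The closure of the image of a bounded set is compact and misses the boundary,
      so the distance has a positive minimum on it; the value 1 for empty \<open>B\<close> is
      arbitrary.\<close>
    obtain c where c: "c > 0" "\<And>x. x \<in> B \<Longrightarrow> c \<le> \<delta> x"
    proof (cases "B = {}")
      case False
      obtain z where z: "z \<in> closure (i ` B)"
        "\<And>y. y \<in> closure (i ` B) \<Longrightarrow> infdist z (boundary X i) \<le> infdist y (boundary X i)"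
        using continuous_attains_inf[OF \<open>compact (closure (i ` B))\<close> _ continuous_on_infdist[OF continuous_on_id]] False
        by fastforce
      have "z \<notin> boundary X i" using z(1) B by (auto simp: X.bounded_iff)
      then have "infdist z (boundary X i) > 0"
        by (rule infdist_pos_not_in_closed[OF closed ne])
      moreover have "infdist z (boundary X i) \<le> \<delta> x" if "x \<in> B" for x
        unfolding \<delta>_def using z(2) that closure_subset by (metis image_eqI subsetD)
      ultimately show ?thesis using that by blast
    qed (use that[of 1] in auto)
    have "f ` B \<subseteq> (\<Union>n\<le>nat \<lfloor>1 / c\<rfloor>. F n)"
    proof
      fix y assume "y \<in> f ` B"
      then obtain x where x: "x \<in> B" "y = f x" by blast
      then have "1 / \<delta> x \<le> 1 / c" using c by (simp add: frac_le)
      then have "N x \<le> nat \<lfloor>1 / c\<rfloor>" unfolding N_def by (intro nat_mono floor_mono)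
      then show "y \<in> (\<Union>n\<le>nat \<lfloor>1 / c\<rfloor>. F n)" using f'(1)[of x] x BS by (auto simp: f_def)
    qed
    moreover have "finite (\<Union>n\<le>nat \<lfloor>1 / c\<rfloor>. F n)" using F(1) by blast
    moreover have "f ` B \<subseteq> topspace Y" using fY BS by blast
    ultimately show "coarsely_bounded (controlled Y j) (f ` B)"
      by (meson Y.finite_bounded finite_subset)
  qed (use hD lim in auto)
  then show ?thesis using that[of f] lim by (simp add: f_def)
qed

end


section \<open>The Higson corona as the remainder\<close>

text \<open>Evaluation at \<open>p\<close> of the continuous extensions of the functions in
  \<open>C_h\<close>. It is meant for the whole closure, not just the boundary, so that on
  \<open>X\<close> it reproduces \<open>higson_embedding\<close>.\<close>

definition corona_point :: "'a topology \<Rightarrow> ('a \<Rightarrow> 'k::metric_space) \<Rightarrow> 'k \<Rightarrow> (('a \<Rightarrow> real) \<Rightarrow> real)" where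
  "corona_point X i p = (\<lambda>\<phi>\<in>C_h (X, controlled X i). Lim (ends X i p) \<phi>)"

declare B_h.simps [simp del] C_h.simps [simp del] higson_embedding.simps [simp del]
  higson_compactification.simps [simp del] higson_corona.simps [simp del] corona_class.simps [simp del]

lemma C_h_iff: "\<phi> \<in> C_h (X, \<E>) \<longleftrightarrow> \<phi> \<in> B_h (X, \<E>) \<and> continuous_map X euclideanreal \<phi>"
  by (simp add: C_h.simps)

section \<open>Higson functions and boundary values\<close>

context compactified_space
begin

lemma bounded_away_from_boundary:
  assumes "e > 0"
  shows "coarsely_bounded (controlled X i) {x \<in> topspace X. \<forall>p\<in>boundary X i. e \<le> dist (i x) p}"
  unfolding bounded_iff_ends
proof (intro conjI ballI)
  fix p assume "p \<in> boundary X i"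
  then show "eventually (\<lambda>x. x \<notin> {x \<in> topspace X. \<forall>p\<in>boundary X i. e \<le> dist (i x) p}) (ends X i p)"
    unfolding eventually_ends using assms by (intro exI[of _ e]) force
qed auto

text \<open>For the existence of limits, two sequences tending to \<open>p\<close> form a controlled
  set and eventually leave any bounded set, so their values differ by less than every
  \<open>\<epsilon>\<close>. Conversely, a controlled set violating the oscillation condition yields
  bad pairs that either share a boundary limit, where the values converge together, or stay away
  from the boundary.\<close>

lemma B_h_iff:
  "\<phi> \<in> B_h (X, controlled X i) \<longleftrightarrow> \<phi> \<in> extensional (topspace X) \<and> bounded (\<phi> ` topspace X) \<and>
     (\<forall>p\<in>boundary X i. \<exists>l. (\<phi> \<longlongrightarrow> l) (ends X i p))"
proof (intro iffI conjI ballI)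
  assume \<phi>: "\<phi> \<in> B_h (X, controlled X i)"
  then have osc: "\<exists>B. coarsely_bounded (controlled X i) B \<and> (\<forall>(x, y) \<in> E - B \<times> B. \<bar>\<phi> x - \<phi> y\<bar> < \<epsilon>)"
    if "E \<in> controlled X i" "\<epsilon> > 0" for E \<epsilon>
    using that unfolding B_h.simps mem_Collect_eq by meson
  show "\<phi> \<in> extensional (topspace X)" and bdd: "bounded (\<phi> ` topspace X)"
    using \<phi> by (simp_all add: B_h.simps)
  fix p assume p: "p \<in> boundary X i"
  show "\<exists>l. (\<phi> \<longlongrightarrow> l) (ends X i p)"
  proof (rule boundary_value_exists[OF _ _ p])
    show "compact (closure (\<phi> ` topspace X))" using bdd by (simp add: compact_closure)
    show "\<phi> ` topspace X \<subseteq> closure (\<phi> ` topspace X)" by (rule closure_subset)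
    fix x y a b
    assume x: "\<And>n. x n \<in> topspace X" and y: "\<And>n. y n \<in> topspace X"
      and lx: "filterlim x (ends X i p) sequentially" and ly: "filterlim y (ends X i p) sequentially"
      and a: "(\<lambda>n. \<phi> (x n)) \<longlonglongrightarrow> a" and b: "(\<lambda>n. \<phi> (y n)) \<longlonglongrightarrow> b"
    have "\<bar>a - b\<bar> \<le> \<epsilon>" if \<epsilon>: "\<epsilon> > 0" for \<epsilon>
    proof -
      obtain B where B: "coarsely_bounded (controlled X i) B"
        "\<forall>(x, y) \<in> range (\<lambda>n. (x n, y n)) - B \<times> B. \<bar>\<phi> x - \<phi> y\<bar> < \<epsilon>"
        using osc[OF controlled_sequencesI[OF x y lx ly] \<epsilon>] by blast
      have "eventually (\<lambda>n. \<bar>\<phi> (x n) - \<phi> (y n)\<bar> \<le> \<epsilon>) sequentially"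
        using bounded_not_eventually[OF B(1) p lx]
      proof eventually_elim
        case (elim n)
        then have "(x n, y n) \<in> range (\<lambda>n. (x n, y n)) - B \<times> B" by auto
        from bspec[OF B(2) this] show ?case by simp
      qed
      moreover have "(\<lambda>n. \<bar>\<phi> (x n) - \<phi> (y n)\<bar>) \<longlonglongrightarrow> \<bar>a - b\<bar>"
        by (intro tendsto_rabs tendsto_diff a b)
      ultimately show ?thesis using tendsto_upperbound sequentially_bot by blast
    qed
    then show "a = b" using field_le_epsilon[of "\<bar>a - b\<bar>" 0] by simp
  qed blast
next
  assume \<phi>: "\<phi> \<in> extensional (topspace X) \<and> bounded (\<phi> ` topspace X) \<and>
     (\<forall>p\<in>boundary X i. \<exists>l. (\<phi> \<longlongrightarrow> l) (ends X i p))"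
  \<comment> \<open>One bounded set per \<open>n\<close>, together exhausting \<open>X\<close>: if
    none of them works for \<open>E\<close> and \<open>\<epsilon>\<close>, the failures form a
    single sequence of pairs.\<close>
  define B where "B n = {x \<in> topspace X. \<forall>p\<in>boundary X i. inverse (real (Suc n)) \<le> dist (i x) p}" for n
  have "\<exists>n. \<forall>(x, y) \<in> E - B n \<times> B n. \<bar>\<phi> x - \<phi> y\<bar> < \<epsilon>"
    if E: "E \<in> controlled X i" and \<epsilon>: "\<epsilon> > 0" for E \<epsilon>
  proof (rule ccontr)
    assume "\<not> ?thesis"
    then have "\<forall>n. \<exists>x y. (x, y) \<in> E \<and> \<not> (x \<in> B n \<and> y \<in> B n) \<and> \<not> \<bar>\<phi> x - \<phi> y\<bar> < \<epsilon>" by fast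
    then obtain x y where xy: "\<And>n. (x n, y n) \<in> E" "\<And>n. \<not> (x n \<in> B n \<and> y n \<in> B n)"
      "\<And>n. \<not> \<bar>\<phi> (x n) - \<phi> (y n)\<bar> < \<epsilon>" by metis
    have xyS: "x n \<in> topspace X" "y n \<in> topspace X" for n
      using xy(1)[of n] E by (auto simp: controlled_iff)
    obtain r p q where r: "strict_mono r" "p \<in> closure (i ` topspace X)" "q \<in> closure (i ` topspace X)"
      "filterlim (x \<circ> r) (ends X i p) sequentially" "filterlim (y \<circ> r) (ends X i q) sequentially"
      by (rule convergent_pair_subsequence[OF xyS])
    show False
    proof (cases "p \<in> boundary X i \<or> q \<in> boundary X i")
      case True
      then have pq: "p = q" "p \<in> boundary X i"
        using controlledD[OF E, of "x \<circ> r" "y \<circ> r" p q] xy(1) r by auto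
      obtain l where l: "(\<phi> \<longlongrightarrow> l) (ends X i p)" using \<phi> pq by blast
      have "(\<lambda>n. \<phi> (x (r n))) \<longlonglongrightarrow> l" "(\<lambda>n. \<phi> (y (r n))) \<longlonglongrightarrow> l"
        using filterlim_compose[OF l r(4)] filterlim_compose[OF l r(5)[folded pq(1)]] by (simp_all add: o_def)
      then have "(\<lambda>n. \<bar>\<phi> (x (r n)) - \<phi> (y (r n))\<bar>) \<longlonglongrightarrow> \<bar>l - l\<bar>"
        by (intro tendsto_rabs tendsto_diff)
      then have "eventually (\<lambda>n. \<bar>\<phi> (x (r n)) - \<phi> (y (r n))\<bar> < \<epsilon>) sequentially"
        using \<epsilon> order_tendstoD(2) by fastforce
      then show False using xy(3) by (auto simp: eventually_sequentially)
    next
      case False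
      \<comment> \<open>If the limit \<open>c\<close> is at distance at least \<open>e\<close> from
        the boundary, then eventually \<open>z (r n)\<close> is at distance at least
        \<open>e/2\<close>, which exceeds the shrinking threshold
        \<open>1/(r n + 1)\<close>.\<close>
      have "eventually (\<lambda>n. z (r n) \<in> B (r n)) sequentially"
        if z: "\<And>n. z n \<in> topspace X" "filterlim (z \<circ> r) (ends X i c) sequentially" "c \<notin> boundary X i"
        for z c
      proof -
        have "open (- boundary X i)" using compact_boundary compact_imp_closed by blast
        then obtain e where e: "e > 0" "ball c e \<subseteq> - boundary X i"
          using z(3) by (metis ComplI open_contains_ball)
        have "eventually (\<lambda>n. inverse (real (Suc n)) < e/2) sequentially"
          using LIMSEQ_inverse_real_of_nat e(1) order_tendstoD(2) half_gt_zero by blast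
        then have "eventually (\<lambda>n. inverse (real (Suc (r n))) < e/2) sequentially"
          using filterlim_subseq[OF r(1)] unfolding filterlim_iff by blast
        moreover have "eventually (\<lambda>n. dist (i (z (r n))) c < e/2) sequentially"
          using z(2) e(1) by (intro tendstoD) (auto simp: filterlim_ends)
        ultimately show ?thesis
        proof eventually_elim
          case (elim n)
          have "e \<le> dist c p" if "p \<in> boundary X i" for p
            using subsetD[OF e(2), of p] that by (auto simp: not_less[symmetric])
          then have "e/2 \<le> dist (i (z (r n))) p" if "p \<in> boundary X i" for p
            using that elim(2) dist_triangle3[of c p "i (z (r n))"] by fastforce
          then show ?case using elim(1) z(1) unfolding B_def by fastforce
        qed
      qed
      from this[of x p] this[of y q]
      have "eventually (\<lambda>n. x (r n) \<in> B (r n)) sequentially" "eventually (\<lambda>n. y (r n) \<in> B (r n)) sequentially"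
        using False xyS r(4,5) by blast+
      then have "eventually (\<lambda>n. False) sequentially"
        by eventually_elim (use xy(2) in blast)
      then show False by simp
    qed
  qed
  moreover have "coarsely_bounded (controlled X i) (B n)" "B n \<subseteq> topspace X" for n
    unfolding B_def by (rule bounded_away_from_boundary) auto
  ultimately show "\<phi> \<in> B_h (X, controlled X i)"
    using \<phi> by (simp only: B_h.simps mem_Collect_eq) meson
qed

section \<open>The Higson compactification as the closure of \<open>X\<close>\<close>

lemma tendsto_at_point:
  assumes "continuous_map X euclideanreal \<phi>" "x \<in> topspace X"
  shows "(\<phi> \<longlongrightarrow> \<phi> x) (ends X i (i x))"
proof (rule topological_tendstoI)
  fix U assume U: "open U" "\<phi> x \<in> U"
  let ?V = "{z \<in> topspace X. \<phi> z \<in> U}"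
  have "openin X ?V"
    using openin_continuous_map_preimage[OF assms(1), of U] U(1) by simp
  then have "openin (top_of_set (i ` topspace X)) (i ` ?V)"
    using homeomorphic_imp_open_map[OF homeomorphic] by (simp add: open_map_def)
  then obtain W where W: "open W" "i ` ?V = i ` topspace X \<inter> W"
    by (auto simp: openin_open)
  then have "i x \<in> W" using U assms(2) by blast
  then have "eventually (\<lambda>z. i z \<in> W) (ends X i (i x))"
    using topological_tendstoD[OF tendsto_ends W(1)] by blast
  with eventually_ends_topspace show "eventually (\<lambda>z. \<phi> z \<in> U) (ends X i (i x))"
  proof eventually_elim
    case (elim z)
    then have "i z \<in> i ` ?V" using W(2) by blast
    then show ?case using elim(1) inj_i by (auto simp: inj_on_def)
  qed
qed

lemma C_h_tendsto:
  assumes "\<phi> \<in> C_h (X, controlled X i)" "p \<in> closure (i ` topspace X)"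
  shows "(\<phi> \<longlongrightarrow> Lim (ends X i p) \<phi>) (ends X i p)"
proof -
  have "\<exists>l. (\<phi> \<longlongrightarrow> l) (ends X i p)"
  proof (cases "p \<in> boundary X i")
    case True
    then show ?thesis using assms(1) by (auto simp: C_h_iff B_h_iff)
  next
    case False
    then have "p \<in> i ` topspace X" using assms(2) by (simp add: closure_eq)
    then show ?thesis using tendsto_at_point assms(1) by (auto simp: C_h_iff)
  qed
  then show ?thesis
    using tendsto_Lim[OF ends_nontrivial[OF assms(2)]] by auto
qed

text \<open>Supplies enough Higson functions: distance functions to separate points, and Tietze
  extensions of functions on the boundary.\<close>

lemma restrict_C_h:
  assumes "continuous_on (closure (i ` topspace X)) \<Phi>"
  shows "restrict (\<lambda>x. \<Phi> (i x)) (topspace X) \<in> C_h (X, controlled X i)" (is "?\<phi> \<in> _")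
    and "p \<in> closure (i ` topspace X) \<Longrightarrow>
           (restrict (\<lambda>x. \<Phi> (i x)) (topspace X) \<longlongrightarrow> \<Phi> p) (ends X i p)"
proof -
  have lim: "(?\<phi> \<longlongrightarrow> \<Phi> p) (ends X i p)" if p: "p \<in> closure (i ` topspace X)" for p
  proof -
    have "((\<lambda>x. \<Phi> (i x)) \<longlongrightarrow> \<Phi> p) (ends X i p)"
    proof (rule continuous_on_tendsto_compose[OF assms tendsto_ends p])
      show "eventually (\<lambda>x. i x \<in> closure (i ` topspace X)) (ends X i p)"
        using eventually_ends_topspace by eventually_elim (rule image_in_closure)
    qed
    moreover have "eventually (\<lambda>x. ?\<phi> x = \<Phi> (i x)) (ends X i p)"
      using eventually_ends_topspace by eventually_elim simp
    ultimately show ?thesis by (simp add: tendsto_cong)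
  qed
  then show "p \<in> closure (i ` topspace X) \<Longrightarrow> (?\<phi> \<longlongrightarrow> \<Phi> p) (ends X i p)" .
  have "bounded (\<Phi> ` closure (i ` topspace X))"
    using assms compact_closure compact_continuous_image compact_imp_bounded by blast
  then have "bounded (?\<phi> ` topspace X)"
    by (rule bounded_subset) (use image_in_closure in auto)
  then have "?\<phi> \<in> B_h (X, controlled X i)"
    unfolding B_h_iff using lim boundary_subset by blast
  moreover have "continuous_map X euclideanreal ?\<phi>"
  proof -
    have "continuous_map X (top_of_set (closure (i ` topspace X))) i"
      using homeomorphic_imp_continuous_map[OF homeomorphic] image_in_closure
      by (auto simp: continuous_map_in_subtopology)
    then have "continuous_map X euclideanreal (\<Phi> \<circ> i)"
      using assms by (intro continuous_map_compose) auto
    then show ?thesis by (rule continuous_map_eq) simp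
  qed
  ultimately show "?\<phi> \<in> C_h (X, controlled X i)" by (simp only: C_h_iff)
qed

lemma Lim_restrict:
  fixes \<Phi> :: "'k \<Rightarrow> real"
  assumes "continuous_on (closure (i ` topspace X)) \<Phi>" "p \<in> closure (i ` topspace X)"
  shows "Lim (ends X i p) (restrict (\<lambda>x. \<Phi> (i x)) (topspace X)) = \<Phi> p"
  by (rule tendsto_Lim[OF ends_nontrivial[OF assms(2)] restrict_C_h(2)[OF assms]])

text \<open>Each coordinate is a function of limits, hence continuous by
  \<open>boundary_values_continuous\<close>; a continuous injection of a compact space into a
  Hausdorff space is an embedding.\<close>

lemma corona_point_embedding:
  "embedding_map (top_of_set (closure (i ` topspace X))) (powertop_real (C_h (X, controlled X i)))
     (corona_point X i)"
proof (rule continuous_imp_embedding_map)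
  let ?K = "closure (i ` topspace X)"
  show "continuous_map (top_of_set ?K) (powertop_real (C_h (X, controlled X i))) (corona_point X i)"
    unfolding continuous_map_componentwise
  proof (intro conjI ballI)
    show "corona_point X i ` topspace (top_of_set ?K) \<subseteq> extensional (C_h (X, controlled X i))"
      by (auto simp: corona_point_def)
    fix \<phi> assume \<phi>: "\<phi> \<in> C_h (X, controlled X i)"
    have "continuous_on ?K (\<lambda>p. Lim (ends X i p) \<phi>)"
      using C_h_tendsto[OF \<phi>] by (rule boundary_values_continuous[OF order_refl])
    then show "continuous_map (top_of_set ?K) euclideanreal (\<lambda>p. corona_point X i p \<phi>)"
      using \<phi> by (simp add: corona_point_def)
  qed
  show "compact_space (top_of_set ?K)"
    using compact_closure compact_space_subtopology compactin_euclidean_iff by blast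
  show "Hausdorff_space (powertop_real (C_h (X, controlled X i)))"
    by (simp add: Hausdorff_space_product_topology)
  show "inj_on (corona_point X i) (topspace (top_of_set ?K))"
  proof (rule inj_onI)
    fix p q assume pq: "p \<in> topspace (top_of_set ?K)" "q \<in> topspace (top_of_set ?K)"
      and eq: "corona_point X i p = corona_point X i q"
    \<comment> \<open>The extension of this function is the distance from \<open>p\<close>, which
      vanishes at \<open>p\<close> only.\<close>
    let ?\<phi> = "restrict (\<lambda>x. dist p (i x)) (topspace X)"
    have c: "continuous_on ?K (dist p)" by (intro continuous_intros)
    have "corona_point X i p ?\<phi> = corona_point X i q ?\<phi>" by (simp only: eq)
    then have "dist p p = dist p q"
      using restrict_C_h(1)[OF c] Lim_restrict[OF c] pq unfolding corona_point_def by simp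
    then show "p = q" by simp
  qed
qed

lemma inj_corona_point: "inj_on (corona_point X i) (closure (i ` topspace X))"
  using corona_point_embedding homeomorphic_imp_injective_map
  by (fastforce simp: embedding_map_def)

lemma corona_point_image:
  assumes "x \<in> topspace X"
  shows "corona_point X i (i x) = higson_embedding (X, controlled X i) x"
  unfolding corona_point_def higson_embedding.simps
proof (rule restrict_ext)
  fix \<phi> assume "\<phi> \<in> C_h (X, controlled X i)"
  then have "(\<phi> \<longlongrightarrow> \<phi> x) (ends X i (i x))" using tendsto_at_point assms by (simp add: C_h_iff)
  then show "Lim (ends X i (i x)) \<phi> = \<phi> x"
    using tendsto_Lim[OF ends_nontrivial[OF image_in_closure[OF assms]]] by blast
qed

lemma closure_of_higson_embedding:
  "powertop_real (C_h (X, controlled X i)) closure_of (higson_embedding (X, controlled X i) ` topspace X)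
     = corona_point X i ` closure (i ` topspace X)" (is "?P closure_of ?A = ?e ` ?K")
proof
  have A: "?A = ?e ` (i ` topspace X)"
    unfolding image_image by (intro image_cong refl corona_point_image[symmetric])
  have cont: "continuous_map (top_of_set ?K) ?P ?e"
    using homeomorphic_imp_continuous_map[OF corona_point_embedding[unfolded embedding_map_def]]
    by (simp only: continuous_map_in_subtopology)
  have "compactin ?P (?e ` ?K)"
    by (rule image_compactin[OF _ cont])
      (simp add: compactin_subtopology compact_closure)
  then have "closedin ?P (?e ` ?K)"
    by (intro compactin_imp_closedin) (auto simp: Hausdorff_space_product_topology)
  then show "?P closure_of ?A \<subseteq> ?e ` ?K"
    unfolding A by (intro closure_of_minimal image_mono closure_subset)
  have "?e ` (top_of_set ?K closure_of (i ` topspace X)) \<subseteq> ?P closure_of (?e ` (i ` topspace X))"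
    by (rule continuous_map_image_closure_subset[OF cont])
  then show "?e ` ?K \<subseteq> ?P closure_of ?A"
    unfolding A using closure_subset[of "i ` topspace X"]
    by (simp add: closure_of_subtopology Int_absorb1)
qed

lemma higson_corona_eq:
  "higson_corona (X, controlled X i) =
     subtopology (powertop_real (C_h (X, controlled X i))) (corona_point X i ` boundary X i)"
proof -
  let ?P = "powertop_real (C_h (X, controlled X i))" and ?e = "corona_point X i"
  have sub: "?e ` closure (i ` topspace X) \<subseteq> topspace ?P"
    using closure_of_subset_topspace[of ?P] by (simp only: closure_of_higson_embedding[symmetric])
  have "higson_embedding (X, controlled X i) ` topspace X = ?e ` (i ` topspace X)"
    unfolding image_image by (intro image_cong refl corona_point_image[symmetric])
  then have "?e ` closure (i ` topspace X) - higson_embedding (X, controlled X i) ` topspace X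
      = ?e ` boundary X i"
    using inj_on_image_set_diff[OF inj_corona_point, of "closure (i ` topspace X)" "i ` topspace X"]
      closure_subset[of "i ` topspace X"] by (simp add: boundary_def Diff_subset)
  then show ?thesis
    using sub boundary_subset unfolding higson_corona.simps higson_compactification.simps closure_of_higson_embedding
    by (simp add: subtopology_subtopology Int_absorb1 Int_absorb2 image_mono del: topspace_product_topology)
qed

lemma topspace_corona:
  "topspace (higson_corona (X, controlled X i)) = corona_point X i ` boundary X i"
proof -
  have "corona_point X i p \<in> topspace (powertop_real (C_h (X, controlled X i)))" for p
    by (simp add: corona_point_def)
  then show ?thesis unfolding higson_corona_eq topspace_subtopology by (simp only: Int_absorb1 image_subsetI)
qed

lemma homeomorphic_corona:
  "homeomorphic_map (top_of_set (boundary X i)) (higson_corona (X, controlled X i)) (corona_point X i)"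
proof -
  let ?K = "closure (i ` topspace X)" and ?P = "powertop_real (C_h (X, controlled X i))"
    and ?e = "corona_point X i"
  have K: "?e ` ?K \<subseteq> topspace ?P" by (auto simp: corona_point_def)
  have D: "?K \<inter> boundary X i = boundary X i" "?e ` ?K \<inter> ?e ` boundary X i = ?e ` boundary X i"
    using boundary_subset by auto
  have "homeomorphic_map (subtopology (top_of_set ?K) (boundary X i))
      (subtopology (subtopology ?P (?e ` ?K)) (?e ` boundary X i)) ?e"
  proof (rule homeomorphic_map_subtopologies)
    show "homeomorphic_map (top_of_set ?K) (subtopology ?P (?e ` ?K)) ?e"
      using corona_point_embedding by (simp add: embedding_map_def)
    show "?e ` (topspace (top_of_set ?K) \<inter> boundary X i)
        = topspace (subtopology ?P (?e ` ?K)) \<inter> ?e ` boundary X i"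
      using K D by (simp only: topspace_subtopology topspace_euclidean Int_UNIV_left) blast
  qed
  then show ?thesis
    by (simp only: higson_corona_eq subtopology_subtopology D)
qed

section \<open>Functions vanishing at infinity and classes on the corona\<close>

lemma B_0_tendsto:
  assumes "\<phi> \<in> B_0 X" "p \<in> boundary X i"
  shows "(\<phi> \<longlongrightarrow> 0) (ends X i p)"
proof (rule tendstoI)
  fix \<epsilon> :: real assume "\<epsilon> > 0"
  then obtain C where C: "compactin X C" "\<forall>x\<in>topspace X - C. \<bar>\<phi> x\<bar> < \<epsilon>"
    using assms(1) by (auto simp: B_0_def)
  have "compact (i ` C)"
    using image_compactin[OF C(1) homeomorphic_imp_continuous_map[OF homeomorphic]]
    by (simp add: compactin_subtopology)
  then have "closure (i ` C) = i ` C" by (simp add: compact_imp_closed)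
  moreover have "C \<subseteq> topspace X" using C(1) compactin_subset_topspace by blast
  ultimately have "coarsely_bounded (controlled X i) C"
    unfolding bounded_iff by (auto simp: boundary_def)
  then have "eventually (\<lambda>x. x \<notin> C) (ends X i p)"
    using assms(2) by (simp add: bounded_iff_ends)
  with eventually_ends_topspace show "eventually (\<lambda>x. dist (\<phi> x) 0 < \<epsilon>) (ends X i p)"
    by eventually_elim (use C(2) in auto)
qed

text \<open>The closure of the image of \<open>B\<close> is compact inside the image of
  \<open>X\<close>, so it can be carried back by the inverse homeomorphism.\<close>

lemma bounded_subset_compactin:
  assumes "coarsely_bounded (controlled X i) B"
  obtains C where "compactin X C" "B \<subseteq> C"
proof -
  let ?L = "closure (i ` B)"
  obtain i' where i': "homeomorphic_maps X (top_of_set (i ` topspace X)) i i'"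
    using homeomorphic homeomorphic_map_maps by blast
  have BS: "B \<subseteq> topspace X" "?L \<inter> boundary X i = {}" using assms by (auto simp: bounded_iff)
  have LK: "?L \<subseteq> closure (i ` topspace X)" using BS by (simp add: closure_mono image_mono)
  then have "?L \<subseteq> i ` topspace X" using BS(2) by (auto simp: closure_eq)
  moreover have "compact ?L"
    using compact_Int_closed[OF compact_closure closed_closure, of "i ` B"] LK by (simp add: Int_absorb1)
  ultimately have "compactin (top_of_set (i ` topspace X)) ?L" by (simp add: compactin_subtopology)
  then have "compactin X (i' ` ?L)"
    using image_compactin i' by (auto simp: homeomorphic_maps_def)
  moreover have "B \<subseteq> i' ` ?L"
  proof
    fix x assume "x \<in> B"
    moreover from this have "i x \<in> ?L" using closure_subset[of "i ` B"] by blast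
    moreover have "i' (i x) = x" using \<open>x \<in> B\<close> BS(1) i' by (auto simp: homeomorphic_maps_def)
    ultimately show "x \<in> i' ` ?L" by (metis imageI)
  qed
  ultimately show ?thesis using that by blast
qed

lemma B_0_I:
  assumes "\<phi> \<in> extensional (topspace X)" "bounded (\<phi> ` topspace X)"
    and lim: "\<And>p. p \<in> boundary X i \<Longrightarrow> (\<phi> \<longlongrightarrow> 0) (ends X i p)"
  shows "\<phi> \<in> B_0 X"
  unfolding B_0_def
proof (intro CollectI conjI assms(1,2) allI impI)
  fix \<epsilon> :: real assume \<epsilon>: "\<epsilon> > 0"
  have "coarsely_bounded (controlled X i) {x \<in> topspace X. \<bar>\<phi> x\<bar> \<ge> \<epsilon>}"
    unfolding bounded_iff_ends
  proof (intro conjI ballI)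
    fix p assume "p \<in> boundary X i"
    from tendstoD[OF lim[OF this] \<epsilon>]
    show "eventually (\<lambda>x. x \<notin> {x \<in> topspace X. \<bar>\<phi> x\<bar> \<ge> \<epsilon>}) (ends X i p)"
      by eventually_elim auto
  qed auto
  then obtain C where "compactin X C" "{x \<in> topspace X. \<bar>\<phi> x\<bar> \<ge> \<epsilon>} \<subseteq> C"
    by (rule bounded_subset_compactin)
  then show "\<exists>C. compactin X C \<and> (\<forall>x\<in>topspace X - C. \<bar>\<phi> x\<bar> < \<epsilon>)"
    by (intro exI[of _ C]) (auto simp: not_le[symmetric])
qed

text \<open>This eliminates the continuous representative. It has the same boundary values as
  \<open>\<phi>\<close>, because the difference vanishes at infinity; conversely, Tietze extends the
  boundary function of \<open>\<psi>\<close> to the whole closure, and the restriction to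
  \<open>X\<close> of this extension is a representative.\<close>

lemma corona_class_iff:
  "corona_class (X, controlled X i) \<phi> \<psi> \<longleftrightarrow> \<phi> \<in> B_h (X, controlled X i) \<and>
     continuous_map (higson_corona (X, controlled X i)) euclideanreal \<psi> \<and>
     (\<forall>p\<in>boundary X i. (\<phi> \<longlongrightarrow> \<psi> (corona_point X i p)) (ends X i p))"
proof -
  have "(\<exists>\<phi>'\<in>C_h (X, controlled X i). (\<lambda>x\<in>topspace X. \<phi> x - \<phi>' x) \<in> B_0 X \<and>
        (\<forall>p\<in>topspace (higson_corona (X, controlled X i)). \<psi> p = p \<phi>')) \<longleftrightarrow>
      (\<forall>p\<in>boundary X i. (\<phi> \<longlongrightarrow> \<psi> (corona_point X i p)) (ends X i p))" (is "?l = ?r")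
    if \<phi>: "\<phi> \<in> B_h (X, controlled X i)"
      and \<psi>: "continuous_map (higson_corona (X, controlled X i)) euclideanreal \<psi>"
  proof (intro iffI ballI)
    fix p assume ?l and p: "p \<in> boundary X i"
    then obtain \<phi>' where \<phi>': "\<phi>' \<in> C_h (X, controlled X i)" "(\<lambda>x\<in>topspace X. \<phi> x - \<phi>' x) \<in> B_0 X"
      "\<psi> (corona_point X i p) = corona_point X i p \<phi>'"
      unfolding topspace_corona by blast
    have "((\<lambda>x. (\<lambda>x\<in>topspace X. \<phi> x - \<phi>' x) x + \<phi>' x) \<longlongrightarrow> 0 + \<psi> (corona_point X i p)) (ends X i p)"
    proof (rule tendsto_add[OF B_0_tendsto[OF \<phi>'(2) p]])
      show "(\<phi>' \<longlongrightarrow> \<psi> (corona_point X i p)) (ends X i p)"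
        using C_h_tendsto[OF \<phi>'(1), of p] \<phi>'(1,3) p boundary_subset
        by (auto simp: corona_point_def)
    qed
    moreover have "eventually (\<lambda>x. (\<lambda>x\<in>topspace X. \<phi> x - \<phi>' x) x + \<phi>' x = \<phi> x) (ends X i p)"
      using eventually_ends_topspace by eventually_elim simp
    ultimately show "(\<phi> \<longlongrightarrow> \<psi> (corona_point X i p)) (ends X i p)" by (simp add: tendsto_cong)
  next
    assume ?r
    have "continuous_map (top_of_set (boundary X i)) euclideanreal (\<psi> \<circ> corona_point X i)"
      using homeomorphic_imp_continuous_map[OF homeomorphic_corona] \<psi> by (rule continuous_map_compose)
    then have "continuous_on (boundary X i) (\<psi> \<circ> corona_point X i)" by simp
    moreover have "closedin (top_of_set (closure (i ` topspace X))) (boundary X i)"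
      using compact_boundary boundary_subset by (simp add: closed_subset compact_imp_closed)
    ultimately obtain \<Phi> where \<Phi>: "continuous_on (closure (i ` topspace X)) \<Phi>"
      "\<And>p. p \<in> boundary X i \<Longrightarrow> \<Phi> p = \<psi> (corona_point X i p)"
      using Tietze_unbounded[of "boundary X i" "\<psi> \<circ> corona_point X i"] by auto
    let ?\<phi>' = "restrict (\<lambda>x. \<Phi> (i x)) (topspace X)"
    have C: "?\<phi>' \<in> C_h (X, controlled X i)" by (rule restrict_C_h(1)[OF \<Phi>(1)])
    have "(\<lambda>x\<in>topspace X. \<phi> x - ?\<phi>' x) \<in> B_0 X"
    proof (rule B_0_I)
      have "bounded (\<phi> ` topspace X)" "bounded (?\<phi>' ` topspace X)"
        using \<phi> C by (simp_all only: C_h_iff B_h_iff)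
      then have "bounded ((\<lambda>x. \<phi> x - ?\<phi>' x) ` topspace X)" by (rule bounded_minus_comp)
      then show "bounded ((\<lambda>x\<in>topspace X. \<phi> x - ?\<phi>' x) ` topspace X)"
        by simp
      fix p assume p: "p \<in> boundary X i"
      have "((\<lambda>x. \<phi> x - ?\<phi>' x) \<longlongrightarrow> \<psi> (corona_point X i p) - \<Phi> p) (ends X i p)"
        using \<open>?r\<close> p boundary_subset by (intro tendsto_diff restrict_C_h(2)[OF \<Phi>(1)]) auto
      moreover have "eventually (\<lambda>x. (\<lambda>x\<in>topspace X. \<phi> x - ?\<phi>' x) x = \<phi> x - ?\<phi>' x) (ends X i p)"
        using eventually_ends_topspace by eventually_elim simp
      ultimately show "((\<lambda>x\<in>topspace X. \<phi> x - ?\<phi>' x) \<longlongrightarrow> 0) (ends X i p)"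
        using \<Phi>(2)[OF p] by (simp add: tendsto_cong)
    qed auto
    moreover have "\<psi> (corona_point X i p) = corona_point X i p ?\<phi>'" if "p \<in> boundary X i" for p
      using C \<Phi> Lim_restrict[OF \<Phi>(1), of p] that boundary_subset
      by (auto simp: corona_point_def)
    ultimately show ?l using C unfolding topspace_corona by blast
  qed
  then show ?thesis unfolding corona_class.simps by blast
qed

end

section \<open>The corona map of a coarse map\<close>

context compactified_pair
begin

lemma corona_class_compose:
  assumes f: "coarse f" and hD: "\<And>p. p \<in> boundary X i \<Longrightarrow> h p \<in> boundary Y j"
    and lim: "\<And>p. p \<in> boundary X i \<Longrightarrow> ((\<lambda>x. j (f x)) \<longlongrightarrow> h p) (ends X i p)"
    and H: "continuous_map (higson_corona (X, controlled X i)) (higson_corona (Y, controlled Y j)) H"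
      "\<And>p. p \<in> boundary X i \<Longrightarrow> H (corona_point X i p) = corona_point Y j (h p)"
    and cls: "corona_class (Y, controlled Y j) \<phi> \<psi>"
  shows "corona_class (X, controlled X i) (restrict (\<phi> \<circ> f) (topspace X)) (\<psi> \<circ> H)"
proof -
  have fY: "f \<in> topspace X \<rightarrow> topspace Y" using f by (simp add: coarse_map_def)
  have \<phi>: "bounded (\<phi> ` topspace Y)"
    and \<psi>: "continuous_map (higson_corona (Y, controlled Y j)) euclideanreal \<psi>"
    and l: "\<And>q. q \<in> boundary Y j \<Longrightarrow> (\<phi> \<longlongrightarrow> \<psi> (corona_point Y j q)) (ends Y j q)"
    using cls unfolding Y.corona_class_iff Y.B_h_iff by auto
  have lim': "(restrict (\<phi> \<circ> f) (topspace X) \<longlongrightarrow> (\<psi> \<circ> H) (corona_point X i p)) (ends X i p)"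
    if p: "p \<in> boundary X i" for p
  proof -
    have "((\<lambda>x. \<phi> (f x)) \<longlongrightarrow> \<psi> (corona_point Y j (h p))) (ends X i p)"
      using filterlim_compose[OF l[OF hD[OF p]] filterlim_ends_Y[OF fY lim[OF p]]] .
    moreover have "eventually (\<lambda>x. restrict (\<phi> \<circ> f) (topspace X) x = \<phi> (f x)) (ends X i p)"
      using eventually_ends_topspace by eventually_elim simp
    ultimately show ?thesis using H(2)[OF p] by (simp add: tendsto_cong)
  qed
  have "bounded (restrict (\<phi> \<circ> f) (topspace X) ` topspace X)"
    by (rule bounded_subset[OF \<phi>]) (use fY in auto)
  then show ?thesis
    unfolding X.corona_class_iff X.B_h_iff using lim' continuous_map_compose[OF H(1) \<psi>] by auto
qed

lemma corona_transfer_continuous: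
  assumes cont: "continuous_on (boundary X i) h" and hD: "h ` boundary X i \<subseteq> boundary Y j"
  shows "continuous_map (higson_corona (X, controlled X i)) (higson_corona (Y, controlled Y j))
    (\<lambda>t\<in>corona_point X i ` boundary X i.
       corona_point Y j (h (inv_into (boundary X i) (corona_point X i) t)))" (is "continuous_map _ _ ?H")
proof -
  let ?A = "(X, controlled X i)" and ?B = "(Y, controlled Y j)"
  have inj: "inj_on (corona_point X i) (boundary X i)"
    using X.inj_corona_point X.boundary_subset inj_on_subset by blast
  obtain g where g: "homeomorphic_maps (top_of_set (boundary X i)) (higson_corona ?A) (corona_point X i) g"
    using X.homeomorphic_corona homeomorphic_map_maps by blast
  have h: "continuous_map (top_of_set (boundary X i)) (top_of_set (boundary Y j)) h"
    using cont hD by (auto simp: continuous_map_in_subtopology)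
  have "continuous_map (higson_corona ?A) (higson_corona ?B) (corona_point Y j \<circ> (h \<circ> g))"
    using g h homeomorphic_imp_continuous_map[OF Y.homeomorphic_corona]
    unfolding homeomorphic_maps_def by (meson continuous_map_compose)
  moreover have "(corona_point Y j \<circ> (h \<circ> g)) t = ?H t" if t: "t \<in> topspace (higson_corona ?A)" for t
  proof -
    obtain p where "p \<in> boundary X i" "t = corona_point X i p"
      using t unfolding X.topspace_corona by blast
    then show ?thesis using g inj by (simp add: homeomorphic_maps_def)
  qed
  ultimately show ?thesis by (rule continuous_map_eq)
qed

text \<open>Justifies the definite description: the boundary map transported to the coronas has the
  defining property by composition of limits, and the coordinate functions of the corona of
  \<open>Y\<close> force any other solution to agree with it.\<close>

lemma higson_corona_map_eq:
  assumes f: "coarse f" and hD: "\<And>p. p \<in> boundary X i \<Longrightarrow> h p \<in> boundary Y j"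
    and lim: "\<And>p. p \<in> boundary X i \<Longrightarrow> ((\<lambda>x. j (f x)) \<longlongrightarrow> h p) (ends X i p)"
  shows "higson_corona_map (X, controlled X i) (Y, controlled Y j) f =
    (\<lambda>t\<in>corona_point X i ` boundary X i.
       corona_point Y j (h (inv_into (boundary X i) (corona_point X i) t)))" (is "_ = ?H")
  unfolding higson_corona_map_def
proof (rule the_equality)
  let ?A = "(X, controlled X i)" and ?B = "(Y, controlled Y j)"
  have inj: "inj_on (corona_point X i) (boundary X i)"
    using X.inj_corona_point X.boundary_subset inj_on_subset by blast
  have H: "?H (corona_point X i p) = corona_point Y j (h p)" if "p \<in> boundary X i" for p
    using that inj by simp
  have contH: "continuous_map (higson_corona ?A) (higson_corona ?B) ?H"
    using boundary_values_continuous[OF X.boundary_subset lim] hD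
    by (intro corona_transfer_continuous) auto
  show "continuous_map (higson_corona ?A) (higson_corona ?B) ?H \<and>
     ?H \<in> extensional (topspace (higson_corona ?A)) \<and>
     (\<forall>\<phi> \<psi>. corona_class ?B \<phi> \<psi> \<longrightarrow> corona_class ?A (restrict (\<phi> \<circ> f) (topspace (fst ?A))) (\<psi> \<circ> ?H))"
    unfolding X.topspace_corona fst_conv
    by (intro conjI allI impI contH restrict_extensional corona_class_compose[OF f hD lim contH H])
  fix G assume "continuous_map (higson_corona ?A) (higson_corona ?B) G \<and>
     G \<in> extensional (topspace (higson_corona ?A)) \<and>
     (\<forall>\<phi> \<psi>. corona_class ?B \<phi> \<psi> \<longrightarrow> corona_class ?A (restrict (\<phi> \<circ> f) (topspace (fst ?A))) (\<psi> \<circ> G))"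
  then have G: "continuous_map (higson_corona ?A) (higson_corona ?B) G"
    "G \<in> extensional (corona_point X i ` boundary X i)"
    "\<And>\<phi> \<psi>. corona_class ?B \<phi> \<psi> \<Longrightarrow> corona_class ?A (restrict (\<phi> \<circ> f) (topspace X)) (\<psi> \<circ> G)"
    by (auto simp: X.topspace_corona)
  show "G = ?H"
  proof (rule extensionalityI[OF G(2)])
    fix t assume "t \<in> corona_point X i ` boundary X i"
    then obtain p where p: "p \<in> boundary X i" "t = corona_point X i p" by blast
    then have "t \<in> topspace (higson_corona ?A)" by (simp add: X.topspace_corona)
    then have "G t \<in> topspace (higson_corona ?B)" "?H t \<in> topspace (higson_corona ?B)"
      using funcset_mem[OF continuous_map_funspace[OF G(1)]]
        funcset_mem[OF continuous_map_funspace[OF contH]] by blast+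
    moreover have "s \<in> extensional (C_h ?B)" if "s \<in> topspace (higson_corona ?B)" for s
      using that unfolding Y.topspace_corona by (auto simp: corona_point_def)
    ultimately have ext: "G t \<in> extensional (C_h ?B)" "?H t \<in> extensional (C_h ?B)" by blast+
    show "G t = ?H t"
    proof (rule extensionalityI[OF ext])
      fix \<phi> assume \<phi>: "\<phi> \<in> C_h ?B"
      \<comment> \<open>Points of the corona are determined by their coordinates, and the coordinate
        at \<open>\<phi>\<close> is the function in the class of \<open>\<phi>\<close>. Both
        \<open>G\<close> and \<open>?H\<close> must then send \<open>t\<close> to a point whose
        coordinate is the limit of \<open>\<phi> \<circ> f\<close> at \<open>p\<close>.\<close>
      have "continuous_map (higson_corona ?B) euclideanreal (\<lambda>s. s \<phi>)"
        unfolding Y.higson_corona_eq using \<phi>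
        by (intro continuous_map_from_subtopology continuous_map_product_projection)
      moreover have "(\<phi> \<longlongrightarrow> corona_point Y j q \<phi>) (ends Y j q)" if "q \<in> boundary Y j" for q
        using Y.C_h_tendsto[OF \<phi>, of q] \<phi> that Y.boundary_subset by (auto simp: corona_point_def)
      ultimately have cls: "corona_class ?B \<phi> (\<lambda>s. s \<phi>)"
        unfolding Y.corona_class_iff using \<phi> by (simp add: C_h_iff)
      have "(restrict (\<phi> \<circ> f) (topspace X) \<longlongrightarrow> G t \<phi>) (ends X i p)"
        "(restrict (\<phi> \<circ> f) (topspace X) \<longlongrightarrow> ?H t \<phi>) (ends X i p)"
        using G(3)[OF cls] corona_class_compose[OF f hD lim contH H cls] p
        unfolding X.corona_class_iff by (simp_all only: o_def)
      then show "G t \<phi> = ?H t \<phi>"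
        using tendsto_unique X.ends_neq_bot p(1) by blast
    qed
  qed auto
qed

end


section \<open>Categories and coarse equivalence\<close>

text \<open>For each \<open>Z\<close> an object \<open>Go Z\<close> and an isomorphism
  \<open>e Z\<close> from its image to \<open>Z\<close> are chosen; morphisms are conjugated by
  these isomorphisms and lifted by fullness. Equations in \<open>C\<close> are verified after
  applying the functor and reflected by faithfulness.\<close>

lemma equivalence_of_categoriesI:
  assumes F: "is_functor C D Fo Fm"
    and full: "\<And>A B g. A \<in> Obj C \<Longrightarrow> B \<in> Obj C \<Longrightarrow> g \<in> Hom D (Fo A) (Fo B) \<Longrightarrow>
      \<exists>f\<in>Hom C A B. Fm A B f = g"
    and faithful: "\<And>A B f g. A \<in> Obj C \<Longrightarrow> B \<in> Obj C \<Longrightarrow> f \<in> Hom C A B \<Longrightarrow> g \<in> Hom C A B \<Longrightarrow>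
      Fm A B f = Fm A B g \<Longrightarrow> f = g"
    and ess: "\<And>Z. Z \<in> Obj D \<Longrightarrow> \<exists>A\<in>Obj C. \<exists>e. is_iso D (Fo A) Z e"
  shows "is_equivalence_of_categories C D Fo Fm"
proof -
  have C: "is_category C" and D: "is_category D" using F by (auto simp: is_functor_def)
  have Fo: "Fo A \<in> Obj D" if "A \<in> Obj C" for A using F that by (auto simp: is_functor_def)
  have Fm: "Fm A B f \<in> Hom D (Fo A) (Fo B)" if "A \<in> Obj C" "B \<in> Obj C" "f \<in> Hom C A B" for A B f
    using F that by (auto simp: is_functor_def)
  have Fid: "Fm A A (Ident C A) = Ident D (Fo A)" if "A \<in> Obj C" for A
    using F that by (auto simp: is_functor_def)
  have Fcomp: "Fm A E (Comp C A B E g f) = Comp D (Fo A) (Fo B) (Fo E) (Fm B E g) (Fm A B f)"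
    if "A \<in> Obj C" "B \<in> Obj C" "E \<in> Obj C" "f \<in> Hom C A B" "g \<in> Hom C B E" for A B E f g
    using F that by (auto simp: is_functor_def)
  have idC: "Ident C A \<in> Hom C A A" if "A \<in> Obj C" for A using C that by (auto simp: is_category_def)
  have idD: "Ident D A \<in> Hom D A A" if "A \<in> Obj D" for A using D that by (auto simp: is_category_def)
  have cC: "Comp C A B E g f \<in> Hom C A E"
    if "A \<in> Obj C" "B \<in> Obj C" "E \<in> Obj C" "f \<in> Hom C A B" "g \<in> Hom C B E" for A B E f g
    using C that by (auto simp: is_category_def)
  have cD: "Comp D A B E g f \<in> Hom D A E"
    if "A \<in> Obj D" "B \<in> Obj D" "E \<in> Obj D" "f \<in> Hom D A B" "g \<in> Hom D B E" for A B E f g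
    using D that by (auto simp: is_category_def)
  have unitD: "Comp D A A B f (Ident D A) = f" "Comp D A B B (Ident D B) f = f"
    if "A \<in> Obj D" "B \<in> Obj D" "f \<in> Hom D A B" for A B f
    using D that by (auto simp: is_category_def)
  have assocD: "Comp D A B G (Comp D B E G h g) f = Comp D A E G h (Comp D A B E g f)"
    if "A \<in> Obj D" "B \<in> Obj D" "E \<in> Obj D" "G \<in> Obj D" "f \<in> Hom D A B" "g \<in> Hom D B E" "h \<in> Hom D E G"
    for A B E G f g h
    using D that by (auto simp: is_category_def)
  have "\<exists>A e e'. A \<in> Obj C \<and> e \<in> Hom D (Fo A) Z \<and> e' \<in> Hom D Z (Fo A) \<and>
      Comp D (Fo A) Z (Fo A) e' e = Ident D (Fo A) \<and> Comp D Z (Fo A) Z e e' = Ident D Z"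
    if "Z \<in> Obj D" for Z
    using ess[OF that] unfolding is_iso_def by blast
  then obtain Go e e' where e: "\<And>Z. Z \<in> Obj D \<Longrightarrow> Go Z \<in> Obj C"
    "\<And>Z. Z \<in> Obj D \<Longrightarrow> e Z \<in> Hom D (Fo (Go Z)) Z" "\<And>Z. Z \<in> Obj D \<Longrightarrow> e' Z \<in> Hom D Z (Fo (Go Z))"
    "\<And>Z. Z \<in> Obj D \<Longrightarrow> Comp D (Fo (Go Z)) Z (Fo (Go Z)) (e' Z) (e Z) = Ident D (Fo (Go Z))"
    "\<And>Z. Z \<in> Obj D \<Longrightarrow> Comp D Z (Fo (Go Z)) Z (e Z) (e' Z) = Ident D Z"
    by metis
  have GoD: "Fo (Go Z) \<in> Obj D" if "Z \<in> Obj D" for Z using Fo e(1) that by blast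
  define lift where "lift A B g = (SOME f. f \<in> Hom C A B \<and> Fm A B f = g)" for A B g
  have lift: "lift A B g \<in> Hom C A B" "Fm A B (lift A B g) = g"
    if "A \<in> Obj C" "B \<in> Obj C" "g \<in> Hom D (Fo A) (Fo B)" for A B g
    using someI_ex[of "\<lambda>f. f \<in> Hom C A B \<and> Fm A B f = g"] full[OF that] unfolding lift_def by blast+
  define conj where "conj Z W g = Comp D (Fo (Go Z)) W (Fo (Go W)) (e' W) (Comp D (Fo (Go Z)) Z W g (e Z))"
    for Z W g
  define Gm where "Gm Z W g = lift (Go Z) (Go W) (conj Z W g)" for Z W g
  have conj: "conj Z W g \<in> Hom D (Fo (Go Z)) (Fo (Go W))"
    if "Z \<in> Obj D" "W \<in> Obj D" "g \<in> Hom D Z W" for Z W g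
    unfolding conj_def by (intro cD GoD e that)
  have e_conj: "Comp D (Fo (Go Z)) (Fo (Go W)) W (e W) (conj Z W g) = Comp D (Fo (Go Z)) Z W g (e Z)"
    if "Z \<in> Obj D" "W \<in> Obj D" "g \<in> Hom D Z W" for Z W g
  proof -
    have k: "Comp D (Fo (Go Z)) Z W g (e Z) \<in> Hom D (Fo (Go Z)) W" by (intro cD GoD e that)
    have "Comp D (Fo (Go Z)) (Fo (Go W)) W (e W) (conj Z W g)
        = Comp D (Fo (Go Z)) W W (Comp D W (Fo (Go W)) W (e W) (e' W)) (Comp D (Fo (Go Z)) Z W g (e Z))"
      unfolding conj_def by (rule assocD[symmetric]; intro k GoD e that)
    also have "\<dots> = Comp D (Fo (Go Z)) Z W g (e Z)"
      unfolding e(5)[OF that(2)] by (rule unitD; intro k GoD that)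
    finally show ?thesis .
  qed
  \<comment> \<open>The conjugate is the only morphism making the square with \<open>e Z\<close> and
    \<open>e W\<close> commute, since \<open>e W\<close> is invertible. Functoriality of the inverse
    thus amounts to pasting squares.\<close>
  have conj_unique: "u = conj Z W g"
    if ZW: "Z \<in> Obj D" "W \<in> Obj D" and g: "g \<in> Hom D Z W" and u: "u \<in> Hom D (Fo (Go Z)) (Fo (Go W))"
      and eq: "Comp D (Fo (Go Z)) (Fo (Go W)) W (e W) u = Comp D (Fo (Go Z)) Z W g (e Z)" for Z W g u
  proof -
    have "u = Comp D (Fo (Go Z)) (Fo (Go W)) (Fo (Go W))
        (Comp D (Fo (Go W)) W (Fo (Go W)) (e' W) (e W)) u"
      unfolding e(4)[OF ZW(2)] by (rule unitD[symmetric]; intro GoD ZW u)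
    also have "\<dots> = conj Z W g"
      unfolding conj_def eq[symmetric] by (rule assocD; intro GoD ZW u e)
    finally show ?thesis .
  qed
  have Gm: "Gm Z W g \<in> Hom C (Go Z) (Go W)" "Fm (Go Z) (Go W) (Gm Z W g) = conj Z W g"
    if "Z \<in> Obj D" "W \<in> Obj D" "g \<in> Hom D Z W" for Z W g
    unfolding Gm_def by (rule lift; intro e conj that)+
  have G: "is_functor D C Go Gm"
    unfolding is_functor_def
  proof (intro conjI C D ballI)
    show "Go Z \<in> Obj C" if "Z \<in> Obj D" for Z using e(1) that .
    show "Gm Z W g \<in> Hom C (Go Z) (Go W)" if "Z \<in> Obj D" "W \<in> Obj D" "g \<in> Hom D Z W" for Z W g
      using Gm(1) that .
    show "Gm Z Z (Ident D Z) = Ident C (Go Z)" if Z: "Z \<in> Obj D" for Z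
    proof (rule faithful)
      have "Ident D (Fo (Go Z)) = conj Z Z (Ident D Z)"
      proof (rule conj_unique)
        show "Comp D (Fo (Go Z)) (Fo (Go Z)) Z (e Z) (Ident D (Fo (Go Z))) =
            Comp D (Fo (Go Z)) Z Z (Ident D Z) (e Z)"
          using unitD[OF GoD[OF Z] Z e(2)[OF Z]] by simp
      qed (intro Z idD GoD)+
      then show "Fm (Go Z) (Go Z) (Gm Z Z (Ident D Z)) = Fm (Go Z) (Go Z) (Ident C (Go Z))"
        using Gm(2)[OF Z Z idD[OF Z]] Fid[OF e(1)[OF Z]] by simp
    qed (intro Z e Gm idC idD)+
    show "Gm Z V (Comp D Z W V h g) = Comp C (Go Z) (Go W) (Go V) (Gm W V h) (Gm Z W g)"
      if Z: "Z \<in> Obj D" and W: "W \<in> Obj D" and V: "V \<in> Obj D"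
        and g: "g \<in> Hom D Z W" and h: "h \<in> Hom D W V" for Z W V g h
    proof (rule faithful)
      let ?F = "\<lambda>Z. Fo (Go Z)"
      note o = GoD[OF Z] GoD[OF W] GoD[OF V] Z W V
      note m = g h e(2)[OF Z] e(2)[OF W] e(2)[OF V] conj[OF Z W g] conj[OF W V h]
      have "Comp D (?F Z) (?F W) (?F V) (conj W V h) (conj Z W g) = conj Z V (Comp D Z W V h g)"
      proof (rule conj_unique)
        have "Comp D (?F Z) (?F V) V (e V) (Comp D (?F Z) (?F W) (?F V) (conj W V h) (conj Z W g))
            = Comp D (?F Z) (?F W) V (Comp D (?F W) (?F V) V (e V) (conj W V h)) (conj Z W g)"
          by (rule assocD[symmetric]; intro o m)
        also have "\<dots> = Comp D (?F Z) (?F W) V (Comp D (?F W) W V h (e W)) (conj Z W g)"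
          by (simp only: e_conj[OF W V h])
        also have "\<dots> = Comp D (?F Z) W V h (Comp D (?F Z) (?F W) W (e W) (conj Z W g))"
          by (rule assocD; intro o m)
        also have "\<dots> = Comp D (?F Z) W V h (Comp D (?F Z) Z W g (e Z))"
          by (simp only: e_conj[OF Z W g])
        also have "\<dots> = Comp D (?F Z) Z V (Comp D Z W V h g) (e Z)"
          by (rule assocD[symmetric]; intro o m)
        finally show "Comp D (?F Z) (?F V) V (e V) (Comp D (?F Z) (?F W) (?F V) (conj W V h) (conj Z W g))
            = Comp D (?F Z) Z V (Comp D Z W V h g) (e Z)" .
      qed (rule o | rule cD; intro o m)+
      then show "Fm (Go Z) (Go V) (Gm Z V (Comp D Z W V h g)) =
          Fm (Go Z) (Go V) (Comp C (Go Z) (Go W) (Go V) (Gm W V h) (Gm Z W g))"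
        using Gm(2)[OF Z V cD[OF Z W V g h]] Gm[OF Z W g] Gm[OF W V h]
          Fcomp[OF e(1)[OF Z] e(1)[OF W] e(1)[OF V]] by simp
    qed (rule e(1) Z W V Gm(1) cC cD; intro e(1) Z W V Gm(1) g h cD)+
  qed
  have nat1: "naturally_isomorphic D D (\<lambda>Z. Fo (Go Z)) (\<lambda>Z W g. Fm (Go Z) (Go W) (Gm Z W g))
      (\<lambda>Z. Z) (\<lambda>Z W g. g)"
    unfolding naturally_isomorphic_def
  proof (intro exI[of _ e] conjI ballI)
    show "is_iso D (Fo (Go Z)) Z (e Z)" if "Z \<in> Obj D" for Z
      using e(2-5)[OF that] unfolding is_iso_def by blast
    show "Comp D (Fo (Go Z)) (Fo (Go W)) W (e W) (Fm (Go Z) (Go W) (Gm Z W g)) =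
        Comp D (Fo (Go Z)) Z W g (e Z)" if "Z \<in> Obj D" "W \<in> Obj D" "g \<in> Hom D Z W" for Z W g
      using Gm(2)[OF that] e_conj[OF that] by simp
  qed
  \<comment> \<open>The isomorphism back to the identity on \<open>C\<close> is a lift of the one in
    \<open>D\<close> at \<open>Fo A\<close>, so its naturality is the image of the square
    \<open>e_conj\<close>.\<close>
  define \<eta> where "\<eta> A = lift (Go (Fo A)) A (e (Fo A))" for A
  define \<eta>' where "\<eta>' A = lift A (Go (Fo A)) (e' (Fo A))" for A
  have \<eta>: "\<eta> A \<in> Hom C (Go (Fo A)) A" "Fm (Go (Fo A)) A (\<eta> A) = e (Fo A)"
    "\<eta>' A \<in> Hom C A (Go (Fo A))" "Fm A (Go (Fo A)) (\<eta>' A) = e' (Fo A)" if "A \<in> Obj C" for A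
    unfolding \<eta>_def \<eta>'_def by (rule lift; intro that e Fo)+
  have nat2: "naturally_isomorphic C C (\<lambda>A. Go (Fo A)) (\<lambda>A B f. Gm (Fo A) (Fo B) (Fm A B f))
      (\<lambda>A. A) (\<lambda>A B f. f)"
    unfolding naturally_isomorphic_def
  proof (intro exI[of _ \<eta>] conjI ballI)
    fix A assume A: "A \<in> Obj C"
    note GA = e(1)[OF Fo[OF A]]
    have "Comp C (Go (Fo A)) A (Go (Fo A)) (\<eta>' A) (\<eta> A) = Ident C (Go (Fo A))"
    proof (rule faithful)
      show "Fm (Go (Fo A)) (Go (Fo A)) (Comp C (Go (Fo A)) A (Go (Fo A)) (\<eta>' A) (\<eta> A))
          = Fm (Go (Fo A)) (Go (Fo A)) (Ident C (Go (Fo A)))"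
        unfolding Fcomp[OF GA A GA \<eta>(1)[OF A] \<eta>(3)[OF A]] \<eta>(2,4)[OF A] Fid[OF GA]
        by (rule e(4)[OF Fo[OF A]])
    qed (rule GA cC[OF GA A GA \<eta>(1)[OF A] \<eta>(3)[OF A]] idC[OF GA])+
    moreover have "Comp C A (Go (Fo A)) A (\<eta> A) (\<eta>' A) = Ident C A"
    proof (rule faithful)
      show "Fm A A (Comp C A (Go (Fo A)) A (\<eta> A) (\<eta>' A)) = Fm A A (Ident C A)"
        unfolding Fcomp[OF A GA A \<eta>(3)[OF A] \<eta>(1)[OF A]] \<eta>(2,4)[OF A] Fid[OF A]
        by (rule e(5)[OF Fo[OF A]])
    qed (rule A cC[OF A GA A \<eta>(3)[OF A] \<eta>(1)[OF A]] idC[OF A])+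
    ultimately show "is_iso C (Go (Fo A)) A (\<eta> A)"
      unfolding is_iso_def using \<eta>[OF A] by blast
    fix B f assume B: "B \<in> Obj C" and f: "f \<in> Hom C A B"
    note GB = e(1)[OF Fo[OF B]]
    note Ff = Fm[OF A B f] note GFf = Gm[OF Fo[OF A] Fo[OF B] Ff]
    show "Comp C (Go (Fo A)) (Go (Fo B)) B (\<eta> B) (Gm (Fo A) (Fo B) (Fm A B f)) =
        Comp C (Go (Fo A)) A B f (\<eta> A)"
    proof (rule faithful)
      show "Fm (Go (Fo A)) B (Comp C (Go (Fo A)) (Go (Fo B)) B (\<eta> B) (Gm (Fo A) (Fo B) (Fm A B f))) =
          Fm (Go (Fo A)) B (Comp C (Go (Fo A)) A B f (\<eta> A))"
        unfolding Fcomp[OF GA GB B GFf(1) \<eta>(1)[OF B]] Fcomp[OF GA A B \<eta>(1)[OF A] f] GFf(2)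
          \<eta>(2)[OF A] \<eta>(2)[OF B]
        by (rule e_conj[OF Fo[OF A] Fo[OF B] Ff])
    qed (rule GA B cC[OF GA GB B GFf(1) \<eta>(1)[OF B]] cC[OF GA A B \<eta>(1)[OF A] f])+
  qed
  show ?thesis
    unfolding is_equivalence_of_categories_def using F G nat1 nat2 by blast
qed

section \<open>Coarse equivalences and boundary homeomorphisms\<close>

lemma coarse_map_compose:
  assumes "coarse_map S \<E> T \<F> f" "coarse_map T \<F> U \<G> g"
  shows "coarse_map S \<E> U \<G> (g \<circ> f)"
  unfolding coarse_map_def
proof (intro conjI allI impI ballI)
  have f: "f \<in> S \<rightarrow> T" and g: "g \<in> T \<rightarrow> U" using assms by (auto simp: coarse_map_def)
  then show "g \<circ> f \<in> S \<rightarrow> U" by auto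
  fix B assume "B \<subseteq> U" "coarsely_bounded \<G> B"
  then have "coarsely_bounded \<F> {y \<in> T. g y \<in> B}" using assms(2) by (simp add: coarse_map_def)
  then have "coarsely_bounded \<E> {x \<in> S. f x \<in> {y \<in> T. g y \<in> B}}"
    using assms(1) unfolding coarse_map_def by (elim conjE allE[of _ "{y \<in> T. g y \<in> B}"]) auto
  moreover have "{x \<in> S. f x \<in> {y \<in> T. g y \<in> B}} = {x \<in> S. (g \<circ> f) x \<in> B}" using f by auto
  ultimately show "coarsely_bounded \<E> {x \<in> S. (g \<circ> f) x \<in> B}" by simp
next
  fix E assume "E \<in> \<E>"
  then have "map_prod g g ` (map_prod f f ` E) \<in> \<G>" using assms by (simp add: coarse_map_def)
  then show "map_prod (g \<circ> f) (g \<circ> f) ` E \<in> \<G>" by (simp add: image_comp map_prod.comp)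
qed

text \<open>Morphisms are represented by extensional functions, so \<open>compose\<close> and
  \<open>restrict id\<close> agree with plain composition and identity only on the space.\<close>

lemma coarse_map_cong:
  assumes "\<E> \<subseteq> Pow (S \<times> S)" and eq: "\<And>x. x \<in> S \<Longrightarrow> f x = g x"
    and f: "coarse_map S \<E> T \<F> f"
  shows "coarse_map S \<E> T \<F> g"
proof -
  have "{x \<in> S. f x \<in> B} = {x \<in> S. g x \<in> B}" for B using eq by auto
  moreover have "map_prod f f ` E = map_prod g g ` E" if "E \<in> \<E>" for E
  proof -
    have "E \<subseteq> S \<times> S" using that assms(1) by blast
    then show ?thesis using eq by (intro image_cong) auto
  qed
  ultimately show ?thesis using f eq unfolding coarse_map_def Pi_iff by simp
qed

context compactified_space
begin

lemma controlled_subset: "controlled X i \<subseteq> Pow (topspace X \<times> topspace X)"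
  using controlled_iff by auto

lemma coarse_id: "coarse_map (topspace X) (controlled X i) (topspace X) (controlled X i) id"
proof -
  have "{x \<in> topspace X. x \<in> B} = B" if "B \<subseteq> topspace X" for B using that by auto
  then show ?thesis by (simp add: coarse_map_def map_prod.id)
qed

end

text \<open>Limits compose, so two coarse maps are inverse up to closeness exactly when their
  boundary maps are inverse. The hypothesis excludes an empty space paired with a nonempty compact
  one: both boundaries are empty, but no map leads into the empty space.\<close>

lemma (in compactified_pair) coarsely_equivalent_iff:
  assumes ne: "topspace X = {} \<longleftrightarrow> topspace Y = {}"
  shows "coarsely_equivalent (topspace X) (controlled X i) (topspace Y) (controlled Y j) \<longleftrightarrow>
    top_of_set (boundary X i) homeomorphic_space top_of_set (boundary Y j)"
proof -
  interpret YX: compactified_pair Y j X i by unfold_locales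
  interpret XX: compactified_pair X i X i by unfold_locales
  interpret YY: compactified_pair Y j Y j by unfold_locales
  have lim_gf: "((\<lambda>x. i ((g \<circ> f) x)) \<longlongrightarrow> k (h p)) (ends X i p)"
    if "f \<in> topspace X \<rightarrow> topspace Y" "((\<lambda>x. j (f x)) \<longlongrightarrow> h p) (ends X i p)"
      "((\<lambda>y. i (g y)) \<longlongrightarrow> k (h p)) (ends Y j (h p))" for f g h k p
    using filterlim_compose[OF that(3) filterlim_ends_Y[OF that(1,2)]] by simp
  have lim_fg: "((\<lambda>y. j ((f \<circ> g) y)) \<longlongrightarrow> h (k q)) (ends Y j q)"
    if "g \<in> topspace Y \<rightarrow> topspace X" "((\<lambda>y. i (g y)) \<longlongrightarrow> k q) (ends Y j q)"
      "((\<lambda>x. j (f x)) \<longlongrightarrow> h (k q)) (ends X i (k q))" for f g h k q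
    using filterlim_compose[OF that(3) YX.filterlim_ends_Y[OF that(1,2)]] by simp
  have lim_id: "((\<lambda>x. i (id x)) \<longlongrightarrow> p) (ends X i p)" "((\<lambda>y. j (id y)) \<longlongrightarrow> q) (ends Y j q)" for p q
    using tendsto_ends by simp_all
  show ?thesis
  proof
    assume "coarsely_equivalent (topspace X) (controlled X i) (topspace Y) (controlled Y j)"
    then obtain f g where f: "coarse f" and g: "YX.coarse g"
      and gf: "close_maps (topspace X) (controlled X i) (g \<circ> f) id"
      and fg: "close_maps (topspace Y) (controlled Y j) (f \<circ> g) id"
      unfolding coarsely_equivalent_def by blast
    have fX: "f \<in> topspace X \<rightarrow> topspace Y" "g \<in> topspace Y \<rightarrow> topspace X"
      using f g by (auto simp: coarse_map_def)
    have "\<forall>p\<in>boundary X i. \<exists>q. q \<in> boundary Y j \<and> ((\<lambda>x. j (f x)) \<longlongrightarrow> q) (ends X i p)"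
      using coarse_boundary_value[OF f] by metis
    then obtain h where h: "\<And>p. p \<in> boundary X i \<Longrightarrow> h p \<in> boundary Y j"
      "\<And>p. p \<in> boundary X i \<Longrightarrow> ((\<lambda>x. j (f x)) \<longlongrightarrow> h p) (ends X i p)" by metis
    have "\<forall>q\<in>boundary Y j. \<exists>p. p \<in> boundary X i \<and> ((\<lambda>y. i (g y)) \<longlongrightarrow> p) (ends Y j q)"
      using YX.coarse_boundary_value[OF g] by metis
    then obtain k where k: "\<And>q. q \<in> boundary Y j \<Longrightarrow> k q \<in> boundary X i"
      "\<And>q. q \<in> boundary Y j \<Longrightarrow> ((\<lambda>y. i (g y)) \<longlongrightarrow> k q) (ends Y j q)" by metis
    have "\<forall>p\<in>boundary X i. (k \<circ> h) p = id p"
      using XX.close_iff[OF coarse_map_compose[OF f g] X.coarse_id, of "k \<circ> h" id] gf lim_gf fX h k lim_id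
      by simp
    moreover have "\<forall>q\<in>boundary Y j. (h \<circ> k) q = id q"
      using YY.close_iff[OF coarse_map_compose[OF g f] Y.coarse_id, of "h \<circ> k" id] fg lim_fg fX h k lim_id
      by simp
    moreover have "continuous_on (boundary X i) h" "continuous_on (boundary Y j) k"
      using boundary_values_continuous[OF X.boundary_subset h(2)]
        boundary_values_continuous[OF Y.boundary_subset k(2)] by blast+
    ultimately have "homeomorphic_maps (top_of_set (boundary X i)) (top_of_set (boundary Y j)) h k"
      using h(1) k(1) by (auto simp: homeomorphic_maps_def continuous_map_in_subtopology)
    then show "top_of_set (boundary X i) homeomorphic_space top_of_set (boundary Y j)"
      unfolding homeomorphic_space_def by blast
  next
    assume "top_of_set (boundary X i) homeomorphic_space top_of_set (boundary Y j)"
    then obtain h k where hk: "homeomorphic_maps (top_of_set (boundary X i)) (top_of_set (boundary Y j)) h k"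
      unfolding homeomorphic_space_def by blast
    then have h: "continuous_on (boundary X i) h" "h ` boundary X i \<subseteq> boundary Y j"
      and k: "continuous_on (boundary Y j) k" "k ` boundary Y j \<subseteq> boundary X i"
      and inv: "\<And>p. p \<in> boundary X i \<Longrightarrow> k (h p) = p" "\<And>q. q \<in> boundary Y j \<Longrightarrow> h (k q) = q"
      by (auto simp: homeomorphic_maps_def continuous_map_in_subtopology image_subset_iff_funcset)
    obtain f where f: "coarse f"
      "\<And>p. p \<in> boundary X i \<Longrightarrow> ((\<lambda>x. j (f x)) \<longlongrightarrow> h p) (ends X i p)"
      using boundary_map_realized[OF h] ne by metis
    obtain g where g: "YX.coarse g"
      "\<And>q. q \<in> boundary Y j \<Longrightarrow> ((\<lambda>y. i (g y)) \<longlongrightarrow> k q) (ends Y j q)"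
      using YX.boundary_map_realized[OF k] ne by metis
    have fX: "f \<in> topspace X \<rightarrow> topspace Y" "g \<in> topspace Y \<rightarrow> topspace X"
      using f(1) g(1) by (auto simp: coarse_map_def)
    have "((\<lambda>x. i ((g \<circ> f) x)) \<longlongrightarrow> (k \<circ> h) p) (ends X i p)" if p: "p \<in> boundary X i" for p
      using lim_gf[of f h p g k] fX(1) f(2)[OF p] g(2)[of "h p"] h(2) p by auto
    note gf = this
    have "((\<lambda>y. j ((f \<circ> g) y)) \<longlongrightarrow> (h \<circ> k) q) (ends Y j q)" if q: "q \<in> boundary Y j" for q
      using lim_fg[of g k q f h] fX(2) g(2)[OF q] f(2)[of "k q"] k(2) q by auto
    note fg = this
    have "close_maps (topspace X) (controlled X i) (g \<circ> f) id"
      using XX.close_iff[OF coarse_map_compose[OF f(1) g(1)] X.coarse_id, of "k \<circ> h" id]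
        gf inv(1) lim_id(1) by simp
    moreover have "close_maps (topspace Y) (controlled Y j) (f \<circ> g) id"
      using YY.close_iff[OF coarse_map_compose[OF g(1) f(1)] Y.coarse_id, of "h \<circ> k" id]
        fg inv(2) lim_id(2) by simp
    ultimately show "coarsely_equivalent (topspace X) (controlled X i) (topspace Y) (controlled Y j)"
      unfolding coarsely_equivalent_def using f(1) g(1) by blast
  qed
qed

text \<open>Moves a compactification on any type into \<open>nat \<Rightarrow> real\<close>, whose
  metric induces the product topology. The image of \<open>K\<close> is compact, hence closed, so by
  density it is the closure of the image of \<open>X\<close>.\<close>

lemma compactification_realized:
  fixes X :: "'a topology" and K :: "'k topology"
  assumes c: "compactification X K c" and K: "metrizable_space K" and X: "locally_compact_space X"
  obtains i :: "'a \<Rightarrow> (nat \<Rightarrow> real)" where "compactified_space X i" "controlled X i = cc_structure X K c"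
    "subtopology K (remainder X K c) homeomorphic_space top_of_set (boundary X i)"
proof -
  have cK: "compact_space K" using c by (simp add: compactification_def)
  then obtain j where "embedding_map K (powertop_real (UNIV :: nat set)) j"
    using compact_metrizable_embeds K by blast
  then have j: "embedding_map K euclidean j" by (simp add: euclidean_product_topology)
  let ?L = "top_of_set (j ` topspace K)" and ?i = "j \<circ> c"
  have hom: "homeomorphic_map K ?L j" using j by (simp add: embedding_map_def)
  note L = compactification_transport[OF c hom]
  have "compactin ?L (j ` topspace K)"
    by (rule image_compactin[OF _ homeomorphic_imp_continuous_map[OF hom]])
      (use cK in \<open>simp add: compact_space_def\<close>)
  then have comp: "compact (j ` topspace K)" by (simp add: compactin_subtopology)
  have sub: "?i ` topspace X \<subseteq> j ` topspace K"
    using L(1) closure_of_subset_topspace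
    by (metis compactification_def embedding_map_in_subtopology)
  have "closure (?i ` topspace X) \<subseteq> j ` topspace K"
    using sub comp by (intro closure_minimal compact_imp_closed)
  moreover have "?L closure_of (?i ` topspace X) = j ` topspace K"
    using L(1) by (simp add: compactification_def)
  ultimately have cl: "closure (?i ` topspace X) = j ` topspace K"
    using sub by (simp add: closure_of_subtopology Int_absorb1)
  have "compactified_space X ?i"
    using L(1) X comp unfolding compactified_space_def cl
    by (simp add: compactification_def embedding_map_in_subtopology)
  moreover have "controlled X ?i = cc_structure X K c" using L(2) by (simp only: cl)
  moreover have "homeomorphic_map (subtopology K (remainder X K c))
      (subtopology ?L (boundary X ?i)) j"
  proof (rule homeomorphic_map_subtopologies[OF hom])
    have "inj_on j (topspace K)" using hom homeomorphic_imp_injective_map by blast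
    moreover have "c ` topspace X \<subseteq> topspace K"
      using c closure_of_subset_topspace
      by (metis compactification_def embedding_map_in_subtopology subtopology_topspace)
    ultimately have "j ` remainder X K c = j ` topspace K - j ` c ` topspace X"
      by (simp add: remainder_def inj_on_image_set_diff[of j "topspace K"] Diff_subset)
    moreover have "topspace K \<inter> remainder X K c = remainder X K c" by (auto simp: remainder_def)
    moreover have "boundary X ?i = j ` topspace K - ?i ` topspace X" by (simp only: boundary_def cl)
    ultimately show "j ` (topspace K \<inter> remainder X K c) = topspace ?L \<inter> boundary X ?i"
      by (simp add: image_comp) blast
  qed
  moreover have "subtopology ?L (boundary X ?i) = top_of_set (boundary X ?i)"
    using cl by (simp add: subtopology_subtopology boundary_def Int_absorb1 Diff_subset)
  ultimately show ?thesis
    using that[of ?i] homeomorphic_map_imp_homeomorphic_space by metis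
qed


section \<open>The corona functor\<close>

text \<open>An object of \<open>CC\<close> does not record its compactification, so one embedding is
  fixed by choice.\<close>

definition realization :: "'a coarse_top \<Rightarrow> 'a \<Rightarrow> (nat \<Rightarrow> real)" where
  "realization A = (SOME i. compactified_space (fst A) i \<and> controlled (fst A) i = snd A)"

definition corona_set :: "'a coarse_top \<Rightarrow> (nat \<Rightarrow> real) set" where
  "corona_set A = boundary (fst A) (realization A)"

definition corona_coord :: "'a coarse_top \<Rightarrow> (nat \<Rightarrow> real) \<Rightarrow> (('a \<Rightarrow> real) \<Rightarrow> real)" where
  "corona_coord A = corona_point (fst A) (realization A)"

definition boundary_map ::
  "'a coarse_top \<Rightarrow> 'a coarse_top \<Rightarrow> ('a \<Rightarrow> 'a) \<Rightarrow> (nat \<Rightarrow> real) \<Rightarrow> (nat \<Rightarrow> real)" where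
  "boundary_map A B f =
     (\<lambda>p\<in>corona_set A. Lim (ends (fst A) (realization A) p) (\<lambda>x. realization B (f x)))"

lemma CC_realization:
  assumes "A \<in> Obj (CC :: ('a coarse_top, _) precategory)"
  shows "compactified_space (fst A) (realization A)"
    and "snd A = controlled (fst A) (realization A)" and "topspace (fst A) \<noteq> {}"
proof -
  obtain X \<E> and K :: "(nat \<Rightarrow> real) topology" and c where A: "A = (X, \<E>)" "topspace X \<noteq> {}"
    "locally_compact_space X" "compactification X K c" "metrizable_space K" "\<E> = cc_structure X K c"
    using assms by (auto simp: CC_def)
  obtain i :: "'a \<Rightarrow> nat \<Rightarrow> real" where "compactified_space X i" "controlled X i = cc_structure X K c"
    by (rule compactification_realized[OF A(4,5,3)])
  then have "\<exists>i :: 'a \<Rightarrow> nat \<Rightarrow> real. compactified_space (fst A) i \<and> controlled (fst A) i = snd A"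
    using A by auto
  from someI_ex[OF this] show "compactified_space (fst A) (realization A)"
    "snd A = controlled (fst A) (realization A)" by (simp_all add: realization_def)
  show "topspace (fst A) \<noteq> {}" using A by simp
qed

locale CC_objects = compactified_pair "fst A" "realization A" "fst B" "realization B"
  for A B :: "'a coarse_top" +
  assumes A: "A \<in> Obj (CC :: ('a coarse_top, ('a \<Rightarrow> 'a) set) precategory)"
    and B: "B \<in> Obj (CC :: ('a coarse_top, ('a \<Rightarrow> 'a) set) precategory)"

lemma CC_objects:
  assumes "A \<in> Obj (CC :: ('a coarse_top, ('a \<Rightarrow> 'a) set) precategory)"
    and "B \<in> Obj (CC :: ('a coarse_top, ('a \<Rightarrow> 'a) set) precategory)"
  shows "CC_objects A B"
  using assms CC_realization(1)[OF assms(1)] CC_realization(1)[OF assms(2)]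
  by (simp add: CC_objects_def CC_objects_axioms_def compactified_pair_def)

section \<open>Morphisms of \<open>CC\<close> as boundary maps\<close>

context CC_objects
begin

lemma A_eq: "A = (fst A, controlled (fst A) (realization A))"
  and B_eq: "B = (fst B, controlled (fst B) (realization B))"
  using CC_realization(2)[OF A] CC_realization(2)[OF B] by (metis prod.collapse)+

lemma coarse_maps_iff: "f \<in> coarse_maps A B \<longleftrightarrow> f \<in> extensional (topspace (fst A)) \<and> coarse f"
  by (subst A_eq, subst B_eq) simp

lemma closeness_iff:
  "(f, g) \<in> closeness A B \<longleftrightarrow> f \<in> coarse_maps A B \<and> g \<in> coarse_maps A B \<and>
     close_maps (topspace (fst A)) (controlled (fst B) (realization B)) f g"
proof -
  have "closeness (X, \<E>) (Y, \<F>) = {(f, g). f \<in> coarse_maps (X, \<E>) (Y, \<F>) \<and>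
    g \<in> coarse_maps (X, \<E>) (Y, \<F>) \<and> close_maps (topspace X) \<F> f g}"
    for X Y :: "'a topology" and \<E> \<F> by simp
  from this[of "fst A" "snd A" "fst B" "snd B"] show ?thesis
    by (simp only: prod.collapse CC_realization(2)[OF B, symmetric]) blast
qed

lemma boundary_map:
  assumes "f \<in> coarse_maps A B" "p \<in> corona_set A"
  shows "boundary_map A B f p \<in> corona_set B"
    and "((\<lambda>x. realization B (f x)) \<longlongrightarrow> boundary_map A B f p) (ends (fst A) (realization A) p)"
proof -
  have p: "p \<in> boundary (fst A) (realization A)" using assms(2) by (simp add: corona_set_def)
  obtain q where q: "q \<in> boundary (fst B) (realization B)"
    "((\<lambda>x. realization B (f x)) \<longlongrightarrow> q) (ends (fst A) (realization A) p)"
    using coarse_boundary_value[OF _ p] assms(1) by (auto simp: coarse_maps_iff)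
  then have "boundary_map A B f p = q"
    using tendsto_Lim[OF X.ends_neq_bot[OF p]] assms(2) by (simp add: boundary_map_def)
  with q show "boundary_map A B f p \<in> corona_set B"
    "((\<lambda>x. realization B (f x)) \<longlongrightarrow> boundary_map A B f p) (ends (fst A) (realization A) p)"
    by (simp_all add: corona_set_def)
qed

lemma boundary_map_eqI:
  assumes "\<And>p. p \<in> corona_set A \<Longrightarrow>
    ((\<lambda>x. realization B (f x)) \<longlongrightarrow> h p) (ends (fst A) (realization A) p)"
  shows "boundary_map A B f = restrict h (corona_set A)"
  unfolding boundary_map_def using assms
  by (intro restrict_ext tendsto_Lim X.ends_neq_bot) (simp_all add: corona_set_def)

text \<open>On coarse maps, closeness is thus the kernel of \<open>boundary_map\<close>; this gives
  the equivalence relation, compatibility with composition and faithfulness.\<close>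

lemma closeness_iff_boundary_map:
  assumes "f \<in> coarse_maps A B" "g \<in> coarse_maps A B"
  shows "(f, g) \<in> closeness A B \<longleftrightarrow> boundary_map A B f = boundary_map A B g"
proof -
  have "(f, g) \<in> closeness A B \<longleftrightarrow> (\<forall>p\<in>corona_set A. boundary_map A B f p = boundary_map A B g p)"
    unfolding closeness_iff using assms close_iff[of f g "boundary_map A B f" "boundary_map A B g"]
      boundary_map[OF assms(1)] boundary_map[OF assms(2)]
    by (simp add: coarse_maps_iff corona_set_def)
  also have "\<dots> \<longleftrightarrow> boundary_map A B f = boundary_map A B g"
  proof -
    have "boundary_map A B f \<in> extensional (corona_set A)" for f by (simp add: boundary_map_def)
    then show ?thesis by (metis extensionalityI)
  qed
  finally show ?thesis .
qed

lemma equiv_closeness: "equiv (coarse_maps A B) (closeness A B)"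
  by (rule equivI)
    (auto intro!: refl_onI symI transI simp: closeness_iff_boundary_map, auto simp: closeness_iff,
      (metis closeness_iff closeness_iff_boundary_map)+)

lemma closeness_class_eq:
  assumes "f \<in> coarse_maps A B" "g \<in> coarse_maps A B"
  shows "closeness A B `` {f} = closeness A B `` {g} \<longleftrightarrow> boundary_map A B f = boundary_map A B g"
  using eq_equiv_class_iff[OF equiv_closeness assms] closeness_iff_boundary_map[OF assms] by simp

lemma mem_closeness_class:
  assumes "f \<in> coarse_maps A B"
  shows "g \<in> closeness A B `` {f} \<longleftrightarrow> g \<in> coarse_maps A B \<and> boundary_map A B g = boundary_map A B f"
  using assms closeness_iff_boundary_map closeness_iff by (metis Image_singleton_iff)

lemma boundary_map_continuous:
  assumes "f \<in> coarse_maps A B"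
  shows "continuous_on (corona_set A) (boundary_map A B f)"
  using boundary_values_continuous[OF X.boundary_subset] boundary_map(2)[OF assms]
  unfolding corona_set_def by blast

text \<open>Objects of \<open>CC\<close> are nonempty, which provides the target point needed when
  the boundary of the source is empty.\<close>

lemma boundary_map_full:
  assumes "continuous_on (corona_set A) h" "h ` corona_set A \<subseteq> corona_set B"
  obtains f where "f \<in> coarse_maps A B" "boundary_map A B f = restrict h (corona_set A)"
proof -
  obtain f where "f \<in> extensional (topspace (fst A))" "coarse f"
    "\<And>p. p \<in> corona_set A \<Longrightarrow>
      ((\<lambda>x. realization B (f x)) \<longlongrightarrow> h p) (ends (fst A) (realization A) p)"
    using boundary_map_realized[of h] assms CC_realization(3)[OF B] unfolding corona_set_def by metis
  then show ?thesis using that[of f] boundary_map_eqI[of f h] by (simp add: coarse_maps_iff)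
qed

lemma topspace_higson_corona: "topspace (higson_corona A) = corona_coord A ` corona_set A"
  unfolding corona_coord_def corona_set_def by (subst A_eq) (rule X.topspace_corona)

lemma homeomorphic_higson_corona:
  "homeomorphic_map (top_of_set (corona_set A)) (higson_corona A) (corona_coord A)"
  unfolding corona_coord_def corona_set_def
  by (subst (3) A_eq) (rule X.homeomorphic_corona)

lemma inj_corona_coord: "inj_on (corona_coord A) (corona_set A)"
  using homeomorphic_imp_injective_map[OF homeomorphic_higson_corona] by simp

lemma higson_corona_map:
  assumes "f \<in> coarse_maps A B"
  shows "higson_corona_map A B f = (\<lambda>t\<in>topspace (higson_corona A).
      corona_coord B (boundary_map A B f (inv_into (corona_set A) (corona_coord A) t)))"
proof -
  have f: "coarse f" using assms by (simp add: coarse_maps_iff)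
  have "higson_corona_map A B f = higson_corona_map (fst A, controlled (fst A) (realization A))
      (fst B, controlled (fst B) (realization B)) f"
    using A_eq B_eq by simp
  then show ?thesis
    using higson_corona_map_eq[OF f, of "boundary_map A B f"] boundary_map[OF assms]
    by (simp add: corona_set_def corona_coord_def topspace_higson_corona)
qed

lemma higson_corona_map_coord:
  assumes "f \<in> coarse_maps A B" "p \<in> corona_set A"
  shows "higson_corona_map A B f (corona_coord A p) = corona_coord B (boundary_map A B f p)"
  using assms inj_corona_coord by (simp add: higson_corona_map topspace_higson_corona)

lemma higson_corona_map_continuous:
  assumes "f \<in> coarse_maps A B"
  shows "continuous_map (higson_corona A) (higson_corona B) (higson_corona_map A B f)"
proof -
  have "continuous_map (higson_corona (fst A, controlled (fst A) (realization A)))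
     (higson_corona (fst B, controlled (fst B) (realization B))) (higson_corona_map A B f)"
    using corona_transfer_continuous[of "boundary_map A B f"] boundary_map_continuous[OF assms]
      boundary_map(1)[OF assms] higson_corona_map[OF assms]
    by (auto simp: corona_set_def corona_coord_def topspace_higson_corona)
  then show ?thesis using A_eq B_eq by simp
qed

lemma higson_corona_map_inject:
  assumes f: "f \<in> coarse_maps A B" and g: "g \<in> coarse_maps A B"
  shows "higson_corona_map A B f = higson_corona_map A B g \<longleftrightarrow> boundary_map A B f = boundary_map A B g"
proof
  interpret BA: CC_objects B A using CC_objects A B by blast
  assume eq: "higson_corona_map A B f = higson_corona_map A B g"
  show "boundary_map A B f = boundary_map A B g"
  proof (rule extensionalityI)
    fix p assume p: "p \<in> corona_set A"
    then have "corona_coord B (boundary_map A B f p) = corona_coord B (boundary_map A B g p)"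
      using higson_corona_map_coord[OF f p] higson_corona_map_coord[OF g p] eq by simp
    then show "boundary_map A B f p = boundary_map A B g p"
      using BA.inj_corona_coord boundary_map(1)[OF f p] boundary_map(1)[OF g p] by (simp add: inj_on_eq_iff)
  qed (simp_all add: boundary_map_def)
qed (simp add: higson_corona_map f g)

text \<open>All representatives have the same boundary map and hence the same corona map, so
  \<open>the_elem\<close> is applied to a singleton.\<close>

lemma corona_functor_map_class:
  assumes "f \<in> coarse_maps A B"
  shows "corona_functor_map A B (closeness A B `` {f}) = higson_corona_map A B f"
proof -
  have "f \<in> closeness A B `` {f}" using mem_closeness_class assms by blast
  then have "higson_corona_map A B ` (closeness A B `` {f}) = {higson_corona_map A B f}"
    using mem_closeness_class[OF assms] higson_corona_map_inject assms by blast
  then show ?thesis by (simp add: corona_functor_map_def)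
qed

end

section \<open>The two categories\<close>

lemma CC_simps:
  "Hom CC A B = coarse_maps A B // closeness A B"
  "Ident CC A = closeness A A `` {restrict id (topspace (fst A))}"
  "Comp CC A B D \<Gamma> \<Phi> = (\<Union>f\<in>\<Phi>. \<Union>g\<in>\<Gamma>. closeness A D `` {compose (topspace (fst A)) g f})"
  by (simp_all add: CC_def)

lemma KM_simps:
  "Obj KM = {Z. compact_space Z \<and> metrizable_space Z}"
  "Hom KM Y Z = {f \<in> extensional (topspace Y). continuous_map Y Z f}"
  "Ident KM Z = restrict id (topspace Z)"
  "Comp KM W Y Z g f = compose (topspace W) g f"
  by (simp_all add: KM_def)

lemma coarse_maps_compose:
  assumes "A \<in> Obj CC" "B \<in> Obj CC" "D \<in> Obj CC"
    and f: "f \<in> coarse_maps A B" and g: "g \<in> coarse_maps B D"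
  shows "compose (topspace (fst A)) g f \<in> coarse_maps A D"
    and "boundary_map A D (compose (topspace (fst A)) g f) =
      compose (corona_set A) (boundary_map B D g) (boundary_map A B f)"
proof -
  interpret AB: CC_objects A B using CC_objects assms by blast
  interpret BD: CC_objects B D using CC_objects assms by blast
  interpret AD: CC_objects A D using CC_objects assms by blast
  have cf: "AB.coarse f" and cg: "BD.coarse g"
    using f g by (simp_all add: AB.coarse_maps_iff BD.coarse_maps_iff)
  have "AD.coarse (compose (topspace (fst A)) g f)"
    by (rule coarse_map_cong[OF AB.X.controlled_subset _ coarse_map_compose[OF cf cg]])
      (simp add: compose_def)
  then show "compose (topspace (fst A)) g f \<in> coarse_maps A D"
    by (simp add: AD.coarse_maps_iff)
  have fX: "f \<in> topspace (fst A) \<rightarrow> topspace (fst B)" using cf by (simp add: coarse_map_def)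
  have "((\<lambda>x. realization D (compose (topspace (fst A)) g f x)) \<longlongrightarrow>
      boundary_map B D g (boundary_map A B f p)) (ends (fst A) (realization A) p)"
    if p: "p \<in> corona_set A" for p
  proof -
    have "((\<lambda>x. realization D (g (f x))) \<longlongrightarrow>
      boundary_map B D g (boundary_map A B f p)) (ends (fst A) (realization A) p)"
      using filterlim_compose[OF BD.boundary_map(2)[OF g AB.boundary_map(1)[OF f p]]
          AB.filterlim_ends_Y[OF fX AB.boundary_map(2)[OF f p]]] .
    moreover have "eventually (\<lambda>x. realization D (compose (topspace (fst A)) g f x) = realization D (g (f x)))
        (ends (fst A) (realization A) p)"
      using eventually_ends_topspace by eventually_elim (simp add: compose_def)
    ultimately show ?thesis by (simp add: tendsto_cong)
  qed
  from AD.boundary_map_eqI[OF this] show "boundary_map A D (compose (topspace (fst A)) g f) =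
      compose (corona_set A) (boundary_map B D g) (boundary_map A B f)"
    by (simp only: compose_def[of "corona_set A"])
qed

lemma coarse_maps_id:
  assumes "A \<in> Obj CC"
  shows "restrict id (topspace (fst A)) \<in> coarse_maps A A"
    and "boundary_map A A (restrict id (topspace (fst A))) = restrict id (corona_set A)"
proof -
  interpret CC_objects A A using CC_objects assms by blast
  have "coarse (restrict id (topspace (fst A)))"
    by (rule coarse_map_cong[OF X.controlled_subset _ X.coarse_id]) simp
  then show "restrict id (topspace (fst A)) \<in> coarse_maps A A"
    by (simp add: coarse_maps_iff)
  have "((\<lambda>x. realization A (restrict id (topspace (fst A)) x)) \<longlongrightarrow> id p) (ends (fst A) (realization A) p)"
    for p
  proof -
    have "eventually (\<lambda>x. realization A (restrict id (topspace (fst A)) x) = realization A x)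
        (ends (fst A) (realization A) p)"
      using eventually_ends_topspace by eventually_elim simp
    then show ?thesis using tendsto_ends by (simp add: tendsto_cong)
  qed
  then show "boundary_map A A (restrict id (topspace (fst A))) = restrict id (corona_set A)"
    by (rule boundary_map_eqI)
qed

lemma CC_HomE:
  assumes "\<Phi> \<in> Hom CC A B"
  obtains f where "f \<in> coarse_maps A B" "\<Phi> = closeness A B `` {f}"
  using assms by (auto simp: CC_simps quotient_def)

lemma CC_HomI: "f \<in> coarse_maps A B \<Longrightarrow> closeness A B `` {f} \<in> Hom CC A B"
  by (auto simp: CC_simps quotient_def)

text \<open>The boundary map of a composite depends only on those of its factors, so all the classes
  in the union coincide.\<close>

lemma CC_Comp_class:
  assumes o: "A \<in> Obj CC" "B \<in> Obj CC" "D \<in> Obj CC"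
    and f: "f \<in> coarse_maps A B" and g: "g \<in> coarse_maps B D"
  shows "Comp CC A B D (closeness B D `` {g}) (closeness A B `` {f}) =
    closeness A D `` {compose (topspace (fst A)) g f}"
proof -
  interpret AB: CC_objects A B using CC_objects o by blast
  interpret BD: CC_objects B D using CC_objects o by blast
  interpret AD: CC_objects A D using CC_objects o by blast
  have "closeness A D `` {compose (topspace (fst A)) g' f'} = closeness A D `` {compose (topspace (fst A)) g f}"
    if "f' \<in> closeness A B `` {f}" "g' \<in> closeness B D `` {g}" for f' g'
  proof -
    have f': "f' \<in> coarse_maps A B" "boundary_map A B f' = boundary_map A B f"
      and g': "g' \<in> coarse_maps B D" "boundary_map B D g' = boundary_map B D g"
      using that AB.mem_closeness_class[OF f] BD.mem_closeness_class[OF g] by blast+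
    show ?thesis
      using AD.closeness_class_eq coarse_maps_compose[OF o f g] coarse_maps_compose[OF o f'(1) g'(1)] f'(2) g'(2)
      by metis
  qed
  moreover have "f \<in> closeness A B `` {f}" "g \<in> closeness B D `` {g}"
    using AB.mem_closeness_class[OF f] BD.mem_closeness_class[OF g] f g by blast+
  ultimately show ?thesis unfolding CC_simps by blast
qed

lemma is_category_CC: "is_category (CC :: ('a coarse_top, ('a \<Rightarrow> 'a) set) precategory)" (is "is_category ?C")
  unfolding is_category_def
proof (intro conjI ballI)
  show "Ident ?C A \<in> Hom ?C A A" if "A \<in> Obj ?C" for A
    using CC_HomI[OF coarse_maps_id(1)[OF that]] by (simp add: CC_simps(2))
  show "Comp ?C A B D g f \<in> Hom ?C A D"
    if "A \<in> Obj ?C" "B \<in> Obj ?C" "D \<in> Obj ?C" "f \<in> Hom ?C A B" "g \<in> Hom ?C B D" for A B D f g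
    using that(4,5) CC_Comp_class[OF that(1-3)] CC_HomI[OF coarse_maps_compose(1)[OF that(1-3)]]
    by (auto elim!: CC_HomE)
  fix A B \<Phi> assume A: "A \<in> Obj ?C" and B: "B \<in> Obj ?C" and "\<Phi> \<in> Hom ?C A B"
  then obtain f where f: "f \<in> coarse_maps A B" "\<Phi> = closeness A B `` {f}" by (elim CC_HomE)
  interpret CC_objects A B using CC_objects A B by blast
  have ff: "f \<in> extensional (topspace (fst A))" "f \<in> topspace (fst A) \<rightarrow> topspace (fst B)"
    using f(1) by (simp_all add: coarse_maps_iff coarse_map_def)
  have "compose (topspace (fst A)) f (restrict id (topspace (fst A))) = f"
    using ff by (intro extensionalityI[of _ "topspace (fst A)"]) (auto simp: compose_def)
  then show "Comp ?C A A B \<Phi> (Ident ?C A) = \<Phi>"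
    using CC_Comp_class[OF A A B coarse_maps_id(1)[OF A] f(1)] f(2) by (simp add: CC_simps(2))
  have "compose (topspace (fst A)) (restrict id (topspace (fst B))) f = f"
    using ff by (intro extensionalityI[of _ "topspace (fst A)"]) (auto simp: compose_def)
  then show "Comp ?C A B B (Ident ?C B) \<Phi> = \<Phi>"
    using CC_Comp_class[OF A B B f(1) coarse_maps_id(1)[OF B]] f(2) by (simp add: CC_simps(2))
  fix D E \<Gamma> \<Theta> assume D: "D \<in> Obj ?C" and E: "E \<in> Obj ?C" and "\<Gamma> \<in> Hom ?C B D" "\<Theta> \<in> Hom ?C D E"
  then obtain g h where g: "g \<in> coarse_maps B D" "\<Gamma> = closeness B D `` {g}"
    and h: "h \<in> coarse_maps D E" "\<Theta> = closeness D E `` {h}" by (elim CC_HomE)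
  have "compose (topspace (fst A)) h (compose (topspace (fst A)) g f) =
      compose (topspace (fst A)) (compose (topspace (fst B)) h g) f"
    by (rule compose_assoc[OF ff(2)])
  then show "Comp ?C A B E (Comp ?C B D E \<Theta> \<Gamma>) \<Phi> = Comp ?C A D E \<Theta> (Comp ?C A B D \<Gamma> \<Phi>)"
    using CC_Comp_class[OF A B D f(1) g(1)] CC_Comp_class[OF B D E g(1) h(1)]
      CC_Comp_class[OF A B E f(1) coarse_maps_compose(1)[OF B D E g(1) h(1)]]
      CC_Comp_class[OF A D E coarse_maps_compose(1)[OF A B D f(1) g(1)] h(1)]
    by (simp add: f(2) g(2) h(2))
qed

lemma is_category_KM: "is_category KM"
  unfolding is_category_def
proof (intro conjI ballI)
  show "Ident KM A \<in> Hom KM A A" for A :: "'b topology"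
    using continuous_map_eq[OF continuous_map_id, of A "restrict id (topspace A)"]
    by (simp add: KM_simps)
  show "Comp KM A B D g f \<in> Hom KM A D"
    if "f \<in> Hom KM A B" "g \<in> Hom KM B D" for A B D :: "'b topology" and f g
    using that continuous_map_eq[OF continuous_map_compose, of A B f D g "compose (topspace A) g f"]
    by (simp add: KM_simps compose_def)
  fix A B :: "'b topology" and f
  assume "f \<in> Hom KM A B"
  then have f: "f \<in> extensional (topspace A)" and fX: "f \<in> topspace A \<rightarrow> topspace B"
    by (simp_all add: KM_simps continuous_map_def)
  show "Comp KM A A B f (Ident KM A) = f" "Comp KM A B B (Ident KM B) f = f"
    using f fX by (auto intro!: extensionalityI[of _ "topspace A"] simp: compose_def KM_simps)
  show "Comp KM A B E (Comp KM B D E h g) f = Comp KM A D E h (Comp KM A B D g f)"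
    for D E :: "'b topology" and g h
    using compose_assoc[OF fX, of h g] by (simp add: KM_simps)
qed

section \<open>Compact metrizable spaces as remainders\<close>

lemma compact_metrizable_dense_sequence:
  fixes Z :: "'c topology"
  assumes "compact_space Z" "metrizable_space Z" "topspace Z \<noteq> {}"
  obtains s :: "nat \<Rightarrow> 'c" where "range s \<subseteq> topspace Z"
    "\<forall>U N. openin Z U \<longrightarrow> U \<noteq> {} \<longrightarrow> (\<exists>n\<ge>N. s n \<in> U)"
proof -
  obtain j where "embedding_map Z (powertop_real (UNIV :: nat set)) j"
    using compact_metrizable_embeds assms by blast
  then have hom: "homeomorphic_map Z (top_of_set (j ` topspace Z)) j"
    by (simp add: embedding_map_def euclidean_product_topology)
  obtain T where T: "countable T" "T \<subseteq> j ` topspace Z" "j ` topspace Z \<subseteq> closure T"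
    using separable by blast
  have "T \<noteq> {}" using T(3) assms(3) by auto
  define q where "q = from_nat_into T"
  have q: "range q = T" unfolding q_def using \<open>T \<noteq> {}\<close> T(1) by (rule range_from_nat_into)
  \<comment> \<open>Reading only the first component of the decoded pair repeats every point of the
    dense set infinitely often. A plain enumeration could hit an isolated point just once, and then
    some tail would not be dense.\<close>
  have "\<forall>n. \<exists>z\<in>topspace Z. q (fst (prod_decode n)) = j z"
    using q T(2) by blast
  then obtain s where s: "\<And>n. s n \<in> topspace Z" "\<And>n. q (fst (prod_decode n)) = j (s n)" by metis
  have "\<exists>n\<ge>N. s n \<in> U" if U: "openin Z U" "U \<noteq> {}" for U N
  proof -
    have "openin (top_of_set (j ` topspace Z)) (j ` U)"
      using U(1) homeomorphic_imp_open_map[OF hom] by (simp add: open_map_def)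
    then obtain W where W: "open W" "j ` U = j ` topspace Z \<inter> W" by (auto simp: openin_open)
    then have "W \<inter> closure T \<noteq> {}" using U(2) T(3) by blast
    then obtain t where "t \<in> T" "t \<in> W" using open_Int_closure_eq_empty[OF W(1), of T] by blast
    then obtain m where m: "q m \<in> W" using q by blast
    \<comment> \<open>The second component \<open>N\<close> pushes the index past \<open>N\<close>
      without changing the point visited.\<close>
    let ?n = "prod_encode (m, N)"
    have "j (s ?n) \<in> j ` U" using s(1)[of ?n] s(2)[of ?n] m W(2) by auto
    then have "s ?n \<in> U"
      using s(1)[of ?n] homeomorphic_imp_injective_map[OF hom] openin_subset[OF U(1)]
      by (auto simp: inj_on_def)
    moreover have "N \<le> ?n" by (rule le_prod_encode_2)
    ultimately show ?thesis by blast
  qed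
  with s(1) that[of s] show ?thesis by blast
qed

text \<open>Every nonempty compact metrizable \<open>Z\<close> is the remainder of the discrete space of the points
  \<open>(s n, 1 / (n + 1))\<close> in \<open>Z \<times> \<real>\<close>, where every tail of \<open>s\<close> is dense in \<open>Z\<close>.\<close>

lemma remainder_of_discrete_space:
  fixes Z :: "'c topology"
  assumes inf: "infinite (UNIV :: 'a set)"
    and Z: "compact_space Z" "metrizable_space Z" "topspace Z \<noteq> {}"
  obtains X :: "'a topology" and K :: "('c \<times> real) topology" and c
  where "compactification X K c" "metrizable_space K" "locally_compact_space X" "Hausdorff_space X"
    "topspace X \<noteq> {}" "Z homeomorphic_space subtopology K (remainder X K c)"
proof -
  obtain u :: "nat \<Rightarrow> 'a" where u: "inj u" using inf infinite_countable_subset by blast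
  obtain s :: "nat \<Rightarrow> 'c" where s: "range s \<subseteq> topspace Z"
    "\<forall>U N. openin Z U \<longrightarrow> U \<noteq> {} \<longrightarrow> (\<exists>n\<ge>N. s n \<in> U)"
    by (rule compact_metrizable_dense_sequence[OF Z])
  define r where "r n = inverse (real (Suc n))" for n
  have r: "0 < r n" "r n \<le> 1" for n by (auto simp: r_def inverse_le_1_iff)
  have r_anti: "r n \<le> r m" if "m \<le> n" for m n
    using that unfolding r_def by (intro le_imp_inverse_le) auto
  have r_inj: "r m = r n \<longleftrightarrow> m = n" for m n by (auto simp: r_def)
  define P where "P = prod_topology Z euclideanreal"
  define Q where "Q = range (\<lambda>n. (s n, r n))"
  define M where "M = topspace Z \<times> {0} \<union> Q"
  have MP: "M \<subseteq> topspace P" using s(1) by (auto simp: M_def Q_def P_def)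
  let ?K = "subtopology P M"
  define c where "c x = (s (inv u x), r (inv u x))" for x
  \<comment> \<open>The space lives on a copy of the naturals inside \<open>'a\<close>;
    \<open>c\<close> translates the labels into the points at heights \<open>r n\<close>.\<close>
  define X where "X = discrete_topology (range u)"
  have cu: "c (u n) = (s n, r n)" for n using u by (simp add: c_def)
  have cX: "c ` topspace X = Q" by (auto simp: X_def Q_def cu image_image)
  have openP: "openin P (topspace Z \<times> W)" if "open W" for W
    unfolding P_def using that by (simp add: openin_prod_Times_iff)
  have "closedin P M"
  proof -
    have "openin P (topspace P - M)"
      unfolding openin_subopen[of P "topspace P - M"]
    proof
      fix x assume x: "x \<in> topspace P - M"
      obtain z t where zt: "x = (z, t)" by force
      then have t: "t \<noteq> 0" "z \<in> topspace Z" using x by (auto simp: M_def P_def)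
      show "\<exists>T. openin P T \<and> x \<in> T \<and> T \<subseteq> topspace P - M"
      proof (cases "t < 0")
        case True
        then show ?thesis
          using openP[of "{..<0}"] t x r by (intro exI[of _ "topspace Z \<times> {..<0}"])
            (force simp: zt M_def Q_def P_def dest: less_asym)
      next
        case False
        then have "t > 0" using t by simp
        \<comment> \<open>Only points with index below \<open>N\<close> lie above height
          \<open>r N\<close>, so removing finitely many points from this open strip leaves a
          neighbourhood of \<open>x\<close> that misses \<open>M\<close>.\<close>
        then obtain N where N: "r N < t" using reals_Archimedean unfolding r_def by blast
        let ?F = "(\<lambda>n. (s n, r n)) ` {..N}"
        have "Hausdorff_space P"
          using metrizable_imp_Hausdorff_space[OF Z(2)] by (simp add: P_def Hausdorff_space_prod_topology)
        then have "closedin P ?F"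
          using s(1) by (intro closedin_Hausdorff_finite) (auto simp: P_def)
        then have "openin P (topspace Z \<times> {r N<..} - ?F)"
          using openP[of "{r N<..}"] by (intro openin_diff) auto
        moreover have "x \<in> topspace Z \<times> {r N<..} - ?F"
          using x t N by (auto simp: zt M_def Q_def)
        moreover have "topspace Z \<times> {r N<..} - ?F \<subseteq> topspace P - M"
        proof
          fix y assume y: "y \<in> topspace Z \<times> {r N<..} - ?F"
          have "y \<noteq> (s n, r n)" for n
          proof
            assume "y = (s n, r n)"
            moreover from this have "\<not> N \<le> n" using y r_anti[of N n] by auto
            ultimately show False using y by auto
          qed
          then show "y \<in> topspace P - M" using y r(1)[of N] by (auto simp: M_def Q_def P_def)
        qed
        ultimately show ?thesis by blast
      qed
    qed
    then show ?thesis using MP by (simp add: closedin_def)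
  qed
  moreover have "compactin P (topspace Z \<times> {0..1})"
    using Z(1) by (simp add: P_def compactin_Times compact_space_def)
  moreover have "M \<subseteq> topspace Z \<times> {0..1}"
    using s(1) r by (auto simp: M_def Q_def less_imp_le)
  ultimately have "compactin P M" using closed_compactin by blast
  then have "compact_space ?K" using compact_space_subtopology by blast
  have metP: "metrizable_space P"
    using Z(2) by (simp add: P_def metrizable_space_prod_topology metrizable_space_euclidean)
  then have "metrizable_space ?K" by (rule metrizable_space_subtopology)
  then have "Hausdorff_space ?K" by (rule metrizable_imp_Hausdorff_space)
  have disc: "subtopology P Q = discrete_topology Q"
  proof -
    have "openin (subtopology P Q) {(s n, r n)}" for n
    proof -
      \<comment> \<open>An open interval between the neighbouring heights isolates
        \<open>r n\<close>; the topmost point \<open>n = 0\<close> has no upper neighbour.\<close>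
      define W where "W = {r (Suc n)<..} \<inter> (if n = 0 then UNIV else {..<r (n - 1)})"
      have "r m \<in> W \<longleftrightarrow> m = n" for m
      proof
        assume "r m \<in> W"
        then have "\<not> Suc n \<le> m" "n = 0 \<or> \<not> m \<le> n - 1"
          using r_anti[of "Suc n" m] r_anti[of m "n - 1"] by (auto simp: W_def split: if_splits)
        then show "m = n" by linarith
      next
        assume "m = n"
        moreover have "r (Suc n) < r n" "n = 0 \<or> r n < r (n - 1)"
          using r_anti[of n "Suc n"] r_inj[of n "Suc n"] r_anti[of "n - 1" n] r_inj[of "n - 1" n]
          by linarith+
        ultimately show "r m \<in> W" by (auto simp: W_def)
      qed
      then have "{(s n, r n)} = (topspace Z \<times> W) \<inter> Q"
        using s(1) by (auto simp: Q_def)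
      moreover have "open W" by (auto simp: W_def)
      ultimately show ?thesis
        unfolding openin_subtopology using openP[of W] by blast
    qed
    moreover have "topspace (subtopology P Q) = Q" using MP by (auto simp: M_def)
    ultimately show ?thesis
      by (subst eq_commute, subst discrete_topology_unique) (auto simp: Q_def)
  qed
  have "embedding_map X ?K c"
  proof -
    have "homeomorphic_map (discrete_topology (range u)) (discrete_topology Q) c"
    proof (rule bijective_open_imp_homeomorphic_map)
      show "inj_on c (topspace (discrete_topology (range u)))"
        by (auto simp: inj_on_def cu r_inj)
      show "c ` topspace (discrete_topology (range u)) = topspace (discrete_topology Q)"
        using cX by (simp add: X_def)
      then show "continuous_map (discrete_topology (range u)) (discrete_topology Q) c"
        by auto
      show "open_map (discrete_topology (range u)) (discrete_topology Q) c"
        using cX by (auto simp: open_map_def X_def)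
    qed
    moreover have "M \<inter> Q = Q" by (auto simp: M_def)
    ultimately show ?thesis
      unfolding embedding_map_def cX subtopology_subtopology by (simp add: disc X_def)
  qed
  moreover have "?K closure_of Q = topspace ?K"
  proof
    show "topspace ?K \<subseteq> ?K closure_of Q"
    proof
      fix x assume x: "x \<in> topspace ?K"
      have "\<exists>y\<in>Q. y \<in> T" if T: "openin ?K T" "x \<in> T" for T
      proof (cases "x \<in> Q")
        case False
        then obtain z where z: "x = (z, 0)" "z \<in> topspace Z" using x by (auto simp: M_def)
        obtain T' where T': "openin P T'" "T = T' \<inter> M" using T(1) by (auto simp: openin_subtopology)
        then obtain U V where UV: "openin Z U" "open V" "z \<in> U" "0 \<in> V" "U \<times> V \<subseteq> T'"
          using T(2) z by (force simp: P_def openin_prod_topology_alt)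
        obtain e where e: "e > 0" "ball 0 e \<subseteq> V" using UV(2,4) open_contains_ball by blast
        obtain N where N: "r N < e" using reals_Archimedean[OF e(1)] unfolding r_def by blast
        \<comment> \<open>Density of the tail is essential: the point must lie over \<open>U\<close>
          and at the same time be low enough for its height to lie in \<open>V\<close>.\<close>
        obtain n where n: "N \<le> n" "s n \<in> U" using s(2) UV(1,3) by blast
        have "r n \<in> V" using e(2) N r_anti[OF n(1)] r(1)[of n] by (auto simp: subset_iff dist_real_def)
        then have "(s n, r n) \<in> T" using n(2) UV(5) T'(2) by (auto simp: M_def Q_def)
        then show ?thesis by (auto simp: Q_def)
      qed (use T in blast)
      then show "x \<in> ?K closure_of Q" unfolding in_closure_of using x by blast
    qed
  qed (rule closure_of_subset_topspace)
  ultimately have c: "compactification X ?K c"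
    unfolding compactification_def cX using \<open>compact_space ?K\<close> \<open>Hausdorff_space ?K\<close> by blast
  have rem: "remainder X ?K c = topspace Z \<times> {0}"
    using MP r by (auto simp: remainder_def cX M_def Q_def less_le)
  have "homeomorphic_maps Z (subtopology P (topspace Z \<times> {0})) (\<lambda>z. (z, 0)) fst"
    unfolding homeomorphic_maps_def
    by (auto simp: P_def continuous_map_in_subtopology intro!: continuous_map_pairedI
        continuous_map_from_subtopology continuous_map_fst)
  moreover have "subtopology ?K (remainder X ?K c) = subtopology P (topspace Z \<times> {0})"
    unfolding rem subtopology_subtopology by (simp add: M_def Int_absorb1)
  ultimately have "Z homeomorphic_space subtopology ?K (remainder X ?K c)"
    unfolding homeomorphic_space_def by auto
  then show ?thesis
    using that[OF c \<open>metrizable_space ?K\<close>] by (simp add: X_def locally_compact_space_discrete_topology)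
qed

section \<open>The corona functor is an equivalence\<close>

lemma is_iso_KM:
  assumes "homeomorphic_maps Y Z f g"
  shows "is_iso KM Y Z (restrict f (topspace Y))"
  unfolding is_iso_def
proof (intro conjI bexI[of _ "restrict g (topspace Z)"])
  have f: "continuous_map Y Z (restrict f (topspace Y))" and g: "continuous_map Z Y (restrict g (topspace Z))"
    using assms by (auto simp: homeomorphic_maps_def intro: continuous_map_eq)
  then show "restrict f (topspace Y) \<in> Hom KM Y Z" "restrict g (topspace Z) \<in> Hom KM Z Y"
    by (simp_all add: KM_simps)
  show "Comp KM Y Z Y (restrict g (topspace Z)) (restrict f (topspace Y)) = Ident KM Y"
    "Comp KM Z Y Z (restrict f (topspace Y)) (restrict g (topspace Z)) = Ident KM Z"
    using assms by (auto simp: KM_simps compose_def homeomorphic_maps_def continuous_map_def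
        intro!: restrict_ext)
qed

lemma corona_functor:
  "is_functor (CC :: ('a coarse_top, ('a \<Rightarrow> 'a) set) precategory) KM higson_corona corona_functor_map"
  (is "is_functor ?C _ _ _")
  unfolding is_functor_def
proof (intro conjI is_category_CC is_category_KM ballI)
  show "higson_corona A \<in> Obj KM" if A: "A \<in> Obj ?C" for A
  proof -
    interpret CC_objects A A using CC_objects A by blast
    have hs: "top_of_set (corona_set A) homeomorphic_space higson_corona A"
      using homeomorphic_higson_corona homeomorphic_map_imp_homeomorphic_space by blast
    have "compact_space (top_of_set (corona_set A))"
      using X.compact_boundary by (simp add: corona_set_def compact_space_subtopology)
    moreover have "metrizable_space (top_of_set (corona_set A))"
      using metrizable_space_euclidean metrizable_space_subtopology by blast
    ultimately show ?thesis
      using hs homeomorphic_compact_space homeomorphic_metrizable_space by (auto simp: KM_simps)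
  qed
  show "corona_functor_map A B \<Phi> \<in> Hom KM (higson_corona A) (higson_corona B)"
    if A: "A \<in> Obj ?C" and B: "B \<in> Obj ?C" and \<Phi>: "\<Phi> \<in> Hom ?C A B" for A B \<Phi>
  proof -
    interpret CC_objects A B using CC_objects A B by blast
    obtain f where f: "f \<in> coarse_maps A B" "\<Phi> = closeness A B `` {f}" using \<Phi> by (elim CC_HomE)
    show ?thesis
      using higson_corona_map_continuous[OF f(1)]
      by (simp add: f(2) corona_functor_map_class[OF f(1)] KM_simps higson_corona_map[OF f(1)])
  qed
  show "corona_functor_map A A (Ident ?C A) = Ident KM (higson_corona A)" if A: "A \<in> Obj ?C" for A
  proof -
    interpret CC_objects A A using CC_objects A by blast
    have "higson_corona_map A A (restrict id (topspace (fst A))) = restrict id (topspace (higson_corona A))"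
      unfolding higson_corona_map[OF coarse_maps_id(1)[OF A]] coarse_maps_id(2)[OF A] topspace_higson_corona
      using inj_corona_coord by (intro restrict_ext) auto
    then show ?thesis
      by (simp add: CC_simps(2) KM_simps corona_functor_map_class[OF coarse_maps_id(1)[OF A]])
  qed
  show "corona_functor_map A D (Comp ?C A B D \<Gamma> \<Phi>) =
      Comp KM (higson_corona A) (higson_corona B) (higson_corona D)
        (corona_functor_map B D \<Gamma>) (corona_functor_map A B \<Phi>)"
    if A: "A \<in> Obj ?C" and B: "B \<in> Obj ?C" and D: "D \<in> Obj ?C"
      and \<Phi>: "\<Phi> \<in> Hom ?C A B" and \<Gamma>: "\<Gamma> \<in> Hom ?C B D" for A B D \<Phi> \<Gamma>
  proof -
    interpret AB: CC_objects A B using CC_objects A B by blast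
    interpret BD: CC_objects B D using CC_objects B D by blast
    interpret AD: CC_objects A D using CC_objects A D by blast
    obtain f where f: "f \<in> coarse_maps A B" "\<Phi> = closeness A B `` {f}" using \<Phi> by (elim CC_HomE)
    obtain g where g: "g \<in> coarse_maps B D" "\<Gamma> = closeness B D `` {g}" using \<Gamma> by (elim CC_HomE)
    note gf = coarse_maps_compose[OF A B D f(1) g(1)]
    have "higson_corona_map A D (compose (topspace (fst A)) g f) =
        compose (topspace (higson_corona A)) (higson_corona_map B D g) (higson_corona_map A B f)"
    proof (rule extensionalityI)
      fix t assume "t \<in> topspace (higson_corona A)"
      then obtain p where "p \<in> corona_set A" "t = corona_coord A p"
        unfolding AB.topspace_higson_corona by blast
      then show "higson_corona_map A D (compose (topspace (fst A)) g f) t =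
          compose (topspace (higson_corona A)) (higson_corona_map B D g) (higson_corona_map A B f) t"
        using AD.higson_corona_map_coord[OF gf(1)] AB.higson_corona_map_coord[OF f(1)]
          BD.higson_corona_map_coord[OF g(1)] AB.boundary_map(1)[OF f(1)] gf(2)
        by (simp add: compose_def AB.topspace_higson_corona)
    qed (simp_all add: AD.higson_corona_map[OF gf(1)])
    then show ?thesis
      by (simp add: f(2) g(2) CC_Comp_class[OF A B D f(1) g(1)] KM_simps
          AB.corona_functor_map_class[OF f(1)] BD.corona_functor_map_class[OF g(1)]
          AD.corona_functor_map_class[OF gf(1)])
  qed
qed

lemma corona_functor_faithful:
  assumes A: "A \<in> Obj CC" and B: "B \<in> Obj CC" and \<Phi>: "\<Phi> \<in> Hom CC A B" and \<Gamma>: "\<Gamma> \<in> Hom CC A B"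
    and eq: "corona_functor_map A B \<Phi> = corona_functor_map A B \<Gamma>"
  shows "\<Phi> = \<Gamma>"
proof -
  interpret CC_objects A B using CC_objects A B by blast
  obtain f where f: "f \<in> coarse_maps A B" "\<Phi> = closeness A B `` {f}" using \<Phi> by (elim CC_HomE)
  obtain g where g: "g \<in> coarse_maps A B" "\<Gamma> = closeness A B `` {g}" using \<Gamma> by (elim CC_HomE)
  have "boundary_map A B f = boundary_map A B g"
    using eq higson_corona_map_inject[OF f(1) g(1)]
    by (simp add: f(2) g(2) corona_functor_map_class f(1) g(1))
  then show ?thesis using closeness_class_eq[OF f(1) g(1)] f(2) g(2) by simp
qed

lemma corona_functor_full:
  assumes A: "A \<in> Obj CC" and B: "B \<in> Obj CC"
    and k: "k \<in> Hom KM (higson_corona A) (higson_corona B)"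
  shows "\<exists>\<Phi>\<in>Hom CC A B. corona_functor_map A B \<Phi> = k"
proof -
  interpret CC_objects A B using CC_objects A B by blast
  interpret BA: CC_objects B A using CC_objects A B by blast
  have kc: "continuous_map (higson_corona A) (higson_corona B) k" "k \<in> extensional (topspace (higson_corona A))"
    using k by (simp_all add: KM_simps)
  obtain l where l: "homeomorphic_maps (top_of_set (corona_set B)) (higson_corona B) (corona_coord B) l"
    using BA.homeomorphic_higson_corona homeomorphic_map_maps by blast
  \<comment> \<open>The given corona map is transported to the chosen boundaries, where a coarse map
    realises it.\<close>
  let ?h = "l \<circ> k \<circ> corona_coord A"
  have "continuous_map (top_of_set (corona_set A)) (top_of_set (corona_set B)) ?h"
    using homeomorphic_imp_continuous_map[OF homeomorphic_higson_corona] kc(1) l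
    unfolding homeomorphic_maps_def by (meson continuous_map_compose)
  then have "continuous_on (corona_set A) ?h" "?h ` corona_set A \<subseteq> corona_set B"
    unfolding continuous_map_in_subtopology by (simp_all add: image_subset_iff_funcset o_def)
  then obtain f where f: "f \<in> coarse_maps A B" "boundary_map A B f = restrict ?h (corona_set A)"
    by (rule boundary_map_full)
  have "higson_corona_map A B f = k"
  proof (rule extensionalityI[OF _ kc(2)])
    fix t assume t: "t \<in> topspace (higson_corona A)"
    then obtain p where p: "p \<in> corona_set A" "t = corona_coord A p"
      unfolding topspace_higson_corona by blast
    have "k t \<in> topspace (higson_corona B)" using continuous_map_funspace[OF kc(1)] t by blast
    then have "corona_coord B (l (k t)) = k t" using l by (simp add: homeomorphic_maps_def)
    then show "higson_corona_map A B f t = k t"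
      using higson_corona_map_coord[OF f(1) p(1)] f(2) p by simp
  qed (simp add: higson_corona_map[OF f(1)])
  then show ?thesis using CC_HomI[OF f(1)] corona_functor_map_class[OF f(1)] by metis
qed

text \<open>Infinity of \<open>'a\<close> makes room for the countable discrete space whose
  remainder is \<open>Z\<close>.\<close>

lemma corona_functor_essentially_surjective:
  fixes Z :: "(('a \<Rightarrow> real) \<Rightarrow> real) topology"
  assumes inf: "infinite (UNIV :: 'a set)" and Z: "Z \<in> Obj KM"
  shows "\<exists>A\<in>Obj CC. \<exists>e. is_iso KM (higson_corona A) Z e"
proof -
  have cm: "compact_space Z" "metrizable_space Z" using Z by (simp_all add: KM_simps)
  have *: "\<exists>A\<in>Obj CC. \<exists>e. is_iso KM (higson_corona A) Z e"
    if c: "compactification X K c" "metrizable_space K" "topspace X \<noteq> {}" "locally_compact_space X"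
      "Hausdorff_space X" and h: "Z homeomorphic_space subtopology K (remainder X K c)"
    for X :: "'a topology" and K :: "'c topology" and c
  proof -
    obtain i :: "'a \<Rightarrow> nat \<Rightarrow> real" where i: "compactified_space X i"
      "controlled X i = cc_structure X K c"
      "subtopology K (remainder X K c) homeomorphic_space top_of_set (boundary X i)"
      by (rule compactification_realized[OF c(1,2,4)])
    have "top_of_set (boundary X i) homeomorphic_space higson_corona (X, cc_structure X K c)"
      using homeomorphic_map_imp_homeomorphic_space[OF compactified_space.homeomorphic_corona[OF i(1)]]
      by (simp only: i(2))
    then have "higson_corona (X, cc_structure X K c) homeomorphic_space Z"
      using h i(3) by (meson homeomorphic_space_trans homeomorphic_space_sym)
    then show ?thesis
      using CC_objI[OF c] is_iso_KM unfolding homeomorphic_space_def by blast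
  qed
  show ?thesis
  proof (cases "topspace Z = {}")
    case False
    obtain X :: "'a topology" and K :: "((('a \<Rightarrow> real) \<Rightarrow> real) \<times> real) topology" and c
      where "compactification X K c" "metrizable_space K" "locally_compact_space X" "Hausdorff_space X"
        "topspace X \<noteq> {}" "Z homeomorphic_space subtopology K (remainder X K c)"
      by (rule remainder_of_discrete_space[OF inf cm False])
    then show ?thesis using * by blast
  next
    case True
    \<comment> \<open>The empty corona must come from a nonempty space: a one-point space is its own
      compactification and has empty remainder.\<close>
    let ?X = "discrete_topology {undefined :: 'a}"
    have "homeomorphic_map ?X ?X id" by (rule homeomorphic_map_id[THEN iffD2]) simp
    then have "compactification ?X ?X id"
      using closure_of_topspace[of ?X]
      by (simp add: compactification_def embedding_map_def compact_space_discrete_topology)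
    moreover have "Z homeomorphic_space subtopology ?X (remainder ?X ?X id)"
      using True by (simp add: remainder_def homeomorphic_empty_space_eq)
    ultimately show ?thesis
      by (intro *[of ?X ?X id]) (simp_all add: locally_compact_space_discrete_topology)
  qed
qed

theorem corollary4p7:
  shows "(infinite (UNIV :: 'a set) \<longrightarrow>
            is_equivalence_of_categories (CC :: ('a coarse_top, ('a \<Rightarrow> 'a) set) precategory) KM
              higson_corona corona_functor_map) \<and>
         (\<forall>(X :: 'x topology) (K1 :: 'k topology) i1 (K2 :: 'l topology) i2.
            locally_compact_space X \<and> Hausdorff_space X \<and>
            compactification X K1 i1 \<and> metrizable_space K1 \<and>
            compactification X K2 i2 \<and> metrizable_space K2 \<longrightarrow>
            (coarsely_equivalent (topspace X) (cc_structure X K1 i1)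
                                 (topspace X) (cc_structure X K2 i2) \<longleftrightarrow>
             subtopology K1 (remainder X K1 i1) homeomorphic_space
             subtopology K2 (remainder X K2 i2)))"
proof (intro conjI impI allI)
  assume inf: "infinite (UNIV :: 'a set)"
  show "is_equivalence_of_categories (CC :: ('a coarse_top, ('a \<Rightarrow> 'a) set) precategory) KM
      higson_corona corona_functor_map"
    by (rule equivalence_of_categoriesI[OF corona_functor corona_functor_full
          corona_functor_faithful corona_functor_essentially_surjective[OF inf]])
next
  fix X :: "'x topology" and K1 :: "'k topology" and i1 and K2 :: "'l topology" and i2
  assume a: "locally_compact_space X \<and> Hausdorff_space X \<and>
            compactification X K1 i1 \<and> metrizable_space K1 \<and>
            compactification X K2 i2 \<and> metrizable_space K2"
  obtain i :: "'x \<Rightarrow> nat \<Rightarrow> real" where i: "compactified_space X i"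
    "controlled X i = cc_structure X K1 i1"
    "subtopology K1 (remainder X K1 i1) homeomorphic_space top_of_set (boundary X i)"
    by (rule compactification_realized[of X K1 i1]) (use a in blast)+
  obtain j :: "'x \<Rightarrow> nat \<Rightarrow> real" where j: "compactified_space X j"
    "controlled X j = cc_structure X K2 i2"
    "subtopology K2 (remainder X K2 i2) homeomorphic_space top_of_set (boundary X j)"
    by (rule compactification_realized[of X K2 i2]) (use a in blast)+
  \<comment> \<open>The same \<open>X\<close> appears on both sides with different embeddings, so
    the emptiness condition of \<open>coarsely_equivalent_iff\<close> holds trivially.\<close>
  interpret compactified_pair X i X j using i(1) j(1) by (simp add: compactified_pair_def)
  have "coarsely_equivalent (topspace X) (cc_structure X K1 i1) (topspace X) (cc_structure X K2 i2) \<longleftrightarrow>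
      top_of_set (boundary X i) homeomorphic_space top_of_set (boundary X j)"
    unfolding i(2)[symmetric] j(2)[symmetric] by (rule coarsely_equivalent_iff) simp
  also have "\<dots> \<longleftrightarrow> subtopology K1 (remainder X K1 i1) homeomorphic_space top_of_set (boundary X j)"
    using i(3) homeomorphic_space_sym homeomorphic_space_trans by metis
  also have "\<dots> \<longleftrightarrow> subtopology K1 (remainder X K1 i1) homeomorphic_space subtopology K2 (remainder X K2 i2)"
    using j(3) homeomorphic_space_sym homeomorphic_space_trans by metis
  finally show "coarsely_equivalent (topspace X) (cc_structure X K1 i1) (topspace X) (cc_structure X K2 i2) \<longleftrightarrow>
      subtopology K1 (remainder X K1 i1) homeomorphic_space subtopology K2 (remainder X K2 i2)" .
qed

end
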